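(* Every $C^1$ action of a finite cyclic group on a closed 3-manifold $M$ is conjugated to a smooth action.
   Context: $M$ is a smooth closed (compact, without boundary) 3-manifold. A $C^1$ action of a group $G$ is an action in which every element acts by a $C^1$ diffeomorphism; no bound on the derivatives is assumed. The action is conjugated to a smooth action if there is a homeomorphism $h:M\to M$ such that $h\circ g\circ h^{-1}$ is a $C^\infty$ diffeomorphism of $M$ for every $g\in G$. *)

theory Defs
  imports
    "HOL-Analysis.Analysis"
    "HOL-Algebra.Elementary_Groups"
    "HOL-Algebra.Group_Action"
begin

section \<open>Functions of class \<open>C\<^sup>r\<close> on open sets\<close>

text \<open>
  A function on an open subset \<open>S\<close> of a Euclidean space is of class \<open>C\<^sup>n\<close> if all its iterated
  directional derivatives up to order \<open>n\<close> exist as Frechet derivatives and are continuous on \<open>S\<close>.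
  The derivatives are taken at points of the whole space, so \<open>S\<close> must be open; for
  open \<open>S\<close> only the values of \<open>f\<close> on \<open>S\<close> matter.
\<close>

primrec Cn_on ::
  "nat \<Rightarrow> ('a::euclidean_space \<Rightarrow> 'b::euclidean_space) \<Rightarrow> 'a set \<Rightarrow> bool" where
  "Cn_on 0 f S \<longleftrightarrow> continuous_on S f"
| "Cn_on (Suc n) f S \<longleftrightarrow>
     (\<forall>x\<in>S. f differentiable (at x)) \<and>
     (\<forall>v. Cn_on n (\<lambda>x. frechet_derivative f (at x) v) S)"

definition Cr_on ::
  "enat \<Rightarrow> ('a::euclidean_space \<Rightarrow> 'b::euclidean_space) \<Rightarrow> 'a set \<Rightarrow> bool" where
  "Cr_on r f S \<longleftrightarrow> (\<forall>n. enat n \<le> r \<longrightarrow> Cn_on n f S)"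


section \<open>Smooth manifolds\<close>

text \<open>A chart is a pair of its domain and its coordinate map.\<close>

type_synonym ('a, 'e) chart = "'a set \<times> ('a \<Rightarrow> 'e)"

definition chart_on :: "'a topology \<Rightarrow> ('a, 'e::euclidean_space) chart \<Rightarrow> bool" where
  "chart_on X c \<longleftrightarrow> (case c of (U, \<phi>) \<Rightarrow>
     openin X U \<and> open (\<phi> ` U) \<and> homeomorphic_map (subtopology X U) (top_of_set (\<phi> ` U)) \<phi>)"

definition smooth_atlas :: "'a topology \<Rightarrow> ('a, 'e::euclidean_space) chart set \<Rightarrow> bool" where
  "smooth_atlas X \<A> \<longleftrightarrow>
     (\<forall>c\<in>\<A>. chart_on X c) \<and>
     \<Union> (fst ` \<A>) = topspace X \<and>
     (\<forall>(U, \<phi>)\<in>\<A>. \<forall>(V, \<psi>)\<in>\<A>. Cr_on \<infinity> (\<psi> \<circ> inv_into U \<phi>) (\<phi> ` (U \<inter> V)))"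

text \<open>
  The atlas is not required to be maximal: it determines the smooth structure, and the
  \<open>C\<^sup>r\<close> maps below are the same for an atlas and for the maximal atlas containing it.
  Charts have open image in the model space, so there is no boundary.
\<close>

locale smooth_manifold =
  fixes X :: "'a topology" and \<A> :: "('a, 'e::euclidean_space) chart set"
  assumes Hausdorff: "Hausdorff_space X"
    and second_countable: "second_countable X"
    and atlas: "smooth_atlas X \<A>"

locale closed_smooth_manifold = smooth_manifold +
  assumes compact: "compact_space X"


section \<open>Diffeomorphisms and actions\<close>

text \<open>Self-maps are only considered on the carrier \<^term>\<open>topspace X\<close>.\<close>

definition Cr_map ::
  "enat \<Rightarrow> 'a topology \<Rightarrow> ('a, 'e::euclidean_space) chart set \<Rightarrow> ('a \<Rightarrow> 'a) \<Rightarrow> bool" where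
  "Cr_map r X \<A> f \<longleftrightarrow>
     continuous_map X X f \<and>
     (\<forall>(U, \<phi>)\<in>\<A>. \<forall>(V, \<psi>)\<in>\<A>. Cr_on r (\<psi> \<circ> f \<circ> inv_into U \<phi>) (\<phi> ` (U \<inter> f -` V)))"

definition Cr_diffeo ::
  "enat \<Rightarrow> 'a topology \<Rightarrow> ('a, 'e::euclidean_space) chart set \<Rightarrow> ('a \<Rightarrow> 'a) \<Rightarrow> bool" where
  "Cr_diffeo r X \<A> f \<longleftrightarrow>
     (\<exists>f'. homeomorphic_maps X X f f' \<and> Cr_map r X \<A> f \<and> Cr_map r X \<A> f')"

definition Cr_action ::
  "enat \<Rightarrow> ('g, 'm) monoid_scheme \<Rightarrow> 'a topology \<Rightarrow> ('a, 'e::euclidean_space) chart set \<Rightarrow>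
   ('g \<Rightarrow> 'a \<Rightarrow> 'a) \<Rightarrow> bool" where
  "Cr_action r G X \<A> \<rho> \<longleftrightarrow>
     group_action G (topspace X) \<rho> \<and> (\<forall>g\<in>carrier G. Cr_diffeo r X \<A> (\<rho> g))"

definition conjugated_to_smooth_action ::
  "('g, 'm) monoid_scheme \<Rightarrow> 'a topology \<Rightarrow> ('a, 'e::euclidean_space) chart set \<Rightarrow>
   ('g \<Rightarrow> 'a \<Rightarrow> 'a) \<Rightarrow> bool" where
  "conjugated_to_smooth_action G X \<A> \<rho> \<longleftrightarrow>
     (\<exists>h h'. homeomorphic_maps X X h h' \<and>
        (\<forall>g\<in>carrier G. Cr_diffeo \<infinity> X \<A> (h \<circ> \<rho> g \<circ> h')))"

end

(*
  Idea (Bochner, Hirsch, Palais). In a C^1 chart around p, averaging over the stabilizer of p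
  linearizes it, so X is covered by finitely many invariant tubes on which the action is smooth in
  suitable C^1 coordinates. These coordinates are not smoothly compatible with each other, but a
  C^1 chart psi can be replaced by theta o psi, where theta is a compactly supported C^1-small
  perturbation of the identity of R^n, so that it becomes smooth near a compact set with respect to
  a given smooth structure; averaging theta preserves equivariance. Gluing the tubes one after the
  other gives a smooth structure C on X, C^1-compatible with the original structure A, for which the
  action is smooth. The same perturbations, applied to the charts of C, deform the identity of X into
  a diffeomorphism k : (X, A) -> (X, C), and k^-1 conjugates the action to one that is smooth for A.
*)

theory Submission
  imports Defs
begin

section \<open>Calculus of \<open>C\<^sup>r\<close> functions\<close>

text \<open>A chart is only ever changed by composing it with a perturbation \<open>\<theta>\<close>
  of its Euclidean target. This leaves its domain untouched, and if \<open>\<theta>\<close> minus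
  the identity has Lipschitz constant at most 1/2, injectivity and C^1 regularity persist. The
  obstacle is that a later correction must not spoil an earlier one. Hence the correction is a
  mollification weighted by cutoffs that are smooth in the coordinates of the structure aimed at:
  wherever the chart was already smooth for that structure, it remains so. Regularity is then
  obtained in two stages: invertibility comes from the C^1 level, where it is stable under small
  changes, and afterwards only smoothness of the transition map has to be seen, because a C^1
  diffeomorphism germ that is smooth has a smooth inverse. All local statements are phrased with
  germs of maps, so that averages and composites with group elements can be compared without
  tracking domains.\<close>

lemma Cn_on_cong:
  assumes "open S" "\<And>x. x \<in> S \<Longrightarrow> f x = g x" "Cn_on n f S"
  shows "Cn_on n g S"
  using assms(2,3)
proof (induction n arbitrary: f g)
  case 0
  then show ?case by (simp cong: continuous_on_cong)
next
  case (Suc n)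
  have d: "(f has_derivative frechet_derivative f (at x)) (at x)" if "x \<in> S" for x
    using Suc.prems that by (simp add: frechet_derivative_works)
  have d': "(g has_derivative frechet_derivative f (at x)) (at x)" if "x \<in> S" for x
    using has_derivative_transform_within_open[OF d[OF that] \<open>open S\<close> that] Suc.prems(1) by blast
  have eq: "frechet_derivative f (at x) v = frechet_derivative g (at x) v" if "x \<in> S" for x v
    using frechet_derivative_at[OF d'[OF that]] by simp
  show ?case
    using Suc.prems d' eq Suc.IH[OF eq] by (auto simp: differentiable_def)
qed

text \<open>Derivatives are unique, so an explicit \<open>D\<close> may replace the choice hidden in
  \<open>frechet_derivative\<close>; the inductive steps below go through this rule.\<close>

lemma Cn_onI:
  assumes "open S" "\<And>x. x \<in> S \<Longrightarrow> (f has_derivative D x) (at x)"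
    and "\<And>v. Cn_on n (\<lambda>x. D x v) S"
  shows "Cn_on (Suc n) f S"
proof -
  have "frechet_derivative f (at x) = D x" if "x \<in> S" for x
    using frechet_derivative_at[OF assms(2)[OF that]] by simp
  then show ?thesis
    using assms(2) Cn_on_cong[OF assms(1) _ assms(3)] by (auto simp: differentiable_def)
qed

lemma Cn_onD:
  assumes "Cn_on (Suc n) f S" "x \<in> S"
  shows "(f has_derivative frechet_derivative f (at x)) (at x)"
  using assms by (simp add: frechet_derivative_works)

lemma Cn_onD2: "Cn_on (Suc n) f S \<Longrightarrow> Cn_on n (\<lambda>x. frechet_derivative f (at x) v) S"
  by simp

lemma Cn_on_Suc_D: "Cn_on (Suc n) f S \<Longrightarrow> Cn_on n f S"
proof (induction n arbitrary: f)
  case 0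
  then show ?case
    by (auto intro!: continuous_at_imp_continuous_on differentiable_imp_continuous_within)
next
  case (Suc n)
  then have "Cn_on (Suc n) (\<lambda>x. frechet_derivative f (at x) v) S" for v
    using Cn_onD2 by blast
  then show ?case using Suc by auto
qed

lemma Cn_on_le: "m \<le> n \<Longrightarrow> Cn_on n f S \<Longrightarrow> Cn_on m f S"
  by (induction n rule: dec_induct) (use Cn_on_Suc_D in blast)+

lemma Cn_on_continuous: "Cn_on n f S \<Longrightarrow> continuous_on S f"
  using Cn_on_le[of 0 n] by simp

lemma Cn_on_subset: "Cn_on n f S \<Longrightarrow> T \<subseteq> S \<Longrightarrow> Cn_on n f T"
  by (induction n arbitrary: f) (auto intro: continuous_on_subset)

lemma Cn_on_local:
  assumes "\<And>x. x \<in> S \<Longrightarrow> \<exists>U. open U \<and> x \<in> U \<and> Cn_on n f U"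
  shows "Cn_on n f S"
  using assms
proof (induction n arbitrary: f)
  case 0
  then show ?case
    by (metis Cn_on.simps(1) continuous_at_imp_continuous_on continuous_on_eq_continuous_at)
next
  case (Suc n)
  have "f differentiable at x" if "x \<in> S" for x
    using Suc.prems[OF that] by auto
  moreover have "Cn_on n (\<lambda>x. frechet_derivative f (at x) v) S" for v
    by (rule Suc.IH) (use Suc.prems in force)
  ultimately show ?case by simp
qed

section \<open>Closure of the class C^n under algebraic operations, composition and
  inversion\<close>

lemma Cn_on_const: "open S \<Longrightarrow> Cn_on n (\<lambda>x. c) S"
  by (induction n arbitrary: c) (auto intro!: Cn_onI[where D="\<lambda>x v. 0"] simp del: Cn_on.simps(2))

lemma Cn_on_bounded_linear:
  assumes "open S" "bounded_linear f"
  shows "Cn_on n f S"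
proof (cases n)
  case 0
  then show ?thesis using assms by (simp add: linear_continuous_on)
next
  case (Suc m)
  then show ?thesis
    using assms by (auto intro!: Cn_onI[where D="\<lambda>x. f"] Cn_on_const bounded_linear_imp_has_derivative
        simp del: Cn_on.simps(2))
qed

lemma Cn_on_id: "open S \<Longrightarrow> Cn_on n (\<lambda>x. x) S"
  by (simp add: Cn_on_bounded_linear)

lemma Cn_on_add:
  assumes "open S" "Cn_on n f S" "Cn_on n g S"
  shows "Cn_on n (\<lambda>x. f x + g x) S"
  using assms(2,3)
proof (induction n arbitrary: f g)
  case 0
  then show ?case by (simp add: continuous_on_add)
next
  case (Suc n)
  show ?case
  proof (rule Cn_onI[OF assms(1)])
    show "((\<lambda>x. f x + g x) has_derivative (\<lambda>v. frechet_derivative f (at x) v + frechet_derivative g (at x) v)) (at x)"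
      if "x \<in> S" for x
      using Cn_onD[OF Suc.prems(1) that] Cn_onD[OF Suc.prems(2) that] by (rule has_derivative_add)
    show "Cn_on n (\<lambda>x. frechet_derivative f (at x) v + frechet_derivative g (at x) v) S" for v
      using Suc.prems Suc.IH by simp
  qed
qed

lemma Cn_on_sum:
  assumes "open S" "\<And>i. i \<in> I \<Longrightarrow> Cn_on n (f i) S"
  shows "Cn_on n (\<lambda>x. \<Sum>i\<in>I. f i x) S"
  using assms(2)
  by (induction I rule: infinite_finite_induct) (auto intro!: Cn_on_const Cn_on_add assms(1))

lemma Cn_on_bilinear:
  fixes prod :: "'a::euclidean_space \<Rightarrow> 'b::euclidean_space \<Rightarrow> 'c::euclidean_space"
    and f :: "'d::euclidean_space \<Rightarrow> 'a" and g :: "'d \<Rightarrow> 'b"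
  assumes "bounded_bilinear prod" "open S" "Cn_on n f S" "Cn_on n g S"
  shows "Cn_on n (\<lambda>x. prod (f x) (g x)) S"
  using assms(3,4)
proof (induction n arbitrary: f g)
  case 0
  then show ?case by (simp add: bounded_bilinear.continuous_on[OF assms(1)])
next
  case (Suc n)
  show ?case
  proof (rule Cn_onI[OF assms(2)])
    show "((\<lambda>x. prod (f x) (g x)) has_derivative
        (\<lambda>v. prod (f x) (frechet_derivative g (at x) v) + prod (frechet_derivative f (at x) v) (g x))) (at x)"
      if "x \<in> S" for x
      using bounded_bilinear.FDERIV[OF assms(1) Cn_onD[OF Suc.prems(1) that] Cn_onD[OF Suc.prems(2) that]] .
    show "Cn_on n (\<lambda>x. prod (f x) (frechet_derivative g (at x) v) + prod (frechet_derivative f (at x) v) (g x)) S" for v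
      using Suc.prems Cn_on_Suc_D[OF Suc.prems(1)] Cn_on_Suc_D[OF Suc.prems(2)]
      by (intro Cn_on_add assms(2) Suc.IH) auto
  qed
qed

lemmas Cn_on_scaleR = Cn_on_bilinear[OF bounded_bilinear_scaleR]
lemmas Cn_on_mult = Cn_on_bilinear[OF bounded_bilinear_mult]
lemmas Cn_on_inner = Cn_on_bilinear[OF bounded_bilinear_inner]

lemma Cn_on_linear_comp:
  fixes L :: "'b::euclidean_space \<Rightarrow> 'c::euclidean_space"
  assumes "bounded_linear L" "open S" "Cn_on n f S"
  shows "Cn_on n (\<lambda>x. L (f x)) S"
  using assms(3)
proof (induction n arbitrary: f)
  case 0
  then show ?case using bounded_linear.continuous_on[OF assms(1)] by simp
next
  case (Suc n)
  show ?case
    using Suc.prems Suc.IH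
    by (intro Cn_onI[OF assms(2), where D="\<lambda>x v. L (frechet_derivative f (at x) v)"]
        bounded_linear.has_derivative[OF assms(1)] Cn_onD) auto
qed

lemma Cn_on_diff:
  assumes "open S" "Cn_on n f S" "Cn_on n g S"
  shows "Cn_on n (\<lambda>x. f x - g x) S"
  using Cn_on_add[OF assms(1,2) Cn_on_linear_comp[OF _ assms(1,3), of uminus]]
  by (simp add: bounded_linear_minus)

lemma Cn_on_compose:
  fixes f :: "'a::euclidean_space \<Rightarrow> 'b::euclidean_space" and g :: "'b \<Rightarrow> 'c::euclidean_space"
  assumes "open S" "open T" "Cn_on n f S" "Cn_on n g T" "f ` S \<subseteq> T"
  shows "Cn_on n (\<lambda>x. g (f x)) S"
  using assms(3,4)
proof (induction n arbitrary: g)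
  case 0
  then show ?case using assms(5) by (auto intro: continuous_on_compose2)
next
  case (Suc n)
  \<comment> \<open>\<open>Cn_on\<close> controls derivatives in fixed directions, but the chain
    rule applies the derivative of \<open>g\<close> to the moving vector
    \<open>frechet_derivative f (at x) v\<close>. Expanding that vector in the basis leaves fixed
    directions with C^n coefficients.\<close>
  let ?D = "\<lambda>x v. \<Sum>b\<in>Basis. (frechet_derivative f (at x) v \<bullet> b) *\<^sub>R frechet_derivative g (at (f x)) b"
  show ?case
  proof (rule Cn_onI[OF assms(1), where D="?D"])
    show "((\<lambda>x. g (f x)) has_derivative ?D x) (at x)" if "x \<in> S" for x
    proof -
      have "f x \<in> T" using that assms(5) by auto
      then have g: "(g has_derivative frechet_derivative g (at (f x))) (at (f x))"
        using Cn_onD Suc.prems(2) by blast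
      interpret bounded_linear "frechet_derivative g (at (f x))"
        using g by (rule has_derivative_bounded_linear)
      have "?D x = frechet_derivative g (at (f x)) \<circ> frechet_derivative f (at x)"
      proof
        fix v
        have "frechet_derivative g (at (f x)) (frechet_derivative f (at x) v)
          = frechet_derivative g (at (f x)) (\<Sum>b\<in>Basis. (frechet_derivative f (at x) v \<bullet> b) *\<^sub>R b)"
          by (simp add: euclidean_representation)
        then show "?D x v = (frechet_derivative g (at (f x)) \<circ> frechet_derivative f (at x)) v"
          by (simp add: sum scaleR)
      qed
      then show ?thesis
        using diff_chain_at[OF Cn_onD[OF Suc.prems(1) that] g] by (simp add: o_def)
    qed
    show "Cn_on n (\<lambda>x. ?D x v) S" for v
      using Suc.prems Cn_on_Suc_D[OF Suc.prems(1)]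
      by (intro Cn_on_sum Cn_on_scaleR Suc.IH Cn_on_inner Cn_on_const assms(1)) auto
  qed
qed

lemma Cn_on_inverse_real:
  fixes a :: "'a::euclidean_space \<Rightarrow> real"
  assumes "open S" "Cn_on n a S" "\<And>x. x \<in> S \<Longrightarrow> a x \<noteq> 0"
  shows "Cn_on n (\<lambda>x. inverse (a x)) S"
  using assms(2)
proof (induction n)
  case 0
  then show ?case using assms(3) by (auto intro!: continuous_intros)
next
  case (Suc n)
  show ?case
  proof (rule Cn_onI[OF assms(1)])
    show "((\<lambda>x. inverse (a x)) has_derivative
      (\<lambda>v. - (inverse (a x) * frechet_derivative a (at x) v * inverse (a x)))) (at x)" if "x \<in> S" for x
      using Deriv.has_derivative_inverse[OF assms(3)[OF that] Cn_onD[OF Suc.prems that]] .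
    show "Cn_on n (\<lambda>x. - (inverse (a x) * frechet_derivative a (at x) v * inverse (a x))) S" for v
      using Suc.prems Cn_on_Suc_D[OF Suc.prems]
      by (intro Cn_on_linear_comp[OF bounded_linear_minus[OF bounded_linear_ident]] Cn_on_mult Suc.IH assms(1)) auto
  qed
qed

lemma Cn_on_prod:
  fixes f :: "'i \<Rightarrow> 'a::euclidean_space \<Rightarrow> real"
  assumes "open S" "\<And>i. i \<in> I \<Longrightarrow> Cn_on n (f i) S"
  shows "Cn_on n (\<lambda>x. \<Prod>i\<in>I. f i x) S"
  using assms(2)
  by (induction I rule: infinite_finite_induct) (auto intro!: Cn_on_const Cn_on_mult assms(1))

lemma Cn_on_det:
  fixes M :: "'a::euclidean_space \<Rightarrow> real^'n^'n"
  assumes "open S" "\<And>i j. Cn_on n (\<lambda>x. M x $ i $ j) S"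
  shows "Cn_on n (\<lambda>x. det (M x)) S"
  unfolding det_def
  by (intro Cn_on_sum Cn_on_mult Cn_on_const Cn_on_prod assms)

lemma Cn_on_vec:
  fixes f :: "'a::euclidean_space \<Rightarrow> real^'n"
  assumes "open S" "\<And>i. Cn_on n (\<lambda>x. f x $ i) S"
  shows "Cn_on n f S"
proof -
  have "Cn_on n (\<lambda>x. \<Sum>i\<in>UNIV. f x $ i *\<^sub>R (axis i 1 :: real^'n)) S"
    by (intro Cn_on_sum Cn_on_scaleR Cn_on_const assms)
  then show ?thesis
    by (simp add: basis_expansion scalar_mult_eq_scaleR[symmetric])
qed

lemma Cn_on_vec_nth: "open S \<Longrightarrow> Cn_on n f S \<Longrightarrow> Cn_on n (\<lambda>x. f x $ i) S"
  by (rule Cn_on_linear_comp[OF bounded_linear_vec_nth])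

text \<open>Smoothness of the derivative of the inverse is read off Cramer's rule.\<close>

lemma Cn_on_inverse:
  fixes T :: "real^'n \<Rightarrow> real^'n"
  assumes V: "open V" and T: "Cn_on (Suc m) T V"
    and D: "\<And>x. x \<in> V \<Longrightarrow> inj (frechet_derivative T (at x))"
    and g: "\<And>x. x \<in> V \<Longrightarrow> g (T x) = x"
  shows "open (T ` V)" and "Cn_on (Suc m) g (T ` V)"
proof -
  have "inj_on T V" by (metis g inj_onI)
  then show oTV: "open (T ` V)"
    using invariance_of_domain Cn_on_continuous[OF T] V by blast
  define A where "A x = matrix (frechet_derivative T (at x))" for x
  \<comment> \<open>\<open>J v x\<close> solves the linear system with the derivative of
    \<open>T\<close> at \<open>x\<close> as matrix and \<open>v\<close> as right-hand side. It is
    rational in the matrix entries, hence as regular as the derivative of \<open>T\<close>.\<close>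
  define J where "J v x = (\<chi> k. det (\<chi> i j. if j = k then v $ i else A x $ i $ j) / det (A x))" for v x
  have lin: "linear (frechet_derivative T (at x))" if "x \<in> V" for x
    using Cn_onD[OF T that] has_derivative_linear by blast
  have mw: "matrix (frechet_derivative T (at x)) *v v = frechet_derivative T (at x) v" if "x \<in> V" for x v
    by (rule matrix_works) (simp add: linear_matrix_vector_mul_eq lin[OF that])
  have det: "det (A x) \<noteq> 0" if "x \<in> V" for x
    using D[OF that] lin[OF that] unfolding A_def
    by (simp add: det_nz_iff_inj)
  have J: "frechet_derivative T (at x) (J v x) = v" if "x \<in> V" for x v
    using cramer[OF det[OF that], of "J v x" v] mw[OF that]
    by (simp add: J_def A_def)
  have J': "J (frechet_derivative T (at x) v) x = v" if "x \<in> V" for x v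
    by (rule injD[OF D[OF that]]) (rule J[OF that])
  have linJ: "linear (\<lambda>v. J v x)" if "x \<in> V" for x
  proof (rule linearI; rule injD[OF D[OF that]])
  qed (simp_all add: J[OF that] linear_add[OF lin[OF that]] linear_scale[OF lin[OF that]])
  have dg: "(g has_derivative (\<lambda>v. J v (g y))) (at y)" if "y \<in> T ` V" for y
  proof -
    from that obtain x where x: "x \<in> V" "y = T x" by auto
    have "(g has_derivative (\<lambda>v. J v x)) (at (T x))"
      using V x(1) Cn_on_continuous[OF T] g Cn_onD[OF T x(1)]
      by (rule has_derivative_inverse_strong) (use J[OF x(1)] in auto)
    then show ?thesis using x g by simp
  qed
  have nA: "Cn_on m (\<lambda>x. A x $ i $ j) V" for i j
    unfolding A_def matrix_def using T V by (simp add: Cn_on_vec_nth)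
  have nJ: "Cn_on m (J v) V" for v
  proof (rule Cn_on_vec[OF V])
    fix k
    have "Cn_on m (\<lambda>x. det (\<chi> i j. if j = k then v $ i else A x $ i $ j) * inverse (det (A x))) V"
    proof (intro Cn_on_mult Cn_on_inverse_real Cn_on_det V det)
      show "Cn_on m (\<lambda>x. (\<chi> i j. if j = k then v $ i else A x $ i $ j) $ i $ j) V" for i j
        by (cases "j = k") (simp_all add: nA Cn_on_const V)
    qed (simp_all add: nA)
    then show "Cn_on m (\<lambda>x. J v x $ k) V" by (simp add: J_def divide_inverse)
  qed
  \<comment> \<open>Bootstrap: the derivative of \<open>g\<close> at \<open>y\<close> in direction
    \<open>v\<close> is \<open>J v (g y)\<close>, so class C^j of \<open>g\<close> gives class
    C^(j+1), as long as \<open>j\<close> does not exceed the class of \<open>J\<close>.\<close>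
  have "Cn_on j g (T ` V)" if "j \<le> Suc m" for j
    using that
  proof (induction j)
    case 0
    then show ?case
      using dg has_derivative_continuous by (force intro!: continuous_at_imp_continuous_on)
  next
    case (Suc j)
    have "Cn_on j (\<lambda>y. J v (g y)) (T ` V)" for v
      by (rule Cn_on_compose[OF oTV V _ Cn_on_le[OF _ nJ]]) (use Suc g in auto)
    then show ?case using Cn_onI[OF oTV dg] by blast
  qed
  then show "Cn_on (Suc m) g (T ` V)" by blast
qed

declare Cn_on.simps(2)[simp del]

section \<open>The classes C^r for finite or infinite r\<close>

lemma Cr_onI: "(\<And>n. enat n \<le> r \<Longrightarrow> Cn_on n f S) \<Longrightarrow> Cr_on r f S"
  by (simp add: Cr_on_def)

lemma Cr_onD: "Cr_on r f S \<Longrightarrow> enat n \<le> r \<Longrightarrow> Cn_on n f S"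
  by (simp add: Cr_on_def)

lemma Cr_on_1: "Cr_on 1 f S \<longleftrightarrow> Cn_on 1 f S"
  by (metis Cr_on_def Cn_on_le enat_ord_simps(1) one_enat_def order_refl)

lemma Cr_on_subset: "Cr_on r f S \<Longrightarrow> T \<subseteq> S \<Longrightarrow> Cr_on r f T"
  unfolding Cr_on_def using Cn_on_subset by blast

lemma Cr_on_mono: "Cr_on r f S \<Longrightarrow> s \<le> r \<Longrightarrow> Cr_on s f S"
  unfolding Cr_on_def using order_trans by blast

lemma Cr_on_cong: "open S \<Longrightarrow> (\<And>x. x \<in> S \<Longrightarrow> f x = g x) \<Longrightarrow> Cr_on r f S \<Longrightarrow> Cr_on r g S"
  unfolding Cr_on_def using Cn_on_cong by blast

lemma Cr_on_local:
  "(\<And>x. x \<in> S \<Longrightarrow> \<exists>U. open U \<and> x \<in> U \<and> Cr_on r f U) \<Longrightarrow> Cr_on r f S"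
  unfolding Cr_on_def using Cn_on_local[of S _ f] by metis

lemma Cr_on_continuous: "Cr_on r f S \<Longrightarrow> continuous_on S f"
  using Cr_onD[of r f S 0] by (simp add: zero_enat_def[symmetric])

lemma Cr_on_compose:
  fixes f :: "'a::euclidean_space \<Rightarrow> 'b::euclidean_space" and g :: "'b \<Rightarrow> 'c::euclidean_space"
  assumes "open S" "open T" "Cr_on r f S" "Cr_on r g T" "f ` S \<subseteq> T"
  shows "Cr_on r (\<lambda>x. g (f x)) S"
  by (rule Cr_onI, rule Cn_on_compose[OF assms(1,2) _ _ assms(5)]) (use assms in \<open>auto dest: Cr_onD\<close>)

lemma Cr_on_bounded_linear: "open S \<Longrightarrow> bounded_linear f \<Longrightarrow> Cr_on r f S"
  by (simp add: Cr_on_def Cn_on_bounded_linear)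

lemma Cr_on_const: "open S \<Longrightarrow> Cr_on r (\<lambda>x. c) S"
  by (simp add: Cr_on_def Cn_on_const)

lemma Cr_on_id: "open S \<Longrightarrow> Cr_on r (\<lambda>x. x) S"
  by (simp add: Cr_on_def Cn_on_id)

lemma Cr_on_add: "open S \<Longrightarrow> Cr_on r f S \<Longrightarrow> Cr_on r g S \<Longrightarrow> Cr_on r (\<lambda>x. f x + g x) S"
  by (simp add: Cr_on_def Cn_on_add)

lemma Cr_on_diff: "open S \<Longrightarrow> Cr_on r f S \<Longrightarrow> Cr_on r g S \<Longrightarrow> Cr_on r (\<lambda>x. f x - g x) S"
  by (simp add: Cr_on_def Cn_on_diff)

lemma Cr_on_sum: "open S \<Longrightarrow> (\<And>i. i \<in> I \<Longrightarrow> Cr_on r (f i) S) \<Longrightarrow> Cr_on r (\<lambda>x. \<Sum>i\<in>I. f i x) S"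
  by (simp add: Cr_on_def Cn_on_sum)

lemma Cr_on_scaleR: "open S \<Longrightarrow> Cr_on r f S \<Longrightarrow> Cr_on r g S \<Longrightarrow> Cr_on r (\<lambda>x. f x *\<^sub>R g x) S"
  by (simp add: Cr_on_def Cn_on_scaleR)

lemma Cr_on_inverse:
  fixes T :: "real^'n \<Rightarrow> real^'n"
  assumes V: "open V" and T: "Cr_on r T V" and r: "1 \<le> r"
    and D: "\<And>x. x \<in> V \<Longrightarrow> inj (frechet_derivative T (at x))"
    and g: "\<And>x. x \<in> V \<Longrightarrow> g (T x) = x"
  shows "open (T ` V)" and "Cr_on r g (T ` V)"
proof -
  have T1: "Cn_on (Suc 0) T V" using T r by (simp add: Cr_on_def one_enat_def del: Cn_on.simps)
  show "open (T ` V)" using Cn_on_inverse(1)[OF V T1 D g] .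
  show "Cr_on r g (T ` V)"
  proof (rule Cr_onI)
    fix n assume n: "enat n \<le> r"
    show "Cn_on n g (T ` V)"
    proof (cases n)
      case 0
      then show ?thesis using Cn_on_le[OF _ Cn_on_inverse(2)[OF V T1 D g], of 0] by blast
    next
      case (Suc m)
      then show ?thesis using Cn_on_inverse(2)[OF V _ D g] T n by (simp add: Cr_on_def del: Cn_on.simps)
    qed
  qed
qed

subsection \<open>Germs of local diffeomorphisms\<close>

text \<open>The inverse \<open>T'\<close> and its regularity are part of the data, so restriction,
  composition and inversion are formal. Calculus enters when such a \<open>T'\<close> has to be
  produced, in \<open>ldiff_upgrade\<close> and \<open>ldiff_expansive\<close>.\<close>

definition ldiff_on :: "enat \<Rightarrow> ('a::euclidean_space \<Rightarrow> 'a) \<Rightarrow> ('a \<Rightarrow> 'a) \<Rightarrow> 'a set \<Rightarrow> bool" where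
  "ldiff_on r T T' V \<longleftrightarrow> open V \<and> open (T ` V) \<and> Cr_on r T V \<and> Cr_on r T' (T ` V) \<and> (\<forall>x\<in>V. T' (T x) = x)"

definition ldiff :: "enat \<Rightarrow> ('a::euclidean_space \<Rightarrow> 'a) \<Rightarrow> 'a \<Rightarrow> bool" where
  "ldiff r T p \<longleftrightarrow> (\<exists>V T'. p \<in> V \<and> ldiff_on r T T' V)"

lemma ldiff_on_subset:
  assumes "ldiff_on r T T' V" "open W" "W \<subseteq> V"
  shows "ldiff_on r T T' W"
proof -
  have "T ` W = T ` V \<inter> T' -` W"
    using assms unfolding ldiff_on_def by force
  moreover have "open (T ` V \<inter> T' -` W)"
    using assms continuous_open_preimage[OF Cr_on_continuous] unfolding ldiff_on_def by blast
  ultimately show ?thesis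
    using assms Cr_on_subset unfolding ldiff_on_def by (metis image_mono subsetD)
qed

lemma ldiff_on_ldiff: "ldiff_on r T T' V \<Longrightarrow> p \<in> V \<Longrightarrow> ldiff r T p"
  unfolding ldiff_def by blast

lemma ldiff_shrink:
  assumes "ldiff r T p" "open W" "p \<in> W"
  obtains V T' where "p \<in> V" "V \<subseteq> W" "ldiff_on r T T' V"
proof -
  obtain V T' where V: "p \<in> V" "ldiff_on r T T' V"
    using assms unfolding ldiff_def by blast
  then have "open (V \<inter> W)" using assms unfolding ldiff_on_def by blast
  then show ?thesis using ldiff_on_subset[OF V(2), of "V \<inter> W"] V assms that by blast
qed

lemma ldiff_near: "ldiff r T p \<Longrightarrow> \<forall>\<^sub>F y in nhds p. ldiff r T y"
  unfolding ldiff_def eventually_nhds by (meson ldiff_on_def)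

lemma ldiff_continuous: "ldiff r T p \<Longrightarrow> isCont T p"
  unfolding ldiff_def ldiff_on_def
  by (meson Cr_on_continuous continuous_on_eq_continuous_at)

lemma ldiff_cong:
  assumes "ldiff r T p" "\<forall>\<^sub>F y in nhds p. T y = S y"
  shows "ldiff r S p"
proof -
  obtain W where W: "open W" "p \<in> W" "\<forall>y\<in>W. T y = S y"
    using assms(2) by (auto simp: eventually_nhds)
  obtain V T' where V: "p \<in> V" "V \<subseteq> W" "ldiff_on r T T' V"
    using ldiff_shrink[OF assms(1) W(1,2)] .
  have eq: "T y = S y" if "y \<in> V" for y using V W that by blast
  then have "T ` V = S ` V" by auto
  then have "ldiff_on r S T' V"
    using V(3) eq Cr_on_cong[of V T S r] unfolding ldiff_on_def by auto
  then show ?thesis using V unfolding ldiff_def by blast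
qed

lemma ldiff_compose:
  assumes "ldiff r T p" "ldiff r S (T p)"
  shows "ldiff r (\<lambda>x. S (T x)) p"
proof -
  obtain W S' where W: "T p \<in> W" "ldiff_on r S S' W"
    using assms(2) unfolding ldiff_def by blast
  have oW: "open W" using W unfolding ldiff_on_def by blast
  obtain V0 T0 where V0: "p \<in> V0" "ldiff_on r T T0 V0"
    using assms(1) unfolding ldiff_def by blast
  have "open (V0 \<inter> T -` W)"
    using V0 oW continuous_open_preimage[OF Cr_on_continuous] unfolding ldiff_on_def by blast
  then obtain V T' where V: "p \<in> V" "V \<subseteq> V0 \<inter> T -` W" "ldiff_on r T T' V"
    using ldiff_shrink[OF assms(1)] V0(1) W(1) by (metis IntI vimageI)
  have "T ` V \<subseteq> W" using V by blast
  moreover have "open (T ` V)" using V unfolding ldiff_on_def by blast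
  ultimately have S: "ldiff_on r S S' (T ` V)" using ldiff_on_subset[OF W(2)] by blast
  have ST: "(\<lambda>x. S (T x)) ` V = S ` T ` V" by auto
  have 1: "open V" "open (T ` V)" "Cr_on r T V" "Cr_on r T' (T ` V)" "\<And>x. x \<in> V \<Longrightarrow> T' (T x) = x"
    using V(3) by (auto simp: ldiff_on_def)
  have 2: "open (S ` T ` V)" "Cr_on r S (T ` V)" "Cr_on r S' (S ` T ` V)" "\<And>x. x \<in> V \<Longrightarrow> S' (S (T x)) = T x"
    using S by (auto simp: ldiff_on_def)
  have sub: "S' ` S ` T ` V \<subseteq> T ` V" using 2(4) by auto
  have "ldiff_on r (\<lambda>x. S (T x)) (\<lambda>x. T' (S' x)) V"
    unfolding ldiff_on_def ST
    using 1(1) 2(1) Cr_on_compose[OF 1(1,2,3) 2(2) order_refl] Cr_on_compose[OF 2(1) 1(2) 2(3) 1(4) sub]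
      1(5) 2(4) by simp
  then show ?thesis using V unfolding ldiff_def by blast
qed

lemma ldiff_on_inverse:
  assumes "ldiff_on r T T' V"
  shows "ldiff_on r T' T (T ` V)"
proof -
  have "T' ` T ` V = V" using assms unfolding ldiff_on_def by force
  then show ?thesis using assms unfolding ldiff_on_def by auto
qed

lemma ldiff_inverse:
  assumes "ldiff r T p"
  obtains T' where "ldiff r T' (T p)" "\<forall>\<^sub>F x in nhds p. T' (T x) = x" "T' (T p) = p"
proof -
  obtain V T' where V: "p \<in> V" "ldiff_on r T T' V"
    using assms unfolding ldiff_def by blast
  moreover have "\<forall>\<^sub>F x in nhds p. T' (T x) = x"
    using V unfolding eventually_nhds ldiff_on_def by blast
  moreover have "ldiff r T' (T p)"
    using ldiff_on_inverse[OF V(2)] V(1) unfolding ldiff_def by blast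
  ultimately show ?thesis using that unfolding ldiff_on_def by blast
qed

lemma ldiff_mono: "ldiff r T p \<Longrightarrow> s \<le> r \<Longrightarrow> ldiff s T p"
  unfolding ldiff_def ldiff_on_def using Cr_on_mono by metis

lemma ldiff_id: "ldiff r (\<lambda>x. x) p"
  unfolding ldiff_def ldiff_on_def by (intro exI[of _ UNIV] exI[of _ "\<lambda>x. x"]) (auto simp: Cr_on_id)

lemma ldiff_linear:
  fixes f :: "'a::euclidean_space \<Rightarrow> 'a"
  assumes "linear f" "linear g" "\<And>x. g (f x) = x" "\<And>x. f (g x) = x"
  shows "ldiff r f p"
  unfolding ldiff_def ldiff_on_def
proof (intro exI[of _ UNIV] exI[of _ g] conjI)
  show "open (range f)" using assms(4) by (metis open_UNIV surjI)
  then show "Cr_on r g (range f)" using assms(2) by (simp add: Cr_on_bounded_linear linear_conv_bounded_linear)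
qed (use assms in \<open>auto simp: Cr_on_bounded_linear linear_conv_bounded_linear\<close>)

lemma ldiff_derivative_inj:
  assumes "ldiff_on r T T' V" "x \<in> V" "1 \<le> r"
  shows "inj (frechet_derivative T (at x))"
proof -
  have 1: "Cn_on (Suc 0) T V" "Cn_on (Suc 0) T' (T ` V)" "open V"
    using assms by (auto simp: ldiff_on_def Cr_on_def one_enat_def)
  have "(T has_derivative frechet_derivative T (at x)) (at x)" using Cn_onD[OF 1(1)] assms by blast
  moreover have "(T' has_derivative frechet_derivative T' (at (T x))) (at (T x))"
    using Cn_onD[OF 1(2)] assms by blast
  ultimately have "(T' \<circ> T has_derivative frechet_derivative T' (at (T x)) \<circ> frechet_derivative T (at x)) (at x)"
    by (rule diff_chain_at)
  moreover have "(T' \<circ> T has_derivative (\<lambda>v. v)) (at x)"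
    by (rule has_derivative_transform_within_open[OF has_derivative_ident 1(3) assms(2)])
      (use assms(1) in \<open>auto simp: ldiff_on_def\<close>)
  ultimately have "frechet_derivative T' (at (T x)) \<circ> frechet_derivative T (at x) = (\<lambda>v. v)"
    by (rule has_derivative_unique)
  then show ?thesis by (metis comp_apply injI)
qed

text \<open>The C^1 inverse forces the derivative of \<open>T\<close> to be injective, and then the
  inverse is as regular as \<open>T\<close> itself. This is how C^1 compatibility is promoted to C^r
  compatibility.\<close>

lemma ldiff_upgrade:
  fixes T :: "real^'n \<Rightarrow> real^'n"
  assumes "ldiff 1 T p" "open W" "p \<in> W" "Cr_on r T W" "1 \<le> r"
  shows "ldiff r T p"
proof -
  obtain V T' where V: "p \<in> V" "V \<subseteq> W" "ldiff_on 1 T T' V"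
    using ldiff_shrink[OF assms(1-3)] .
  have "open V" "\<And>x. x \<in> V \<Longrightarrow> T' (T x) = x" using V by (auto simp: ldiff_on_def)
  then have "ldiff_on r T T' V"
    using Cr_on_inverse[of V r T T'] Cr_on_subset[OF assms(4) V(2)] ldiff_derivative_inj[OF V(3)] assms(5)
    by (auto simp: ldiff_on_def)
  then show ?thesis using V ldiff_on_ldiff by blast
qed

text \<open>The lower bound makes \<open>T\<close> injective, and in the limit it bounds the
  derivative from below, which is therefore injective as well.\<close>

lemma ldiff_expansive:
  fixes T :: "real^'n \<Rightarrow> real^'n"
  assumes V: "open V" and T: "Cn_on 1 T V" and c: "0 < c"
    and exp: "\<And>x y. x \<in> V \<Longrightarrow> y \<in> V \<Longrightarrow> c * norm (x - y) \<le> norm (T x - T y)"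
    and p: "p \<in> V"
  shows "ldiff 1 T p"
proof -
  have "inj_on T V"
  proof (rule inj_onI)
    fix x y assume "x \<in> V" "y \<in> V" "T x = T y"
    then show "x = y" using exp[of x y] c by (simp add: mult_le_0_iff)
  qed
  have "inj (frechet_derivative T (at x))" if x: "x \<in> V" for x
  proof -
    let ?D = "frechet_derivative T (at x)"
    have D: "(T has_derivative ?D) (at x)" using Cn_onD[of 0 T V x] T x by simp
    then have lin: "linear ?D" by (rule has_derivative_linear)
    show ?thesis
      unfolding linear_injective_0[OF lin]
    proof (intro allI impI, rule ccontr)
      fix v assume v: "?D v = 0" "v \<noteq> 0"
      obtain d where d: "d > 0" "\<And>y. norm (y - x) < d \<Longrightarrow> norm (T y - T x - ?D (y - x)) \<le> c / 2 * norm (y - x)"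
        using D c unfolding has_derivative_at_alt by (metis half_gt_zero)
      obtain e where e: "e > 0" "ball x e \<subseteq> V" using V x open_contains_ball by blast
      \<comment> \<open>Small enough to keep \<open>x + t *\<^sub>R v\<close> in \<open>V\<close>
        and within the range where the linearization error is at most \<open>c / 2\<close> times the
        distance; a kernel vector \<open>v\<close> then contradicts the bound with
        \<open>c\<close>.\<close>
      define t where "t = min d e / (2 * norm v)"
      have t: "t > 0" "t * norm v < d" "t * norm v < e" using v d e by (auto simp: t_def)
      have "x + t *\<^sub>R v \<in> V" using e t by (intro subsetD[OF e(2)]) (simp add: dist_norm)
      then have "c * (t * norm v) \<le> norm (T (x + t *\<^sub>R v) - T x)"
        using exp[of "x + t *\<^sub>R v" x] x t by simp
      also have "\<dots> \<le> c / 2 * (t * norm v)"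
        using d(2)[of "x + t *\<^sub>R v"] t v by (simp add: linear_scale[OF lin])
      finally have "c * (t * norm v) \<le> 0" by simp
      moreover have "0 < c * (t * norm v)" using c t v by simp
      ultimately show False by linarith
    qed
  qed
  then have "ldiff_on 1 T (the_inv_into V T) V"
    using Cr_on_inverse[OF V _ order_refl, of T "the_inv_into V T"] T V \<open>inj_on T V\<close>
    by (auto simp: ldiff_on_def Cr_on_1 the_inv_into_f_f simp del: Cn_on.simps One_nat_def)
  then show ?thesis using p ldiff_on_ldiff by blast
qed

section \<open>Smoothing in Euclidean space\<close>

subsection \<open>Cutoff functions\<close>

text \<open>The functions t^(-k) exp(-1/t), extended by 0 to t \<le> 0. With the parameter
  \<open>k\<close>, derivatives are linear combinations of members of the family, so one induction
  proves smoothness of all of them.\<close>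

definition expinv :: "nat \<Rightarrow> real \<Rightarrow> real" where
  "expinv k t = (if t \<le> 0 then 0 else inverse t ^ k * exp (- inverse t))"

lemma expinv_tendsto_0: "(expinv k \<longlongrightarrow> 0) (at 0)"
proof -
  have "((\<lambda>t. inverse t ^ k / exp (inverse t)) \<longlongrightarrow> 0) (at_right (0::real))"
    using filterlim_compose[OF tendsto_power_div_exp_0 filterlim_inverse_at_top_right] .
  moreover have "\<forall>\<^sub>F t in at_right 0. inverse t ^ k / exp (inverse t) = expinv k t"
    using eventually_at_right_less[of 0] by eventually_elim (simp add: expinv_def exp_minus field_simps)
  ultimately have "(expinv k \<longlongrightarrow> 0) (at_right 0)"
    using tendsto_cong by fast
  moreover have "(expinv k \<longlongrightarrow> 0) (at_left 0)"
    by (rule tendsto_eventually) (auto simp: eventually_at_filter expinv_def)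
  ultimately show ?thesis by (simp add: filterlim_at_split)
qed

lemma expinv_deriv:
  "(expinv k has_real_derivative expinv (k + 2) t - real k * expinv (k + 1) t) (at t)"
proof -
  consider "t > 0" | "t < 0" | "t = 0" by linarith
  then show ?thesis
  proof cases
    case 1
    have "((\<lambda>t. inverse t ^ k * exp (- inverse t)) has_real_derivative
        expinv (k + 2) t - real k * expinv (k + 1) t) (at t)"
    proof (cases k)
      case 0
      then show ?thesis using 1
        by (auto intro!: derivative_eq_intros simp: expinv_def field_simps power2_eq_square)
    next
      case (Suc j)
      have "(inverse has_real_derivative - (inverse t * inverse t)) (at t)"
        using DERIV_inverse[of t] 1 by (simp add: numeral_2_eq_2)
      note p = DERIV_power_Suc[OF this, of j]
      have "((\<lambda>t. exp (- inverse t)) has_real_derivative exp (- inverse t) * (inverse t * inverse t)) (at t)"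
        using 1 by (auto intro!: derivative_eq_intros simp: power2_eq_square)
      from DERIV_mult[OF p this]
      show ?thesis using 1 Suc by (simp add: expinv_def algebra_simps)
    qed
    then show ?thesis
      by (rule has_field_derivative_transform_within_open[where S="{0<..}"])
        (use 1 in \<open>auto simp: expinv_def\<close>)
  next
    case 2
    have "((\<lambda>t. 0) has_real_derivative expinv (k + 2) t - real k * expinv (k + 1) t) (at t)"
      using 2 by (simp add: expinv_def)
    then show ?thesis
      by (rule has_field_derivative_transform_within_open[where S="{..<0}"])
        (use 2 in \<open>auto simp: expinv_def\<close>)
  next
    case 3
    \<comment> \<open>The difference quotient at 0 is \<open>expinv (Suc k)\<close> itself, and its
      limit at 0 is 0.\<close>
    have "\<forall>\<^sub>F h in at 0. expinv (Suc k) h = (expinv k (0 + h) - expinv k 0) / h"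
      by (auto simp: eventually_at_filter expinv_def field_simps)
    then have "((\<lambda>h. (expinv k (0 + h) - expinv k 0) / h) \<longlongrightarrow> 0) (at 0)"
      using expinv_tendsto_0[of "Suc k"] tendsto_cong by fast
    then show ?thesis unfolding 3 by (simp add: DERIV_def expinv_def)
  qed
qed

lemma Cn_on_expinv: "Cn_on n (expinv k) UNIV"
proof (induction n arbitrary: k)
  case 0
  then show ?case
    using expinv_deriv by (auto intro!: continuous_at_imp_continuous_on intro: DERIV_isCont)
next
  case (Suc n)
  show ?case
  proof (rule Cn_onI)
    show "(expinv k has_derivative (\<lambda>v. (expinv (k + 2) x - real k * expinv (k + 1) x) * v)) (at x)" for x
      using expinv_deriv unfolding has_field_derivative_def .
    show "Cn_on n (\<lambda>x. (expinv (k + 2) x - real k * expinv (k + 1) x) * v) UNIV" for v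
      by (intro Cn_on_mult Cn_on_diff Cn_on_const Suc.IH) auto
  qed simp
qed

definition smooth_step :: "real \<Rightarrow> real" where
  "smooth_step t = expinv 0 t * inverse (expinv 0 t + expinv 0 (1 - t))"

lemma smooth_step_denominator: "0 < expinv 0 t + expinv 0 (1 - t)"
  by (simp add: expinv_def add_pos_pos)

lemma Cn_on_smooth_step: "Cn_on n smooth_step UNIV"
  unfolding smooth_step_def
  using smooth_step_denominator
  by (intro Cn_on_mult Cn_on_inverse_real Cn_on_add Cn_on_expinv
      Cn_on_compose[OF _ _ _ Cn_on_expinv] Cn_on_diff Cn_on_const Cn_on_id)
    (auto simp: less_imp_neq[symmetric])

lemma smooth_step_values:
  "t \<le> 0 \<Longrightarrow> smooth_step t = 0" "1 \<le> t \<Longrightarrow> smooth_step t = 1" "0 \<le> smooth_step t" "smooth_step t \<le> 1"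
proof -
  show "t \<le> 0 \<Longrightarrow> smooth_step t = 0" "1 \<le> t \<Longrightarrow> smooth_step t = 1"
    by (auto simp: smooth_step_def expinv_def)
  have "0 \<le> expinv 0 s" for s by (simp add: expinv_def)
  then show "0 \<le> smooth_step t" "smooth_step t \<le> 1"
    using smooth_step_denominator[of t] by (auto simp: smooth_step_def field_simps)
qed

lemma smooth_cutoff:
  fixes c :: "'a::euclidean_space"
  assumes "0 < r" "r < R"
  obtains \<mu> :: "'a \<Rightarrow> real" where "\<And>n. Cn_on n \<mu> UNIV" "\<And>x. x \<in> cball c r \<Longrightarrow> \<mu> x = 1"
    "\<And>x. x \<notin> ball c R \<Longrightarrow> \<mu> x = 0" "\<And>x. 0 \<le> \<mu> x" "\<And>x. \<mu> x \<le> 1"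
proof -
  \<comment> \<open>\<open>k\<close> scales the argument of \<open>smooth_step\<close> to be 1 on
    the sphere of radius \<open>r\<close> and 0 on that of radius \<open>R\<close>. The squared norm
    is used because it is smooth at the centre too.\<close>
  define k where "k = inverse (R\<^sup>2 - r\<^sup>2)"
  have k: "R\<^sup>2 - r\<^sup>2 > 0" "k > 0" using assms by (auto simp: k_def power_strict_mono)
  define \<mu> where "\<mu> x = smooth_step ((R\<^sup>2 - (x - c) \<bullet> (x - c)) * k)" for x
  show ?thesis
  proof (rule that[of \<mu>])
    show "Cn_on n \<mu> UNIV" for n
      unfolding \<mu>_def
      by (intro Cn_on_compose[OF _ _ _ Cn_on_smooth_step] Cn_on_mult Cn_on_diff Cn_on_inner Cn_on_const Cn_on_id) auto
    show "\<mu> x = 1" if "x \<in> cball c r" for x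
    proof -
      have "(x - c) \<bullet> (x - c) \<le> r\<^sup>2"
        using that assms by (simp add: dist_norm norm_minus_commute power2_norm_eq_inner[symmetric] power_mono)
      then have "1 \<le> (R\<^sup>2 - (x - c) \<bullet> (x - c)) * k" using k by (simp add: k_def field_simps)
      then show ?thesis by (simp add: \<mu>_def smooth_step_values)
    qed
    show "\<mu> x = 0" if "x \<notin> ball c R" for x
    proof -
      have "R\<^sup>2 \<le> (x - c) \<bullet> (x - c)"
        using that assms by (simp add: dist_norm norm_minus_commute power2_norm_eq_inner[symmetric] power_mono)
      then show ?thesis using k by (simp add: \<mu>_def smooth_step_values mult_le_0_iff)
    qed
  qed (simp_all add: \<mu>_def smooth_step_values)
qed

subsection \<open>Mollification\<close>

text \<open>In finite dimension, continuity of all directional derivatives is continuity in operator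
  norm. The operator-valued derivative is the input of the Leibniz rule and of the compactness bound
  below.\<close>

lemma Cn1_blinfun:
  assumes "Cn_on (Suc 0) f S"
  shows "\<And>x. x \<in> S \<Longrightarrow> (f has_derivative blinfun_apply (Blinfun (frechet_derivative f (at x)))) (at x)"
    and "continuous_on S (\<lambda>x. Blinfun (frechet_derivative f (at x)))"
    and "\<And>x v. x \<in> S \<Longrightarrow> blinfun_apply (Blinfun (frechet_derivative f (at x))) v = frechet_derivative f (at x) v"
proof -
  have bl: "bounded_linear (frechet_derivative f (at x))" if "x \<in> S" for x
    using Cn_onD[OF assms that] by (rule has_derivative_bounded_linear)
  then show *: "\<And>x v. x \<in> S \<Longrightarrow> blinfun_apply (Blinfun (frechet_derivative f (at x))) v = frechet_derivative f (at x) v"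
    by (simp add: bounded_linear_Blinfun_apply)
  show "\<And>x. x \<in> S \<Longrightarrow> (f has_derivative blinfun_apply (Blinfun (frechet_derivative f (at x)))) (at x)"
    using Cn_onD[OF assms] bl by (simp add: bounded_linear_Blinfun_apply)
  have "continuous_on S (\<lambda>x. frechet_derivative f (at x) v)" for v
    using Cn_onD2[OF assms] by simp
  then show "continuous_on S (\<lambda>x. Blinfun (frechet_derivative f (at x)))"
    by (intro continuous_on_blinfun_componentwise) (simp add: * cong: continuous_on_cong)
qed

lemma frechet_derivative_bounded_on_compact:
  assumes "Cn_on (Suc 0) f S" "compact Z" "Z \<subseteq> S"
  obtains M where "0 < M" "\<And>x v. x \<in> Z \<Longrightarrow> norm (frechet_derivative f (at x) v) \<le> M * norm v"
proof -
  have "compact ((\<lambda>x. Blinfun (frechet_derivative f (at x))) ` Z)"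
    using Cn1_blinfun(2)[OF assms(1)] assms(2,3) by (metis compact_continuous_image continuous_on_subset)
  then obtain M where M: "0 < M" "\<And>x. x \<in> Z \<Longrightarrow> norm (Blinfun (frechet_derivative f (at x))) \<le> M"
    using compact_imp_bounded by (force simp: bounded_pos)
  have "norm (frechet_derivative f (at x) v) \<le> M * norm v" if "x \<in> Z" for x v
  proof -
    have "norm (blinfun_apply (Blinfun (frechet_derivative f (at x))) v)
      \<le> norm (Blinfun (frechet_derivative f (at x))) * norm v"
      by (rule norm_blinfun)
    also have "\<dots> \<le> M * norm v"
      by (rule mult_right_mono[OF M(2)[OF that] norm_ge_zero])
    finally show ?thesis using Cn1_blinfun(3)[OF assms(1) subsetD[OF assms(3) that], of v] by simp
  qed
  then show ?thesis using M that by blast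
qed

text \<open>The derivative falls on the kernel, and the result is again a convolution of
  \<open>f\<close>, with the differentiated kernel; this is the inductive step of
  \<open>Cn_on_convolution\<close>.\<close>

lemma convolution_has_derivative:
  fixes \<eta> :: "'a::euclidean_space \<Rightarrow> real" and f :: "'a \<Rightarrow> 'b::euclidean_space"
  assumes \<eta>: "Cn_on (Suc 0) \<eta> UNIV" and f: "continuous_on (cbox a b) f"
  shows "((\<lambda>x. integral (cbox a b) (\<lambda>z. \<eta> (x - z) *\<^sub>R f z)) has_derivative
    (\<lambda>v. integral (cbox a b) (\<lambda>z. frechet_derivative \<eta> (at (x - z)) v *\<^sub>R f z))) (at x)"
proof -
  define D where "D y = Blinfun (frechet_derivative \<eta> (at y))" for y
  have D: "(\<eta> has_derivative blinfun_apply (D y)) (at y)" "continuous_on UNIV D"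
    "blinfun_apply (D y) v = frechet_derivative \<eta> (at y) v" for y v
    using Cn1_blinfun[OF \<eta>] by (auto simp: D_def)
  define F where "F x z = blinfun_compose (blinfun_scaleR_left (f z)) (D (x - z))" for x z
  have F: "blinfun_apply (F x z) v = frechet_derivative \<eta> (at (x - z)) v *\<^sub>R f z" for x z v
    by (simp add: F_def D)
  have c\<eta>: "continuous_on UNIV \<eta>" using Cn_on_continuous[OF \<eta>] .
  have cF: "continuous_on (UNIV \<times> cbox a b) (\<lambda>(x, z). F x z)"
    unfolding F_def split_beta
    by (intro continuous_intros continuous_on_compose2[OF D(2)] continuous_on_compose2[OF f]
        bounded_linear.continuous_on[OF bounded_linear_blinfun_scaleR_left] blinfun.continuous_on) auto
  have der: "((\<lambda>x. \<eta> (x - z) *\<^sub>R f z) has_derivative blinfun_apply (F x z)) (at x)" for x z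
  proof -
    have "((\<lambda>x. \<eta> (x - z)) has_derivative (\<lambda>v. blinfun_apply (D (x - z)) v)) (at x)"
      by (rule has_derivative_compose[OF _ D(1)]) (auto intro!: derivative_eq_intros)
    then have "((\<lambda>x. \<eta> (x - z) *\<^sub>R f z) has_derivative (\<lambda>v. blinfun_apply (D (x - z)) v *\<^sub>R f z)) (at x)"
      by (rule has_derivative_scaleR_left)
    moreover have "blinfun_apply (F x z) = (\<lambda>v. blinfun_apply (D (x - z)) v *\<^sub>R f z)"
      by (simp add: F_def fun_eq_iff)
    ultimately show ?thesis by simp
  qed
  have "((\<lambda>x. integral (cbox a b) (\<lambda>z. \<eta> (x - z) *\<^sub>R f z)) has_derivative
      blinfun_apply (integral (cbox a b) (F x))) (at x)"
    by (rule leibniz_rule[where U=UNIV])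
      (auto intro!: der cF integrable_continuous continuous_intros continuous_on_compose2[OF c\<eta>] f)
  moreover have "F x integrable_on cbox a b"
  proof (rule integrable_continuous)
    have "continuous_on (cbox a b) (\<lambda>z. (x, z))" by (intro continuous_intros)
    from continuous_on_compose2[OF cF this] show "continuous_on (cbox a b) (F x)" by auto
  qed
  moreover from this have "blinfun_apply (integral (cbox a b) (F x)) =
      (\<lambda>v. integral (cbox a b) (\<lambda>z. frechet_derivative \<eta> (at (x - z)) v *\<^sub>R f z))"
    by (simp add: fun_eq_iff blinfun_apply_integral F)
  ultimately show ?thesis by simp
qed

lemma Cn_on_convolution:
  fixes \<eta> :: "'a::euclidean_space \<Rightarrow> real" and f :: "'a \<Rightarrow> 'b::euclidean_space"
  assumes \<eta>: "\<And>n. Cn_on n \<eta> UNIV" and f: "continuous_on (cbox a b) f"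
  shows "Cn_on n (\<lambda>x. integral (cbox a b) (\<lambda>z. \<eta> (x - z) *\<^sub>R f z)) UNIV"
  using \<eta>
proof (induction n arbitrary: \<eta>)
  case 0
  have "isCont (\<lambda>x. integral (cbox a b) (\<lambda>z. \<eta> (x - z) *\<^sub>R f z)) x" for x
    using convolution_has_derivative[OF 0 f] by (rule has_derivative_continuous)
  then show ?case by (simp add: continuous_at_imp_continuous_on)
next
  case (Suc n)
  show ?case
    by (rule Cn_onI[OF open_UNIV convolution_has_derivative[OF Suc.prems f]])
      (use Suc.IH Cn_onD2[OF Suc.prems] in blast)
qed

lemma frechet_derivative_outside_support:
  assumes "closed Z" "\<And>x. x \<notin> Z \<Longrightarrow> f x = 0" "x \<notin> Z"
  shows "frechet_derivative f (at x) = (\<lambda>v. 0)"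
proof -
  have "((\<lambda>x. 0) has_derivative (\<lambda>v. 0)) (at x)" by simp
  then have "(f has_derivative (\<lambda>v. 0)) (at x)"
    by (rule has_derivative_transform_within_open[where s="- Z"]) (use assms in auto)
  then show ?thesis by (metis frechet_derivative_at)
qed

lemma uniformly_close_translates:
  fixes F :: "'a::euclidean_space \<Rightarrow> 'b::real_normed_vector"
  assumes F: "continuous_on UNIV F" and supp: "\<And>x. x \<notin> cball 0 R \<Longrightarrow> F x = 0" and e: "0 < e"
  obtains d where "0 < d" "\<And>x y. norm y \<le> d \<Longrightarrow> norm (F (x - y) - F x) \<le> e"
proof -
  have "uniformly_continuous_on (cball 0 (R + 2)) F"
    using F by (intro compact_uniformly_continuous) (auto intro: continuous_on_subset)
  then obtain d where d: "d > 0" "\<And>x x'. x \<in> cball 0 (R + 2) \<Longrightarrow> x' \<in> cball 0 (R + 2) \<Longrightarrow> dist x' x < d \<Longrightarrow> dist (F x') (F x) < e"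
    using e unfolding uniformly_continuous_on_def by metis
  show ?thesis
  \<comment> \<open>A step of length at most 1 from the ball of radius \<open>R + 1\<close> stays in
    the ball of radius \<open>R + 2\<close>, where uniform continuity is available; from anywhere
    else both points lie outside the support.\<close>
  proof (rule that[of "min 1 (d/2)"])
    show "norm (F (x - y) - F x) \<le> e" if "norm y \<le> min 1 (d/2)" for x y
    proof (cases "norm x \<le> R + 1")
      case True
      moreover have "norm (x - y) \<le> R + 2" using True that norm_triangle_ineq4[of x y] by simp
      ultimately have "dist (F (x - y)) (F x) < e"
        using that d(1) by (intro d(2)) (auto simp: dist_norm norm_minus_commute)
      then show ?thesis by (simp add: dist_norm)
    next
      case False
      moreover have "norm x \<le> norm (x - y) + norm y" by (metis diff_add_cancel norm_triangle_ineq)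
      ultimately have "norm (x - y) > R" using that by simp
      then show ?thesis using False e supp by simp
    qed
  qed (use d in auto)
qed

text \<open>Mollification: the derivative of the convolution is the convolution of the derivative,
  so one averaging estimate bounds the error of \<open>g\<close> and that of its derivative.\<close>

lemma C1_approximation:
  fixes f :: "'a::euclidean_space \<Rightarrow> 'b::euclidean_space"
  assumes f: "Cn_on (Suc 0) f UNIV" and supp: "\<And>x. x \<notin> cball 0 R \<Longrightarrow> f x = 0" and e: "0 < e"
  obtains g where "\<And>n. Cn_on n g UNIV" "\<And>x. norm (g x - f x) \<le> e"
    "\<And>x v. norm (frechet_derivative g (at x) v - frechet_derivative f (at x) v) \<le> e * norm v"
proof -
  define D where "D x = Blinfun (frechet_derivative f (at x))" for x
  have D: "(f has_derivative blinfun_apply (D x)) (at x)" "continuous_on UNIV D"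
    "blinfun_apply (D x) v = frechet_derivative f (at x) v" for x v
    using Cn1_blinfun[OF f] by (auto simp: D_def)
  have D0: "D x = 0" if "x \<notin> cball 0 R" for x
    using frechet_derivative_outside_support[OF closed_cball supp that] D(3)
    by (intro blinfun_eqI) (auto simp: zero_blinfun.rep_eq)
  have cf: "continuous_on UNIV f" using Cn_on_continuous[OF f] .
  obtain d1 where d1: "0 < d1" "\<And>x y. norm y \<le> d1 \<Longrightarrow> norm (f (x - y) - f x) \<le> e"
    using uniformly_close_translates[OF cf supp e] by blast
  obtain d2 where d2: "0 < d2" "\<And>x y. norm y \<le> d2 \<Longrightarrow> norm (D (x - y) - D x) \<le> e"
    using uniformly_close_translates[OF D(2) D0 e] by blast
  define d where "d = min d1 d2"
  have d: "0 < d" using d1 d2 by (simp add: d_def)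
  obtain \<eta> :: "'a \<Rightarrow> real" where \<eta>: "\<And>n. Cn_on n \<eta> UNIV" "\<And>x. x \<in> cball 0 (d/2) \<Longrightarrow> \<eta> x = 1"
    "\<And>x. x \<notin> ball 0 d \<Longrightarrow> \<eta> x = 0" "\<And>x. 0 \<le> \<eta> x"
    using smooth_cutoff[of "d/2" d "0::'a"] d by (metis half_gt_zero field_sum_of_halves less_add_same_cancel1)
  have c\<eta>: "continuous_on UNIV \<eta>" using \<eta>(1)[of 0] by simp
  obtain a where a: "ball 0 d \<subseteq> cbox (- a) (a::'a)"
    using bounded_subset_cbox_symmetric[of "ball 0 d"] by auto
  obtain w where w: "cball 0 R \<subseteq> cbox (- w) (w::'a)"
    using bounded_subset_cbox_symmetric[of "cball 0 R"] by auto
  let ?B = "cbox (- a) a"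
  have "0 \<in> box (- a) a" using a d interior_mono[OF a] by (auto simp: interior_open)
  then have ne: "box (- a) a \<noteq> {}" by blast
  define m where "m = integral ?B \<eta>"
  have int\<eta>: "\<eta> integrable_on ?B" using c\<eta> by (auto intro!: integrable_continuous intro: continuous_on_subset)
  \<comment> \<open>A nonnegative continuous function with zero integral vanishes on the box, but
    \<open>\<eta>\<close> is 1 at the origin.\<close>
  have "m \<noteq> 0"
  proof
    assume "m = 0"
    then have "(\<eta> has_integral 0) ?B" using int\<eta> by (metis integrable_integral m_def)
    then have "\<eta> 0 = 0"
      using c\<eta> \<eta>(4) ne subsetD[OF box_subset_cbox \<open>0 \<in> box (- a) a\<close>]
      by (intro has_integral_0_cbox_imp_0[of "- a" a]) (auto intro: continuous_on_subset)
    then show False using \<eta>(2)[of 0] d by simp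
  qed
  moreover have "m \<ge> 0" unfolding m_def using \<eta>(4) int\<eta> by (intro integral_nonneg) auto
  ultimately have m: "m > 0" by simp
  define \<rho> where "\<rho> x = \<eta> x * inverse m" for x
  have \<rho>: "\<And>n. Cn_on n \<rho> UNIV" unfolding \<rho>_def by (intro Cn_on_mult Cn_on_const \<eta>) auto
  have c\<rho>: "continuous_on UNIV \<rho>" using \<rho>[of 0] by simp
  have \<rho>0: "\<rho> x = 0" if "x \<notin> ball 0 d" for x using \<eta>(3)[OF that] by (simp add: \<rho>_def)
  have \<rho>pos: "0 \<le> \<rho> x" for x using \<eta>(4) m by (simp add: \<rho>_def)
  have int\<rho>: "(\<rho> has_integral 1) ?B"
    using has_integral_mult_left[OF integrable_integral[OF int\<eta>], of "inverse m"] m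
    by (simp add: \<rho>_def[abs_def] m_def)
  \<comment> \<open>Stated for Banach-valued \<open>F\<close>, so that it serves both
    \<open>f\<close> and the operator-valued derivative \<open>D\<close>.\<close>
  have avg: "norm (integral ?B (\<lambda>y. \<rho> y *\<^sub>R F (x - y)) - F x) \<le> e"
    if F: "continuous_on UNIV F" and close: "\<And>y. norm y < d \<Longrightarrow> norm (F (x - y) - F x) \<le> e"
    for F :: "'a \<Rightarrow> 'c::banach" and x
  proof -
    have i1: "(\<lambda>y. \<rho> y *\<^sub>R F (x - y)) integrable_on ?B"
      by (intro integrable_continuous continuous_intros continuous_on_compose2[OF F] continuous_on_subset[OF c\<rho>]) auto
    have i2: "((\<lambda>y. \<rho> y *\<^sub>R F x) has_integral F x) ?B"
      using has_integral_scaleR_left[OF int\<rho>, of "F x"] by simp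
    have "integral ?B (\<lambda>y. \<rho> y *\<^sub>R F (x - y)) - F x = integral ?B (\<lambda>y. \<rho> y *\<^sub>R F (x - y) - \<rho> y *\<^sub>R F x)"
      using integral_diff[OF i1, of "\<lambda>y. \<rho> y *\<^sub>R F x"] i2 by (auto simp: integral_unique)
    also have "norm \<dots> \<le> integral ?B (\<lambda>y. e * \<rho> y)"
    proof (rule Henstock_Kurzweil_Integration.integral_norm_bound_integral)
      show "norm (\<rho> y *\<^sub>R F (x - y) - \<rho> y *\<^sub>R F x) \<le> e * \<rho> y" for y
      proof (cases "norm y < d")
        case True
        then show ?thesis
          using close[OF True] \<rho>pos[of y] mult_right_mono
          by (fastforce simp: scaleR_diff_right[symmetric] mult.commute)
      next
        case False
        then show ?thesis using \<rho>0[of y] by simp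
      qed
    qed (use i1 i2 int\<rho> in \<open>auto intro!: integrable_diff integrable_on_mult_right\<close>)
    also have "\<dots> = e" using int\<rho> by (simp add: integral_unique)
    finally show ?thesis .
  qed
  define g where "g x = integral ?B (\<lambda>y. \<rho> y *\<^sub>R f (x - y))" for x
  \<comment> \<open>Two forms of one convolution: with \<open>f (x - y)\<close> the derivative falls
    on \<open>f\<close>, which gives closeness; with \<open>\<rho> (x - z)\<close> it falls on the
    kernel, which gives smoothness. They agree because each box contains the support of its
    integrand, so both are integrals over the whole space.\<close>
  have g_conv: "g x = integral (cbox (- w) w) (\<lambda>z. \<rho> (x - z) *\<^sub>R f z)" for x
  proof -
    have "((\<lambda>y. \<rho> y *\<^sub>R f (x - y)) has_integral g x) ?B"
      unfolding g_def
      by (intro integrable_integral integrable_continuous continuous_intros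
          continuous_on_compose2[OF cf] continuous_on_subset[OF c\<rho>]) auto
    from has_integral_affinity[OF this, of "-1" x]
    have "((\<lambda>z. \<rho> (x - z) *\<^sub>R f z) has_integral g x) ((\<lambda>z. x - z) ` ?B)"
      by simp
    then have 1: "((\<lambda>z. \<rho> (x - z) *\<^sub>R f z) has_integral g x) UNIV"
    proof (rule has_integral_on_superset)
      show "\<rho> (x - z) *\<^sub>R f z = 0" if "z \<notin> (\<lambda>z. x - z) ` ?B" for z
      proof -
        have "x - z \<notin> ?B" using that by (metis diff_diff_eq2 add_diff_cancel_left' image_eqI)
        then have "x - z \<notin> ball 0 d" using a by blast
        then show ?thesis using \<rho>0[of "x - z"] by simp
      qed
    qed simp
    have "((\<lambda>z. \<rho> (x - z) *\<^sub>R f z) has_integral integral (cbox (- w) w) (\<lambda>z. \<rho> (x - z) *\<^sub>R f z)) (cbox (- w) w)"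
      by (intro integrable_integral integrable_continuous continuous_intros
          continuous_on_compose2[OF c\<rho>] continuous_on_subset[OF cf]) auto
    then have "((\<lambda>z. \<rho> (x - z) *\<^sub>R f z) has_integral integral (cbox (- w) w) (\<lambda>z. \<rho> (x - z) *\<^sub>R f z)) UNIV"
    proof (rule has_integral_on_superset)
      show "\<rho> (x - z) *\<^sub>R f z = 0" if "z \<notin> cbox (- w) w" for z
        using supp[of z] w that by (metis scaleR_zero_right subsetD)
    qed simp
    then show ?thesis using 1 has_integral_unique by blast
  qed
  have dg: "(g has_derivative blinfun_apply (integral ?B (\<lambda>y. \<rho> y *\<^sub>R D (x - y)))) (at x)" for x
  proof -
    have "continuous_on (UNIV \<times> ?B) (\<lambda>(x, y). \<rho> y *\<^sub>R D (x - y))"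
      unfolding split_beta
      by (intro continuous_intros continuous_on_compose2[OF D(2)] continuous_on_compose2[OF c\<rho>]) auto
    moreover have "((\<lambda>x. \<rho> y *\<^sub>R f (x - y)) has_derivative blinfun_apply (\<rho> y *\<^sub>R D (x - y))) (at x)" for x y
    proof -
      have "((\<lambda>x. f (x - y)) has_derivative (\<lambda>v. blinfun_apply (D (x - y)) v)) (at x)"
        by (rule has_derivative_compose[OF _ D(1)]) (auto intro!: derivative_eq_intros)
      then have "((\<lambda>x. \<rho> y *\<^sub>R f (x - y)) has_derivative (\<lambda>v. \<rho> y *\<^sub>R blinfun_apply (D (x - y)) v)) (at x)"
        by (rule has_derivative_scaleR_right)
      then show ?thesis by (simp add: scaleR_blinfun.rep_eq)
    qed
    ultimately show ?thesis
      unfolding g_def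
      by (intro leibniz_rule[where U=UNIV])
        (auto intro!: integrable_continuous continuous_intros continuous_on_compose2[OF cf] continuous_on_subset[OF c\<rho>])
  qed
  show ?thesis
  proof (rule that[of g])
    have "continuous_on (cbox (- w) w) f" using cf continuous_on_subset by blast
    then show "Cn_on n g UNIV" for n
      unfolding g_conv[abs_def] using Cn_on_convolution[OF \<rho>] by blast
    show "norm (g x - f x) \<le> e" for x
      unfolding g_def using d1(2) by (intro avg cf) (simp add: d_def)
    fix x v
    have "norm (integral ?B (\<lambda>y. \<rho> y *\<^sub>R D (x - y)) - D x) \<le> e"
      using d2(2) by (intro avg D(2)) (simp add: d_def)
    then have "norm (blinfun_apply (integral ?B (\<lambda>y. \<rho> y *\<^sub>R D (x - y)) - D x) v) \<le> e * norm v"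
      using norm_blinfun[of "integral ?B (\<lambda>y. \<rho> y *\<^sub>R D (x - y)) - D x" v]
      by (meson mult_right_mono norm_ge_zero order_trans)
    then show "norm (frechet_derivative g (at x) v - frechet_derivative f (at x) v) \<le> e * norm v"
      using frechet_derivative_at[OF dg[of x]] D(3) by (simp add: minus_blinfun.rep_eq)
  qed
qed

subsection \<open>Small perturbations of the identity\<close>

text \<open>C^1-smallness of the displacement, with the derivative bound written as a Lipschitz
  bound, so that composition, averaging and inversion become elementary estimates. The compact
  \<open>Z\<close> inside \<open>W\<close> is what permits extension by the identity.\<close>

definition tame :: "real \<Rightarrow> 'a::euclidean_space set \<Rightarrow> ('a \<Rightarrow> 'a) \<Rightarrow> bool" where
  "tame \<delta> W \<theta> \<longleftrightarrow> Cn_on 1 \<theta> UNIV \<and>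
     (\<exists>Z. compact Z \<and> Z \<subseteq> W \<and> (\<forall>y. y \<notin> Z \<longrightarrow> \<theta> y = y)) \<and>
     (\<forall>y. norm (\<theta> y - y) \<le> \<delta>) \<and>
     (\<forall>x y. norm ((\<theta> x - x) - (\<theta> y - y)) \<le> \<delta> * norm (x - y))"

lemma tame_mono: "tame \<delta> W \<theta> \<Longrightarrow> \<delta> \<le> \<epsilon> \<Longrightarrow> W \<subseteq> V \<Longrightarrow> tame \<epsilon> V \<theta>"
  unfolding tame_def by (meson mult_right_mono norm_ge_zero order_trans)

lemma tame_id: "0 \<le> \<delta> \<Longrightarrow> tame \<delta> W (\<lambda>x. x)"
  unfolding tame_def using Cn_on_id by (auto intro!: exI[of _ "{}"])

text \<open>The displacement is that of \<open>\<theta>\<close> at \<open>\<eta> x\<close> plus that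
  of \<open>\<eta>\<close> at \<open>x\<close>. As \<open>\<eta>\<close> stretches by at most 1 +
  \<epsilon>, the constant is (1 + \<delta>) (1 + \<epsilon>) - 1.\<close>

lemma tame_compose:
  assumes "tame \<delta> W \<theta>" "tame \<epsilon> W \<eta>" "0 \<le> \<delta>"
  shows "tame (\<delta> + \<epsilon> + \<delta> * \<epsilon>) W (\<lambda>x. \<theta> (\<eta> x))"
proof -
  obtain Z1 Z2 where Z: "compact Z1" "Z1 \<subseteq> W" "\<And>y. y \<notin> Z1 \<Longrightarrow> \<theta> y = y"
    "compact Z2" "Z2 \<subseteq> W" "\<And>y. y \<notin> Z2 \<Longrightarrow> \<eta> y = y"
    using assms unfolding tame_def by metis
  have n1: "norm (\<theta> y - y) \<le> \<delta>" "norm ((\<theta> x - x) - (\<theta> y - y)) \<le> \<delta> * norm (x - y)" for x y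
    using assms(1) by (auto simp: tame_def)
  have n2: "norm (\<eta> y - y) \<le> \<epsilon>" "norm ((\<eta> x - x) - (\<eta> y - y)) \<le> \<epsilon> * norm (x - y)" for x y
    using assms(2) by (auto simp: tame_def)
  have eps: "0 \<le> \<epsilon>" using n2(1) norm_ge_zero order_trans by blast
  have c: "Cn_on 1 \<theta> UNIV" "Cn_on 1 \<eta> UNIV" using assms(1,2) by (simp_all add: tame_def)
  have "Cn_on 1 (\<lambda>x. \<theta> (\<eta> x)) UNIV"
    by (rule Cn_on_compose[OF open_UNIV open_UNIV c(2,1) subset_UNIV])
  moreover have "compact (Z1 \<union> Z2)" "Z1 \<union> Z2 \<subseteq> W" using Z by auto
  moreover have "\<theta> (\<eta> y) = y" if "y \<notin> Z1 \<union> Z2" for y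
    using Z that by auto
  moreover have "norm (\<theta> (\<eta> y) - y) \<le> \<delta> + \<epsilon> + \<delta> * \<epsilon>" for y
  proof -
    have "norm (\<theta> (\<eta> y) - y) \<le> norm (\<theta> (\<eta> y) - \<eta> y) + norm (\<eta> y - y)"
      using norm_triangle_ineq[of "\<theta> (\<eta> y) - \<eta> y" "\<eta> y - y"] by simp
    also have "\<dots> \<le> \<delta> + \<epsilon>" using n1(1) n2(1) by (rule add_mono)
    finally show ?thesis using assms(3) eps by (simp add: add_increasing2)
  qed
  moreover have "norm ((\<theta> (\<eta> x) - x) - (\<theta> (\<eta> y) - y)) \<le> (\<delta> + \<epsilon> + \<delta> * \<epsilon>) * norm (x - y)" for x y
  proof -
    have "norm (\<eta> x - \<eta> y) \<le> norm ((\<eta> x - x) - (\<eta> y - y)) + norm (x - y)"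
      using norm_triangle_ineq[of "(\<eta> x - x) - (\<eta> y - y)" "x - y"] by simp
    then have 1: "norm (\<eta> x - \<eta> y) \<le> \<epsilon> * norm (x - y) + norm (x - y)" using n2(2)[of x y] by simp
    have "norm ((\<theta> (\<eta> x) - x) - (\<theta> (\<eta> y) - y))
        \<le> norm ((\<theta> (\<eta> x) - \<eta> x) - (\<theta> (\<eta> y) - \<eta> y)) + norm ((\<eta> x - x) - (\<eta> y - y))"
      using norm_triangle_ineq[of "(\<theta> (\<eta> x) - \<eta> x) - (\<theta> (\<eta> y) - \<eta> y)" "(\<eta> x - x) - (\<eta> y - y)"]
      by (simp add: algebra_simps)
    also have "\<dots> \<le> \<delta> * norm (\<eta> x - \<eta> y) + \<epsilon> * norm (x - y)"
      using n1(2) n2(2) by (rule add_mono)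
    also have "\<dots> \<le> \<delta> * (\<epsilon> * norm (x - y) + norm (x - y)) + \<epsilon> * norm (x - y)"
      using mult_left_mono[OF 1 assms(3)] by simp
    finally show ?thesis by (simp add: algebra_simps)
  qed
  ultimately show ?thesis unfolding tame_def by (intro conjI exI[of _ "Z1 \<union> Z2"] allI impI)
qed

text \<open>A displacement with Lipschitz constant 1/2 leaves at least half of every distance, so
  \<open>ldiff_expansive\<close> applies.\<close>

lemma tame_ldiff:
  fixes \<theta> :: "real^'n \<Rightarrow> real^'n"
  assumes "tame (1/2) W \<theta>"
  shows "ldiff 1 \<theta> y"
proof (rule ldiff_expansive[where V=UNIV and c="1/2"])
  fix x y
  have "norm ((\<theta> x - x) - (\<theta> y - y)) \<le> 1/2 * norm (x - y)" using assms by (simp add: tame_def)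
  then show "1/2 * norm (x - y) \<le> norm (\<theta> x - \<theta> y)"
    using norm_triangle_ineq3[of "\<theta> x - \<theta> y" "x - y"] by (simp add: algebra_simps abs_le_iff)
qed (use assms in \<open>auto simp: tame_def\<close>)

lemma tame_bij:
  fixes \<theta> :: "'a::euclidean_space \<Rightarrow> 'a"
  assumes "tame (1/2) W \<theta>"
  shows "bij \<theta>" and "\<theta> x \<in> W \<longleftrightarrow> x \<in> W"
proof -
  have lip: "norm ((\<theta> x - x) - (\<theta> y - y)) \<le> 1/2 * norm (x - y)" for x y
    using assms by (simp add: tame_def)
  have "\<exists>!x. \<theta> x = y" for y
  proof -
    \<comment> \<open>Solving \<open>\<theta> x = y\<close> is a fixed point problem for a
      contraction with constant 1/2.\<close>
    have "\<exists>!x. y - (\<theta> x - x) = x"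
      by (rule banach_fix_type[of "1/2"])
        (use lip in \<open>auto simp: dist_norm norm_minus_commute algebra_simps\<close>)
    moreover have "y - (\<theta> x - x) = x \<longleftrightarrow> \<theta> x = y" for x
      by (auto simp: algebra_simps)
    ultimately show ?thesis by simp
  qed
  then show bij: "bij \<theta>" by (simp add: bij_iff)
  obtain Z where Z: "Z \<subseteq> W" "\<And>y. y \<notin> Z \<Longrightarrow> \<theta> y = y" using assms by (auto simp: tame_def)
  \<comment> \<open>If \<open>\<theta> x\<close> lies outside \<open>W\<close>, it is a fixed point
    of \<open>\<theta>\<close>, and injectivity gives \<open>\<theta> x = x\<close>.\<close>
  show "\<theta> x \<in> W \<longleftrightarrow> x \<in> W"
    using Z bij by (metis bij_is_inj injD subsetD)
qed

text \<open>By linearity the displacement of the average is the average of the transported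
  displacements. One factor \<open>M\<close> comes from \<open>L i\<close> before
  \<open>\<theta>\<close> acts, the other from \<open>L' i\<close> afterwards;
  \<open>1 \<le> M\<close> lets the plain displacement bound, which costs a single factor, share the
  constant.\<close>

lemma tame_average:
  fixes L :: "'i \<Rightarrow> 'a::euclidean_space \<Rightarrow> 'a"
  assumes \<theta>: "tame \<delta> W \<theta>" and I: "finite I" "I \<noteq> {}"
    and lin: "\<And>i. i \<in> I \<Longrightarrow> linear (L i)" "\<And>i. i \<in> I \<Longrightarrow> linear (L' i)"
    and inv: "\<And>i x. i \<in> I \<Longrightarrow> L' i (L i x) = x" "\<And>i x. i \<in> I \<Longrightarrow> L i (L' i x) = x"
    and W: "\<And>i x. i \<in> I \<Longrightarrow> x \<in> W \<Longrightarrow> L' i x \<in> W"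
    and M: "1 \<le> M" "\<And>i x. i \<in> I \<Longrightarrow> norm (L i x) \<le> M * norm x" "\<And>i x. i \<in> I \<Longrightarrow> norm (L' i x) \<le> M * norm x"
  shows "tame (M * M * \<delta>) W (\<lambda>x. (\<Sum>i\<in>I. L' i (\<theta> (L i x))) /\<^sub>R card I)"
proof -
  let ?A = "\<lambda>x. (\<Sum>i\<in>I. L' i (\<theta> (L i x))) /\<^sub>R card I"
  have card: "real (card I) > 0" using I by (simp add: card_gt_0_iff)
  have A: "?A x - x = (\<Sum>i\<in>I. L' i (\<theta> (L i x) - L i x)) /\<^sub>R card I" for x
  proof -
    have "(\<Sum>i\<in>I. L' i (\<theta> (L i x) - L i x)) = (\<Sum>i\<in>I. L' i (\<theta> (L i x)) - x)"
      by (rule sum.cong) (auto simp: inv linear_diff[OF lin(2)])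
    then show ?thesis using card by (simp add: sum_subtractf scaleR_diff_right sum_constant_scaleR)
  qed
  obtain Z where Z: "compact Z" "Z \<subseteq> W" "\<And>y. y \<notin> Z \<Longrightarrow> \<theta> y = y"
    using \<theta> unfolding tame_def by metis
  have n: "norm (\<theta> y - y) \<le> \<delta>" "norm ((\<theta> x - x) - (\<theta> y - y)) \<le> \<delta> * norm (x - y)" for x y
    using \<theta> by (auto simp: tame_def)
  have \<delta>: "0 \<le> \<delta>" using n(1) norm_ge_zero order_trans by blast
  have bl: "bounded_linear (L i)" "bounded_linear (L' i)" if "i \<in> I" for i
    using lin that by (auto simp: linear_conv_bounded_linear)
  have avg: "norm ((\<Sum>i\<in>I. f i) /\<^sub>R card I) \<le> B" if "\<And>i. i \<in> I \<Longrightarrow> norm (f i) \<le> B" for f :: "'i \<Rightarrow> 'a" and B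
    using sum_norm_le[of I f "\<lambda>_. B"] that card by (simp add: field_simps)
  have c\<theta>: "Cn_on 1 \<theta> UNIV" using \<theta> by (simp add: tame_def)
  have "Cn_on 1 (\<lambda>x. L' i (\<theta> (L i x))) UNIV" if "i \<in> I" for i
  proof -
    have "Cn_on 1 (\<lambda>x. \<theta> (L i x)) UNIV"
      by (rule Cn_on_compose[OF open_UNIV open_UNIV Cn_on_bounded_linear[OF open_UNIV bl(1)[OF that]] c\<theta>]) simp
    from Cn_on_linear_comp[OF bl(2)[OF that] open_UNIV this] show ?thesis .
  qed
  then have "Cn_on 1 ?A UNIV"
    by (intro Cn_on_scaleR Cn_on_const Cn_on_sum) auto
  moreover have "compact (\<Union>i\<in>I. L' i ` Z)"
    using I(1) Z(1) bl by (intro compact_UN compact_continuous_image linear_continuous_on) auto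
  moreover have "(\<Union>i\<in>I. L' i ` Z) \<subseteq> W" using W Z(2) by blast
  moreover have "?A y = y" if "y \<notin> (\<Union>i\<in>I. L' i ` Z)" for y
  proof -
    have "L i y \<notin> Z" if "i \<in> I" for i
      using \<open>y \<notin> _\<close> inv(1)[OF that] that by (metis UN_I imageI)
    then have "?A y - y = 0" unfolding A using Z(3) lin by (simp add: linear_0)
    then show ?thesis by simp
  qed
  moreover have "norm (?A y - y) \<le> M * M * \<delta>" for y
    unfolding A
  proof (rule avg)
    fix i assume i: "i \<in> I"
    have "norm (L' i (\<theta> (L i y) - L i y)) \<le> M * \<delta>"
      using M(3)[OF i, of "\<theta> (L i y) - L i y"] mult_left_mono[OF n(1)[of "L i y"], of M] M(1) by linarith
    also have "\<dots> \<le> M * M * \<delta>" using M(1) \<delta> by (simp add: mult_right_mono)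
    finally show "norm (L' i (\<theta> (L i y) - L i y)) \<le> M * M * \<delta>" .
  qed
  moreover have "norm ((?A x - x) - (?A y - y)) \<le> M * M * \<delta> * norm (x - y)" for x y
    unfolding A scaleR_diff_right[symmetric] sum_subtractf[symmetric]
  proof (rule avg)
    fix i assume i: "i \<in> I"
    let ?d = "(\<theta> (L i x) - L i x) - (\<theta> (L i y) - L i y)"
    have "L' i (\<theta> (L i x) - L i x) - L' i (\<theta> (L i y) - L i y) = L' i ?d"
      by (simp add: linear_diff[OF lin(2)[OF i]])
    also have "norm \<dots> \<le> M * norm ?d" using M(3)[OF i] .
    also have "\<dots> \<le> M * (\<delta> * norm (L i (x - y)))"
      using n(2)[of "L i x" "L i y"] M(1) linear_diff[OF lin(1)[OF i]] by simp
    also have "\<dots> \<le> M * (\<delta> * (M * norm (x - y)))"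
      using M(1,2) i \<delta> by (intro mult_left_mono) auto
    finally show "norm (L' i (\<theta> (L i x) - L i x) - L' i (\<theta> (L i y) - L i y)) \<le> M * M * \<delta> * norm (x - y)"
      by (simp add: algebra_simps)
  qed
  ultimately show ?thesis unfolding tame_def by blast
qed

text \<open>
  If \<open>f\<close> is replaced by \<open>f + w\<close> with \<open>w\<close> compactly supported and \<open>C\<^sup>1\<close>-small, then
  \<open>f + w = \<theta> \<circ> f\<close> where \<open>\<theta> = id + w \<circ> f\<^sup>-\<^sup>1\<close> is tame.
\<close>

lemma local_smoothing:
  fixes f f' :: "real^'n \<Rightarrow> real^'n"
  assumes f: "ldiff_on 1 f f' \<Omega>" and R: "cball c R \<subseteq> \<Omega>" "0 < r" "r < R" and \<delta>: "0 < \<delta>"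
  obtains \<theta> where "tame \<delta> (f ` \<Omega>) \<theta>" "Cr_on \<infinity> (\<lambda>x. \<theta> (f x)) (ball c r)"
    "\<And>W. open W \<Longrightarrow> W \<subseteq> \<Omega> \<Longrightarrow> Cr_on \<infinity> f W \<Longrightarrow> Cr_on \<infinity> (\<lambda>x. \<theta> (f x)) W"
proof -
  have 1: "open \<Omega>" "open (f ` \<Omega>)" "Cn_on (Suc 0) f \<Omega>" "Cn_on (Suc 0) f' (f ` \<Omega>)" "\<And>x. x \<in> \<Omega> \<Longrightarrow> f' (f x) = x"
    using f by (auto simp: ldiff_on_def Cr_on_1)
  \<comment> \<open>\<open>\<mu>\<close> is 1 up to radius \<open>r\<close> and vanishes beyond
    \<open>r2\<close>; \<open>\<nu>\<close> is 1 up to \<open>r2\<close> and vanishes beyond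
    \<open>R\<close>. So \<open>F\<close> agrees with \<open>f\<close> wherever \<open>\<mu>\<close>
    is nonzero, and is compactly supported on the whole space, as mollification demands.\<close>
  define r2 where "r2 = (r + R) / 2"
  have r2: "r < r2" "r2 < R" "0 < r2" using R by (auto simp: r2_def)
  obtain \<mu> :: "real^'n \<Rightarrow> real" where \<mu>: "\<And>n. Cn_on n \<mu> UNIV" "\<And>x. x \<in> cball c r \<Longrightarrow> \<mu> x = 1"
    "\<And>x. x \<notin> ball c r2 \<Longrightarrow> \<mu> x = 0" "\<And>x. 0 \<le> \<mu> x" "\<And>x. \<mu> x \<le> 1"
    using smooth_cutoff[OF R(2) r2(1)] by metis
  obtain \<nu> :: "real^'n \<Rightarrow> real" where \<nu>: "\<And>n. Cn_on n \<nu> UNIV" "\<And>x. x \<in> cball c r2 \<Longrightarrow> \<nu> x = 1"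
    "\<And>x. x \<notin> ball c R \<Longrightarrow> \<nu> x = 0"
    using smooth_cutoff[OF r2(3) r2(2)] by metis
  define F where "F x = \<nu> x *\<^sub>R f x" for x
  have F: "Cn_on (Suc 0) F UNIV"
  proof (rule Cn_on_local)
    fix x :: "real^'n"
    show "\<exists>U. open U \<and> x \<in> U \<and> Cn_on (Suc 0) F U"
    proof (cases "x \<in> \<Omega>")
      case True
      have "Cn_on (Suc 0) F \<Omega>"
        unfolding F_def by (intro Cn_on_scaleR Cn_on_subset[OF \<nu>(1)] 1) auto
      then show ?thesis using True 1 by blast
    next
      case False
      have "Cn_on (Suc 0) F (- cball c R)"
        by (rule Cn_on_cong[OF _ _ Cn_on_const[of _ _ 0]]) (use \<nu>(3) in \<open>auto simp: F_def\<close>)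
      then show ?thesis using False R by (intro exI[of _ "- cball c R"]) auto
    qed
  qed
  have F0: "F x = 0" if "x \<notin> cball 0 (norm c + R)" for x
  proof -
    have "norm x \<le> norm c + dist c x" by (metis dist_norm norm_minus_commute norm_triangle_sub)
    then show ?thesis using \<nu>(3)[of x] that by (auto simp: F_def)
  qed
  have Ff: "F x = f x" if "x \<in> cball c r2" for x using \<nu>(2)[OF that] by (simp add: F_def)
  obtain K where K: "0 < K" "\<And>x v. x \<in> cball c r2 \<Longrightarrow> norm (frechet_derivative \<mu> (at x) v) \<le> K * norm v"
    using frechet_derivative_bounded_on_compact[OF \<mu>(1), of "cball c r2"] by auto
  define Z where "Z = f ` cball c r2"
  have sub: "cball c r2 \<subseteq> \<Omega>" using R r2 by (meson less_imp_le order_trans subset_cball)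
  have Z: "compact Z" "Z \<subseteq> f ` \<Omega>"
    using Cn_on_continuous[OF 1(3)] sub by (auto simp: Z_def intro!: compact_continuous_image intro: continuous_on_subset)
  obtain M where M: "0 < M" "\<And>y v. y \<in> Z \<Longrightarrow> norm (frechet_derivative f' (at y) v) \<le> M * norm v"
    using frechet_derivative_bounded_on_compact[OF 1(4) Z] by blast
  \<comment> \<open>\<open>(1 + K) * e\<close> will bound the derivative of \<open>w\<close> and
    \<open>M\<close> bounds that of \<open>f'\<close>, so their composite has derivative at most
    \<open>\<delta>\<close>. The minimum with \<open>\<delta>\<close> takes care of the displacement
    itself.\<close>
  define e where "e = min \<delta> (\<delta> / ((1 + K) * M))"
  have KM: "0 < (1 + K) * M" using K M by simp
  then have e: "0 < e" "e \<le> \<delta>" using \<delta> by (auto simp: e_def)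
  have "e \<le> \<delta> / ((1 + K) * M)" by (simp add: e_def)
  then have e3: "(1 + K) * M * e \<le> \<delta>" using KM by (simp add: pos_le_divide_eq mult.commute)
  obtain g where g: "\<And>n. Cn_on n g UNIV" "\<And>x. norm (g x - F x) \<le> e"
    "\<And>x v. norm (frechet_derivative g (at x) v - frechet_derivative F (at x) v) \<le> e * norm v"
    using C1_approximation[OF F F0 e(1)] by blast
  \<comment> \<open>Where \<open>F = f\<close>, the sum \<open>f + w\<close> interpolates as (1 -
    \<mu>) f + \<mu> g. It is the smooth \<open>g\<close> up to radius \<open>r\<close>, and
    elsewhere it is smooth wherever \<open>f\<close> is, because the weights are smooth.\<close>
  define w where "w x = \<mu> x *\<^sub>R (g x - F x)" for x
  have w: "Cn_on (Suc 0) w UNIV"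
    unfolding w_def by (intro Cn_on_scaleR Cn_on_diff \<mu> g F) auto
  have w0: "w x = 0" if "x \<notin> ball c r2" for x using \<mu>(3)[OF that] by (simp add: w_def)
  have wb: "norm (w x) \<le> e" for x
    using g(2)[of x] \<mu>(4,5)[of x] mult_mono[of "\<mu> x" 1 "norm (g x - F x)" e] by (simp add: w_def)
  have dw: "norm (frechet_derivative w (at x) v) \<le> (1 + K) * e * norm v" if "x \<in> cball c r2" for x v
  proof -
    have d: "(\<mu> has_derivative frechet_derivative \<mu> (at x)) (at x)"
      "(g has_derivative frechet_derivative g (at x)) (at x)" "(F has_derivative frechet_derivative F (at x)) (at x)"
      using Cn_onD[OF \<mu>(1)[of "Suc 0"]] Cn_onD[OF g(1)[of "Suc 0"]] Cn_onD[OF F] by auto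
    have "(w has_derivative (\<lambda>v. \<mu> x *\<^sub>R (frechet_derivative g (at x) v - frechet_derivative F (at x) v)
        + frechet_derivative \<mu> (at x) v *\<^sub>R (g x - F x))) (at x)"
      unfolding w_def[abs_def] by (intro has_derivative_scaleR has_derivative_diff d)
    from frechet_derivative_at[OF this, symmetric]
    have "frechet_derivative w (at x) v = \<mu> x *\<^sub>R (frechet_derivative g (at x) v - frechet_derivative F (at x) v)
        + frechet_derivative \<mu> (at x) v *\<^sub>R (g x - F x)"
      by (simp only:)
    also have "norm \<dots> \<le> norm (\<mu> x *\<^sub>R (frechet_derivative g (at x) v - frechet_derivative F (at x) v))
        + norm (frechet_derivative \<mu> (at x) v *\<^sub>R (g x - F x))"
      by (rule norm_triangle_ineq)
    also have "\<dots> \<le> 1 * (e * norm v) + (K * norm v) * e"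
      unfolding norm_scaleR using \<mu>(4,5)[of x] g(2)[of x] g(3)[of x v] K(2)[OF that, of v] K(1) e(1)
      by (intro add_mono mult_mono) auto
    finally show ?thesis by (simp add: algebra_simps)
  qed
  \<comment> \<open>\<open>w\<close> read in the target of \<open>f\<close>. It vanishes off the
    compact \<open>Z\<close>, so its extension by 0 remains C^1.\<close>
  define u where "u y = (if y \<in> f ` \<Omega> then w (f' y) else 0)" for y
  define \<theta> where "\<theta> y = y + u y" for y
  have u0: "u y = 0" if "y \<notin> Z" for y
  proof (cases "y \<in> f ` \<Omega>")
    case True
    then obtain x where x: "x \<in> \<Omega>" "y = f x" by blast
    then have "x \<notin> cball c r2" using that by (auto simp: Z_def)
    then show ?thesis using x 1(5) w0 by (simp add: u_def)
  qed (simp add: u_def)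
  have uf: "u (f x) = w x" if "x \<in> \<Omega>" for x using that 1(5) by (simp add: u_def)
  have closedZ: "closed Z" using Z(1) compact_imp_closed by blast
  have u: "Cn_on (Suc 0) u UNIV"
  proof (rule Cn_on_local)
    fix y :: "real^'n"
    show "\<exists>U. open U \<and> y \<in> U \<and> Cn_on (Suc 0) u U"
    proof (cases "y \<in> Z")
      case True
      have "Cn_on (Suc 0) (\<lambda>y. w (f' y)) (f ` \<Omega>)"
        by (rule Cn_on_compose[OF 1(2) open_UNIV 1(4) w]) simp
      then have "Cn_on (Suc 0) u (f ` \<Omega>)"
        by (rule Cn_on_cong[OF 1(2), rotated]) (simp add: u_def)
      then show ?thesis using True Z 1(2) by blast
    next
      case False
      have "Cn_on (Suc 0) u (- Z)"
        by (rule Cn_on_cong[OF _ _ Cn_on_const[of _ _ 0]]) (use u0 closedZ in auto)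
      then show ?thesis using False closedZ by (intro exI[of _ "- Z"]) auto
    qed
  qed
  have du: "norm (frechet_derivative u (at y) v) \<le> \<delta> * norm v" for y v
  proof (cases "y \<in> Z")
    case True
    then obtain x where x: "x \<in> cball c r2" "y = f x" by (auto simp: Z_def)
    then have x': "x \<in> \<Omega>" "f' y = x" using sub 1(5) by auto
    have y: "y \<in> f ` \<Omega>" using True Z by blast
    have "(w \<circ> f' has_derivative frechet_derivative w (at x) \<circ> frechet_derivative f' (at y)) (at y)"
      using diff_chain_at[OF Cn_onD[OF 1(4) y], of w] Cn_onD[OF w, of x] x' by simp
    then have "(u has_derivative frechet_derivative w (at x) \<circ> frechet_derivative f' (at y)) (at y)"
      by (rule has_derivative_transform_within_open[OF _ 1(2) y]) (simp add: u_def)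
    from frechet_derivative_at[OF this, symmetric]
    have "norm (frechet_derivative u (at y) v) = norm (frechet_derivative w (at x) (frechet_derivative f' (at y) v))"
      by simp
    also have "\<dots> \<le> (1 + K) * e * norm (frechet_derivative f' (at y) v)" using dw[OF x(1)] .
    also have "\<dots> \<le> (1 + K) * e * (M * norm v)"
      using M(2)[OF True, of v] K e by (intro mult_left_mono) auto
    also have "\<dots> = ((1 + K) * M * e) * norm v" by simp
    also have "\<dots> \<le> \<delta> * norm v" using e3 by (rule mult_right_mono) simp
    finally show ?thesis .
  next
    case False
    then show ?thesis using frechet_derivative_outside_support[OF closedZ u0 False] \<delta> by simp
  qed
  \<comment> \<open>The mean value inequality on the convex whole space turns the derivative bound
    into the Lipschitz bound of \<open>tame\<close>.\<close>
  have lip: "norm (u x - u y) \<le> \<delta> * norm (x - y)" for x y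
  proof (rule differentiable_bound[of UNIV])
    show "(u has_derivative frechet_derivative u (at x)) (at x within UNIV)" for x
      using Cn_onD[OF u] by simp
    show "onorm (frechet_derivative u (at x)) \<le> \<delta>" for x
      using du by (intro onorm_bound) (use \<delta> in auto)
  qed auto
  have "tame \<delta> (f ` \<Omega>) \<theta>"
    unfolding tame_def
  proof (intro conjI allI exI)
    show "Cn_on 1 \<theta> UNIV" unfolding \<theta>_def using u by (intro Cn_on_add Cn_on_id) auto
    show "compact Z" "Z \<subseteq> f ` \<Omega>" by fact+
    show "y \<notin> Z \<longrightarrow> \<theta> y = y" for y using u0 by (simp add: \<theta>_def)
    show "norm (\<theta> y - y) \<le> \<delta>" for y using wb[of "f' y"] e \<delta> by (simp add: \<theta>_def u_def)
    show "norm ((\<theta> x - x) - (\<theta> y - y)) \<le> \<delta> * norm (x - y)" for x y using lip by (simp add: \<theta>_def)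
  qed
  moreover have "Cr_on \<infinity> (\<lambda>x. \<theta> (f x)) (ball c r)"
  proof (rule Cr_on_cong)
    show "Cr_on \<infinity> g (ball c r)" using Cn_on_subset[OF g(1) subset_UNIV] by (simp add: Cr_on_def)
    fix x assume x: "x \<in> ball c r"
    then have "x \<in> cball c r2" "x \<in> cball c r" using r2 by auto
    then show "g x = \<theta> (f x)" using sub uf Ff \<mu>(2) by (auto simp: \<theta>_def w_def)
  qed simp
  moreover have "Cr_on \<infinity> (\<lambda>x. \<theta> (f x)) W" if W: "open W" "W \<subseteq> \<Omega>" "Cr_on \<infinity> f W" for W
  proof (rule Cr_on_cong[OF W(1)])
    have s: "Cr_on \<infinity> \<mu> W" "Cr_on \<infinity> \<nu> W" "Cr_on \<infinity> g W"
      using Cn_on_subset[OF \<mu>(1) subset_UNIV] Cn_on_subset[OF \<nu>(1) subset_UNIV]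
        Cn_on_subset[OF g(1) subset_UNIV] by (simp_all add: Cr_on_def)
    show "Cr_on \<infinity> (\<lambda>x. f x + w x) W"
      unfolding w_def F_def by (intro Cr_on_add Cr_on_scaleR Cr_on_diff W s)
    show "f x + w x = \<theta> (f x)" if "x \<in> W" for x using that W uf by (auto simp: \<theta>_def)
  qed
  ultimately show ?thesis using that by blast
qed

section \<open>Atlases and germs of charts\<close>

definition near :: "'a topology \<Rightarrow> 'a \<Rightarrow> ('a \<Rightarrow> bool) \<Rightarrow> bool" where
  "near X x P \<longleftrightarrow> (\<exists>U. openin X U \<and> x \<in> U \<and> (\<forall>y\<in>U. P y))"

lemma nearI: "openin X U \<Longrightarrow> x \<in> U \<Longrightarrow> (\<And>y. y \<in> U \<Longrightarrow> P y) \<Longrightarrow> near X x P"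
  unfolding near_def by blast

lemma near_conj: "near X x P \<Longrightarrow> near X x Q \<Longrightarrow> near X x (\<lambda>y. P y \<and> Q y)"
  unfolding near_def by (metis IntE IntI openin_Int)

lemma near_mono: "near X x P \<Longrightarrow> (\<And>y. P y \<Longrightarrow> Q y) \<Longrightarrow> near X x Q"
  unfolding near_def by blast

lemma near_conj_mono: "near X x P \<Longrightarrow> near X x Q \<Longrightarrow> (\<And>y. P y \<Longrightarrow> Q y \<Longrightarrow> R y) \<Longrightarrow> near X x R"
  by (rule near_mono[OF near_conj[of X x P Q]]) auto

lemma near_at: "near X x P \<Longrightarrow> P x"
  unfolding near_def by blast

lemma near_near: "near X x P \<Longrightarrow> near X x (\<lambda>y. near X y P)"
  unfolding near_def by blast

lemma near_continuous_map:
  assumes "continuous_map X X f" "near X (f x) P" "x \<in> topspace X"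
  shows "near X x (\<lambda>y. P (f y))"
proof -
  obtain U where U: "openin X U" "f x \<in> U" "\<forall>y\<in>U. P y"
    using assms(2) unfolding near_def by blast
  show ?thesis
    by (rule nearI[OF openin_continuous_map_preimage[OF assms(1) U(1)]]) (use U assms(3) in auto)
qed

section \<open>Charts as open embeddings of open sets\<close>

lemma chart_onD:
  assumes "chart_on X (U, \<phi>)"
  shows "openin X U" "inj_on \<phi> U" "continuous_map (subtopology X U) euclidean \<phi>"
    "\<And>V. openin X V \<Longrightarrow> V \<subseteq> U \<Longrightarrow> open (\<phi> ` V)"
    "\<And>W. open W \<Longrightarrow> openin X (U \<inter> \<phi> -` W)"
proof -
  have h: "openin X U" "open (\<phi> ` U)" "homeomorphic_map (subtopology X U) (top_of_set (\<phi> ` U)) \<phi>"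
    using assms by (auto simp: chart_on_def)
  then have UX: "U \<subseteq> topspace X" by (simp add: openin_subset)
  then have tU: "topspace (subtopology X U) = U" by auto
  show "openin X U" by fact
  show "inj_on \<phi> U" using h(3) tU by (metis homeomorphic_imp_injective_map)
  show c: "continuous_map (subtopology X U) euclidean \<phi>"
    using homeomorphic_imp_continuous_map[OF h(3)] continuous_map_in_subtopology by blast
  show "open (\<phi> ` V)" if "openin X V" "V \<subseteq> U" for V
  proof -
    have "openin (subtopology X U) V" using that by (metis openin_open_subtopology h(1))
    then have "openin (top_of_set (\<phi> ` U)) (\<phi> ` V)"
      using homeomorphic_imp_open_map[OF h(3)] by (simp add: open_map_def)
    then show ?thesis using h(2) openin_open_trans by blast
  qed
  show "openin X (U \<inter> \<phi> -` W)" if "open W" for W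
  proof -
    have "openin (subtopology X U) {x \<in> topspace (subtopology X U). \<phi> x \<in> W}"
      using openin_continuous_map_preimage[OF c] that by simp
    moreover have "{x \<in> topspace (subtopology X U). \<phi> x \<in> W} = U \<inter> \<phi> -` W" using tU by auto
    ultimately show ?thesis using openin_open_subtopology[OF h(1)] by simp
  qed
qed

lemma chart_onI:
  assumes U: "openin X U" "inj_on \<phi> U"
    and pre: "\<And>x W. x \<in> U \<Longrightarrow> open W \<Longrightarrow> \<phi> x \<in> W \<Longrightarrow> near X x (\<lambda>y. \<phi> y \<in> W)"
    and im: "\<And>V. openin X V \<Longrightarrow> V \<subseteq> U \<Longrightarrow> open (\<phi> ` V)"
  shows "chart_on X (U, \<phi>)"
proof -
  have UX: "U \<subseteq> topspace X" using U by (simp add: openin_subset)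
  then have tU: "topspace (subtopology X U) = U" by auto
  have "openin (subtopology X U) {x \<in> U. \<phi> x \<in> W}" if W: "open W" for W
    unfolding openin_open_subtopology[OF U(1)]
  proof
    show "openin X {x \<in> U. \<phi> x \<in> W}"
    proof (subst openin_subopen, intro ballI)
      fix x assume x: "x \<in> {x \<in> U. \<phi> x \<in> W}"
      then obtain V where V: "openin X V" "x \<in> V" "\<forall>y\<in>V. \<phi> y \<in> W"
        using pre[OF _ W] unfolding near_def by blast
      then show "\<exists>T. openin X T \<and> x \<in> T \<and> T \<subseteq> {x \<in> U. \<phi> x \<in> W}"
        using x U(1) by (intro exI[of _ "U \<inter> V"]) auto
    qed
  qed auto
  then have "continuous_map (subtopology X U) euclidean \<phi>"
    unfolding continuous_map_def tU by auto
  then have c: "continuous_map (subtopology X U) (top_of_set (\<phi> ` U)) \<phi>"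
    by (simp add: continuous_map_in_subtopology tU)
  have "open_map (subtopology X U) (top_of_set (\<phi> ` U)) \<phi>"
    unfolding open_map_def openin_open_subtopology[OF U(1)]
    using im by (auto intro!: open_subset)
  then have "homeomorphic_map (subtopology X U) (top_of_set (\<phi> ` U)) \<phi>"
    using bijective_open_imp_homeomorphic_map[OF c] U(2) tU by simp
  then show ?thesis using U(1) im[OF U(1)] by (simp add: chart_on_def)
qed

lemma chart_near:
  assumes "chart_on X (U, \<phi>)" "x \<in> U" "\<forall>\<^sub>F z in nhds (\<phi> x). P z"
  shows "near X x (\<lambda>y. P (\<phi> y))"
proof -
  obtain W where W: "open W" "\<phi> x \<in> W" "\<forall>z\<in>W. P z" using assms(3) by (auto simp: eventually_nhds)
  show ?thesis
    by (rule nearI[OF chart_onD(5)[OF assms(1) W(1)]]) (use W assms(2) in auto)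
qed

lemma chart_near_open:
  assumes "chart_on X (U, \<phi>)" "x \<in> U" "near X x P"
  obtains N where "openin X N" "N \<subseteq> U" "x \<in> N" "open (\<phi> ` N)" "\<And>y. y \<in> N \<Longrightarrow> P y"
proof -
  obtain N where "openin X N" "x \<in> N" "\<forall>y\<in>N. P y" using assms(3) unfolding near_def by blast
  then show ?thesis
    using that[of "N \<inter> U"] chart_onD(1,4)[OF assms(1)] assms(2) by auto
qed

lemma chart_on_subset:
  assumes "chart_on X (U, \<phi>)" "openin X V" "V \<subseteq> U"
  shows "chart_on X (V, \<phi>)"
proof (rule chart_onI)
  show "near X x (\<lambda>y. \<phi> y \<in> W)" if "x \<in> V" "open W" "\<phi> x \<in> W" for x W
    using that assms by (intro chart_near[OF assms(1)]) (auto simp: eventually_nhds)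
qed (use assms chart_onD[OF assms(1)] in \<open>auto intro: inj_on_subset\<close>)

text \<open>\<open>\<phi>\<close> and \<open>\<psi>\<close> are arbitrary maps with no domain
  attached, so composites such as \<open>\<lambda>y. \<phi> (\<rho> g y)\<close> can be compared as
  they stand. \<open>T\<close> is their transition map.\<close>

definition germ_related :: "'a topology \<Rightarrow> enat \<Rightarrow> ('a \<Rightarrow> real^'n) \<Rightarrow> ('a \<Rightarrow> real^'n) \<Rightarrow> 'a \<Rightarrow> bool" where
  "germ_related X r \<phi> \<psi> x \<longleftrightarrow> (\<exists>T. ldiff r T (\<phi> x) \<and> near X x (\<lambda>y. \<psi> y = T (\<phi> y)))"

text \<open>There is no covering condition: partial atlases, even the empty one, occur while tubes
  are being added.\<close>

definition atlas :: "'a topology \<Rightarrow> enat \<Rightarrow> ('a, real^'n) chart set \<Rightarrow> bool" where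
  "atlas X r \<C> \<longleftrightarrow> (\<forall>c\<in>\<C>. chart_on X c) \<and>
     (\<forall>(U, \<phi>)\<in>\<C>. \<forall>(V, \<psi>)\<in>\<C>. \<forall>x\<in>U \<inter> V. germ_related X r \<phi> \<psi> x)"

text \<open>That is, \<open>\<psi>\<close> is near \<open>x\<close> a chart of the maximal \<open>C\<^sup>r\<close> atlas containing \<open>\<C>\<close>.\<close>

definition regular :: "'a topology \<Rightarrow> enat \<Rightarrow> ('a, real^'n) chart set \<Rightarrow> ('a \<Rightarrow> real^'n) \<Rightarrow> 'a \<Rightarrow> bool" where
  "regular X r \<C> \<psi> x \<longleftrightarrow> (\<exists>(U, \<phi>)\<in>\<C>. x \<in> U \<and> germ_related X r \<phi> \<psi> x)"

lemma germ_relatedI: "ldiff r T (\<phi> x) \<Longrightarrow> near X x (\<lambda>y. \<psi> y = T (\<phi> y)) \<Longrightarrow> germ_related X r \<phi> \<psi> x"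
  unfolding germ_related_def by blast

lemma germ_related_comp:
  assumes "germ_related X r \<phi> \<psi> x" "ldiff r S (\<psi> x)" "near X x (\<lambda>y. \<zeta> y = S (\<psi> y))"
  shows "germ_related X r \<phi> \<zeta> x"
proof -
  obtain T where T: "ldiff r T (\<phi> x)" "near X x (\<lambda>y. \<psi> y = T (\<phi> y))"
    using assms(1) unfolding germ_related_def by blast
  have "ldiff r (\<lambda>z. S (T z)) (\<phi> x)"
    using ldiff_compose[OF T(1), of S] assms(2) near_at[OF T(2)] by simp
  moreover have "near X x (\<lambda>y. \<zeta> y = S (T (\<phi> y)))"
    by (rule near_conj_mono[OF T(2) assms(3)]) simp
  ultimately show ?thesis by (rule germ_relatedI)
qed

lemma germ_related_trans:
  "germ_related X r \<phi> \<psi> x \<Longrightarrow> germ_related X r \<psi> \<zeta> x \<Longrightarrow> germ_related X r \<phi> \<zeta> x"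
  using germ_related_comp[of X r \<phi> \<psi> x _ \<zeta>] unfolding germ_related_def[of X r \<psi>] by blast

text \<open>\<open>\<phi>\<close> has to be a chart here: \<open>T' (T z) = z\<close> holds for z
  near \<open>\<phi> x\<close>, and continuity of \<open>\<phi>\<close> carries this back to a
  neighbourhood of \<open>x\<close>.\<close>

lemma germ_related_sym:
  assumes "germ_related X r \<phi> \<psi> x" "chart_on X (U, \<phi>)" "x \<in> U"
  shows "germ_related X r \<psi> \<phi> x"
proof -
  obtain T where T: "ldiff r T (\<phi> x)" "near X x (\<lambda>y. \<psi> y = T (\<phi> y))"
    using assms(1) unfolding germ_related_def by blast
  obtain T' where T': "ldiff r T' (T (\<phi> x))" "\<forall>\<^sub>F z in nhds (\<phi> x). T' (T z) = z"
    using ldiff_inverse[OF T(1)] by blast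
  have "near X x (\<lambda>y. \<phi> y = T' (\<psi> y))"
    using near_conj_mono[OF chart_near[OF assms(2,3) T'(2)] T(2)] by (metis (mono_tags, lifting))
  moreover have "ldiff r T' (\<psi> x)" using T'(1) near_at[OF T(2)] by simp
  ultimately show ?thesis by (metis germ_relatedI)
qed

lemma germ_related_mono: "germ_related X r \<phi> \<psi> x \<Longrightarrow> s \<le> r \<Longrightarrow> germ_related X s \<phi> \<psi> x"
  unfolding germ_related_def using ldiff_mono by blast

lemma germ_related_near:
  assumes "germ_related X r \<phi> \<psi> x" "chart_on X (U, \<phi>)" "x \<in> U"
  shows "near X x (germ_related X r \<phi> \<psi>)"
proof -
  obtain T where T: "ldiff r T (\<phi> x)" "near X x (\<lambda>y. \<psi> y = T (\<phi> y))"
    using assms(1) unfolding germ_related_def by blast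
  show ?thesis
    using chart_near[OF assms(2,3) ldiff_near[OF T(1)]] near_near[OF T(2)]
    by (rule near_conj_mono) (rule germ_relatedI)
qed

text \<open>Where the transition \<open>T\<close> is invertible, \<open>\<psi>\<close> inherits
  injectivity, continuity and openness from \<open>\<phi>\<close>.\<close>

lemma germ_related_chart:
  assumes "germ_related X r \<phi> \<psi> x" "chart_on X (U, \<phi>)" "x \<in> U"
  obtains V where "x \<in> V" "V \<subseteq> U" "chart_on X (V, \<psi>)"
proof -
  obtain T where T: "ldiff r T (\<phi> x)" "near X x (\<lambda>y. \<psi> y = T (\<phi> y))"
    using assms(1) unfolding germ_related_def by blast
  obtain N where N: "openin X N" "N \<subseteq> U" "x \<in> N" "open (\<phi> ` N)" "\<And>y. y \<in> N \<Longrightarrow> \<psi> y = T (\<phi> y)"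
    using chart_near_open[OF assms(2,3) T(2)] by metis
  obtain A T' where A: "\<phi> x \<in> A" "ldiff_on r T T' A"
    using T(1) unfolding ldiff_def by blast
  have oA: "open A" using A by (simp add: ldiff_on_def)
  define V where "V = N \<inter> (U \<inter> \<phi> -` A)"
  have V: "openin X V" "x \<in> V" "V \<subseteq> U" "V \<subseteq> N" "\<phi> ` V \<subseteq> A"
    using N A assms(3) chart_onD(5)[OF assms(2) oA] by (auto simp: V_def)
  have "chart_on X (V, \<psi>)"
  proof (rule chart_onI[OF V(1)])
    show "inj_on \<psi> V"
    proof (rule inj_onI)
      fix y z assume yz: "y \<in> V" "z \<in> V" "\<psi> y = \<psi> z"
      then have "T (\<phi> y) = T (\<phi> z)" using N(5) V(4) by (metis subsetD)
      then have "T' (T (\<phi> y)) = T' (T (\<phi> z))" by simp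
      then have "\<phi> y = \<phi> z" using A(2) V(5) yz unfolding ldiff_on_def by (metis image_subset_iff)
      then show "y = z" using chart_onD(2)[OF assms(2)] V yz by (meson inj_onD subsetD)
    qed
    show "near X y (\<lambda>z. \<psi> z \<in> W)" if y: "y \<in> V" and W: "open W" "\<psi> y \<in> W" for y W
    proof -
      have "isCont T (\<phi> y)" using ldiff_on_ldiff[OF A(2)] V(5) y ldiff_continuous by blast
      then have "\<forall>\<^sub>F z in nhds (\<phi> y). T z \<in> W"
        using W N(5) V y by (metis continuous_at topological_tendstoD tendsto_at_iff_tendsto_nhds subsetD)
      then have "near X y (\<lambda>z. T (\<phi> z) \<in> W)" using y V by (intro chart_near[OF assms(2)]) auto
      moreover have "near X y (\<lambda>z. \<psi> z = T (\<phi> z))" using N V y by (intro nearI[of X N]) auto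
      ultimately show ?thesis by (rule near_conj_mono) simp
    qed
    show "open (\<psi> ` B)" if B: "openin X B" "B \<subseteq> V" for B
    proof -
      have "\<psi> y = T (\<phi> y)" if "y \<in> B" for y using N(5) V(4) B(2) that by blast
      then have "\<psi> ` B = T ` \<phi> ` B" unfolding image_image by (rule image_cong[OF refl])
      moreover have "open (\<phi> ` B)" using chart_onD(4)[OF assms(2) B(1)] B V by blast
      ultimately show ?thesis
        using ldiff_on_subset[OF A(2), of "\<phi> ` B"] V(5) B by (auto simp: ldiff_on_def)
    qed
  qed
  then show ?thesis using that V by blast
qed

text \<open>Continuity and openness are local; injectivity is the one global condition on a
  chart.\<close>

lemma chart_on_local:
  assumes B: "openin X B" "inj_on \<psi> B" and loc: "\<And>x. x \<in> B \<Longrightarrow> \<exists>V. x \<in> V \<and> chart_on X (V, \<psi>)"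
  shows "chart_on X (B, \<psi>)"
proof (rule chart_onI[OF B])
  show "near X x (\<lambda>y. \<psi> y \<in> W)" if W: "x \<in> B" "open W" "\<psi> x \<in> W" for x W
  proof -
    obtain V where "x \<in> V" "chart_on X (V, \<psi>)" using loc[OF W(1)] by blast
    then show ?thesis using W(2,3) by (intro chart_near) (auto simp: eventually_nhds)
  qed
  show "open (\<psi> ` A)" if A: "openin X A" "A \<subseteq> B" for A
  proof (subst open_subopen, intro ballI)
    fix z assume "z \<in> \<psi> ` A"
    then obtain x where x: "x \<in> A" "z = \<psi> x" by blast
    then obtain V where V: "x \<in> V" "chart_on X (V, \<psi>)" using loc A by blast
    have "open (\<psi> ` (A \<inter> V))" using chart_onD(1,4)[OF V(2)] A by auto
    then show "\<exists>T. open T \<and> z \<in> T \<and> T \<subseteq> \<psi> ` A"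
      using x V by (intro exI[of _ "\<psi> ` (A \<inter> V)"]) auto
  qed
qed

section \<open>Transition maps between charts, recovered from germs\<close>

lemma transition_Cr:
  assumes U: "chart_on X (U, \<phi>)" and W: "W \<subseteq> U" and rel: "\<And>x. x \<in> W \<Longrightarrow> germ_related X r \<phi> \<psi> x"
  shows "Cr_on r (\<psi> \<circ> inv_into U \<phi>) (\<phi> ` W)"
proof (rule Cr_on_local)
  fix z assume "z \<in> \<phi> ` W"
  then obtain x where x: "x \<in> W" "z = \<phi> x" by blast
  then obtain T where T: "ldiff r T (\<phi> x)" "near X x (\<lambda>y. \<psi> y = T (\<phi> y))"
    using rel unfolding germ_related_def by blast
  obtain N where N: "openin X N" "N \<subseteq> U" "x \<in> N" "open (\<phi> ` N)" "\<And>y. y \<in> N \<Longrightarrow> \<psi> y = T (\<phi> y)"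
    using chart_near_open[OF U _ T(2)] x W by (metis subsetD)
  obtain A T' where A: "\<phi> x \<in> A" "A \<subseteq> \<phi> ` N" "ldiff_on r T T' A"
    using ldiff_shrink[OF T(1) N(4)] N(3) by blast
  have "Cr_on r (\<psi> \<circ> inv_into U \<phi>) A"
  proof (rule Cr_on_cong)
    show "open A" "Cr_on r T A" using A by (auto simp: ldiff_on_def)
    fix y assume "y \<in> A"
    then obtain w where w: "w \<in> N" "y = \<phi> w" using A by blast
    then show "T y = (\<psi> \<circ> inv_into U \<phi>) y"
      using N chart_onD(2)[OF U] by (simp add: inv_into_f_f subset_iff)
  qed
  then show "\<exists>A. open A \<and> z \<in> A \<and> Cr_on r (\<psi> \<circ> inv_into U \<phi>) A"
    using A x by (auto simp: ldiff_on_def)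
qed

lemma transition_ldiff_on:
  assumes U: "chart_on X (U, \<phi>)" and V: "chart_on X (V, \<psi>)" and W: "openin X W" "W \<subseteq> U" "W \<subseteq> V"
    and rel: "\<And>x. x \<in> W \<Longrightarrow> germ_related X r \<phi> \<psi> x"
  shows "ldiff_on r (\<psi> \<circ> inv_into U \<phi>) (\<phi> \<circ> inv_into V \<psi>) (\<phi> ` W)"
proof -
  have inv: "inv_into U \<phi> (\<phi> x) = x" "inv_into V \<psi> (\<psi> x) = x" if "x \<in> W" for x
    using that W chart_onD(2)[OF U] chart_onD(2)[OF V] by (auto simp: inv_into_f_f)
  have im: "(\<psi> \<circ> inv_into U \<phi>) ` \<phi> ` W = \<psi> ` W"
    using inv by (force simp: image_image)
  have "Cr_on r (\<phi> \<circ> inv_into V \<psi>) (\<psi> ` W)"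
    using transition_Cr[OF V W(3)] germ_related_sym[OF rel U] W(2) by blast
  then show ?thesis
    unfolding ldiff_on_def im
    using transition_Cr[OF U W(2) rel] chart_onD(4)[OF U W(1,2)] chart_onD(4)[OF V W(1,3)] inv
    by auto
qed

subsection \<open>Regular germs with respect to an atlas\<close>

lemma atlasD: "atlas X r \<C> \<Longrightarrow> (U, \<phi>) \<in> \<C> \<Longrightarrow> chart_on X (U, \<phi>)"
  unfolding atlas_def by blast

lemma atlas_germ_related:
  "atlas X r \<C> \<Longrightarrow> (U, \<phi>) \<in> \<C> \<Longrightarrow> (V, \<psi>) \<in> \<C> \<Longrightarrow> x \<in> U \<Longrightarrow> x \<in> V \<Longrightarrow> germ_related X r \<phi> \<psi> x"
  unfolding atlas_def by blast

lemma atlas_mono: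
  assumes "atlas X r \<C>" "s \<le> r"
  shows "atlas X s \<C>"
  using assms(1) germ_related_mono[OF _ assms(2)] unfolding atlas_def by fast

lemma regularE:
  assumes "regular X r \<C> \<psi> x"
  obtains U \<phi> where "(U, \<phi>) \<in> \<C>" "x \<in> U" "germ_related X r \<phi> \<psi> x"
  using assms unfolding regular_def by blast

lemma regularI: "(U, \<phi>) \<in> \<C> \<Longrightarrow> x \<in> U \<Longrightarrow> germ_related X r \<phi> \<psi> x \<Longrightarrow> regular X r \<C> \<psi> x"
  unfolding regular_def by blast

lemma regular_chart: "(U, \<phi>) \<in> \<C> \<Longrightarrow> x \<in> U \<Longrightarrow> atlas X r \<C> \<Longrightarrow> regular X r \<C> \<phi> x"
  using regularI atlas_germ_related by metis

lemma regular_germ_related: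
  assumes "regular X r \<C> \<phi> x" "germ_related X r \<phi> \<psi> x"
  shows "regular X r \<C> \<psi> x"
  using assms(1) germ_related_trans[OF _ assms(2)] unfolding regular_def by blast

lemma regular_comp:
  assumes "regular X r \<C> \<psi> x" "ldiff r S (\<psi> x)" "near X x (\<lambda>y. \<zeta> y = S (\<psi> y))"
  shows "regular X r \<C> \<zeta> x"
  using regular_germ_related[OF assms(1) germ_relatedI[of r S \<psi> x X \<zeta>]] assms(2,3) .

lemma regular_cong: "regular X r \<C> \<psi> x \<Longrightarrow> near X x (\<lambda>y. \<zeta> y = \<psi> y) \<Longrightarrow> regular X r \<C> \<zeta> x"
  by (erule regular_comp[OF _ ldiff_id])

text \<open>The relation passes through two charts of the atlas, \<open>\<psi>\<close> to
  \<open>\<phi>\<close> to \<open>\<xi>\<close> to \<open>\<zeta>\<close>; the first arrow is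
  reversed by \<open>germ_related_sym\<close>.\<close>

lemma regular_related:
  assumes "atlas X r \<C>" "regular X r \<C> \<psi> x" "regular X r \<C> \<zeta> x"
  shows "germ_related X r \<psi> \<zeta> x"
proof -
  obtain U \<phi> where U: "(U, \<phi>) \<in> \<C>" "x \<in> U" "germ_related X r \<phi> \<psi> x" using assms(2) by (rule regularE)
  obtain V \<xi> where V: "(V, \<xi>) \<in> \<C>" "x \<in> V" "germ_related X r \<xi> \<zeta> x" using assms(3) by (rule regularE)
  have "germ_related X r \<psi> \<phi> x" using germ_related_sym[OF U(3) atlasD[OF assms(1) U(1)] U(2)] .
  then show ?thesis
    by (rule germ_related_trans[OF germ_related_trans[OF _ atlas_germ_related[OF assms(1) U(1) V(1) U(2) V(2)]] V(3)])
qed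

lemma regular_near: "atlas X r \<C> \<Longrightarrow> regular X r \<C> \<psi> x \<Longrightarrow> near X x (regular X r \<C> \<psi>)"
proof -
  assume C: "atlas X r \<C>" and "regular X r \<C> \<psi> x"
  then obtain U \<phi> where U: "(U, \<phi>) \<in> \<C>" "x \<in> U" "germ_related X r \<phi> \<psi> x" by (meson regularE)
  have "near X x (\<lambda>y. y \<in> U)" using U atlasD[OF C U(1)] chart_onD(1) by (intro nearI) auto
  then show ?thesis
    using germ_related_near[OF U(3) atlasD[OF C U(1)] U(2)] by (rule near_conj_mono) (use U regularI in metis)
qed

lemma regular_local_chart:
  assumes "atlas X r \<C>" "regular X r \<C> \<psi> x"
  obtains V where "x \<in> V" "chart_on X (V, \<psi>)" "\<And>y. y \<in> V \<Longrightarrow> regular X r \<C> \<psi> y"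
proof -
  obtain U \<phi> where U: "(U, \<phi>) \<in> \<C>" "x \<in> U" "germ_related X r \<phi> \<psi> x" using assms by (meson regularE)
  obtain V where V: "x \<in> V" "V \<subseteq> U" "chart_on X (V, \<psi>)"
    using germ_related_chart[OF U(3) atlasD[OF assms(1) U(1)] U(2)] .
  obtain N where N: "openin X N" "N \<subseteq> V" "x \<in> N" "\<And>y. y \<in> N \<Longrightarrow> regular X r \<C> \<psi> y"
    using chart_near_open[OF V(3,1) regular_near[OF assms]] by metis
  then show ?thesis using that[OF N(3) chart_on_subset[OF V(3) N(1,2)] N(4)] by blast
qed

lemma regular_chart_on:
  assumes "atlas X r \<C>" "openin X B" "inj_on \<psi> B" "\<And>x. x \<in> B \<Longrightarrow> regular X r \<C> \<psi> x"
  shows "chart_on X (B, \<psi>)"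
proof (rule chart_on_local[OF assms(2,3)])
  fix x assume "x \<in> B"
  from regular_local_chart[OF assms(1) assms(4)[OF this]]
  show "\<exists>V. x \<in> V \<and> chart_on X (V, \<psi>)" by metis
qed

text \<open>The transition is already a C^1 diffeomorphism germ \<open>S\<close>. A C^r formula
  \<open>T\<close> for it agrees with \<open>S\<close> on the open image of a neighbourhood, hence
  is itself invertible to first order, and \<open>ldiff_upgrade\<close> applies.\<close>

lemma regular_upgrade:
  assumes C: "regular X r \<C> \<phi> x" and r: "1 \<le> r"
    and rel: "germ_related X 1 \<phi> \<psi> x" and U: "chart_on X (U, \<phi>)" "x \<in> U"
    and T: "near X x (\<lambda>y. \<psi> y = T (\<phi> y))" "open W" "\<phi> x \<in> W" "Cr_on r T W"
  shows "regular X r \<C> \<psi> x"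
proof -
  obtain S where S: "ldiff 1 S (\<phi> x)" "near X x (\<lambda>y. \<psi> y = S (\<phi> y))"
    using rel unfolding germ_related_def by blast
  obtain N where N: "openin X N" "N \<subseteq> U" "x \<in> N" "open (\<phi> ` N)" "\<And>y. y \<in> N \<Longrightarrow> \<psi> y = S (\<phi> y) \<and> \<psi> y = T (\<phi> y)"
    using chart_near_open[OF U near_conj[OF S(2) T(1)]] by metis
  have "S (\<phi> y) = T (\<phi> y)" if "y \<in> N" for y using N(5)[OF that] by metis
  then have "\<forall>\<^sub>F z in nhds (\<phi> x). S z = T z"
    unfolding eventually_nhds using N(3,4) by (intro exI[of _ "\<phi> ` N"]) auto
  then have "ldiff 1 T (\<phi> x)" using ldiff_cong[OF S(1)] by blast
  then have "ldiff r T (\<phi> x)" using ldiff_upgrade T r by blast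
  then show ?thesis using regular_comp[OF C _ T(1)] by blast
qed

lemma smooth_atlas_atlas:
  fixes \<A> :: "('a, real^'n) chart set"
  assumes "smooth_atlas X \<A>"
  shows "atlas X \<infinity> \<A>"
  unfolding atlas_def
proof (intro conjI ballI, goal_cases)
  case (1 c)
  then show ?case using assms by (simp add: smooth_atlas_def)
next
  case (2 c)
  obtain U \<phi> where c: "c = (U, \<phi>)" by (cases c)
  show ?case
    unfolding c prod.case
  proof (intro ballI, clarify)
    fix V and \<psi> :: "'a \<Rightarrow> real^'n" and x assume V: "(V, \<psi>) \<in> \<A>" and x: "x \<in> U" "x \<in> V"
    have U: "(U, \<phi>) \<in> \<A>" using 2 c by simp
    have ch: "chart_on X (U, \<phi>)" "chart_on X (V, \<psi>)" using assms U V by (auto simp: smooth_atlas_def)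
    have t: "Cr_on \<infinity> (\<psi> \<circ> inv_into U \<phi>) (\<phi> ` (U \<inter> V))" "Cr_on \<infinity> (\<phi> \<circ> inv_into V \<psi>) (\<psi> ` (V \<inter> U))"
      using assms U V unfolding smooth_atlas_def by fast+
    have o: "openin X (U \<inter> V)" using ch chart_onD(1) by blast
    have inv: "inv_into U \<phi> (\<phi> y) = y" "inv_into V \<psi> (\<psi> y) = y" if "y \<in> U \<inter> V" for y
      using that chart_onD(2)[OF ch(1)] chart_onD(2)[OF ch(2)] by (auto simp: inv_into_f_f)
    have im: "(\<psi> \<circ> inv_into U \<phi>) ` \<phi> ` (U \<inter> V) = \<psi> ` (U \<inter> V)" using inv by (force simp: image_image)
    have "ldiff_on \<infinity> (\<psi> \<circ> inv_into U \<phi>) (\<phi> \<circ> inv_into V \<psi>) (\<phi> ` (U \<inter> V))"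
      unfolding ldiff_on_def im
      using t o chart_onD(4)[OF ch(1) o] chart_onD(4)[OF ch(2) o] inv by (auto simp: Int_commute)
    then have "ldiff \<infinity> (\<psi> \<circ> inv_into U \<phi>) (\<phi> x)" using x ldiff_on_ldiff by blast
    moreover have "near X x (\<lambda>y. \<psi> y = (\<psi> \<circ> inv_into U \<phi>) (\<phi> y))"
      using x inv by (intro nearI[OF o]) auto
    ultimately show "germ_related X \<infinity> \<phi> \<psi> x" by (rule germ_relatedI)
  qed
qed

subsection \<open>Relative smoothing of a \<open>C\<^sup>1\<close> chart\<close>

lemma regular_tame:
  assumes "atlas X 1 \<A>" "regular X 1 \<A> \<psi> x" "tame \<delta> W \<theta>" "\<delta> \<le> 1/2"
  shows "regular X 1 \<A> (\<lambda>y. \<theta> (\<psi> y)) x"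
proof (rule regular_comp[OF assms(2)])
  show "ldiff 1 \<theta> (\<psi> x)" using tame_ldiff tame_mono[OF assms(3,4)] by blast
  obtain V where "x \<in> V" "chart_on X (V, \<psi>)" using regular_local_chart[OF assms(1,2)] .
  then show "near X x (\<lambda>y. \<theta> (\<psi> y) = \<theta> (\<psi> y))" using chart_onD(1) by (intro nearI) auto
qed

text \<open>\<open>local_smoothing\<close> is applied to the transition map from a coordinate
  \<open>\<phi>\<close> of \<open>\<C>\<close> to \<open>\<psi>\<close>, so \<open>\<theta>\<close>
  acts on the target of \<open>\<psi>\<close>. The last conclusion, survival of smoothness already
  achieved, is what allows iteration.\<close>

lemma smoothing_in_chart:
  assumes C: "atlas X \<infinity> \<C>" and A: "atlas X 1 \<A>"
    and CA: "\<And>\<phi> x. regular X \<infinity> \<C> \<phi> x \<Longrightarrow> regular X 1 \<A> \<phi> x"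
    and B: "openin X B" "inj_on \<psi> B" "\<And>x. x \<in> B \<Longrightarrow> regular X 1 \<A> \<psi> x"
    and V: "openin X V" "V \<subseteq> B"
    and U: "(U, \<phi>) \<in> \<C>" "cball c R \<subseteq> \<phi> ` (U \<inter> V)" "0 < r" "r < R" and \<delta>: "0 < \<delta>" "\<delta> \<le> 1/2"
  obtains \<theta> where "tame \<delta> (\<psi> ` V) \<theta>"
    "\<And>y. y \<in> U \<Longrightarrow> \<phi> y \<in> ball c r \<Longrightarrow> regular X \<infinity> \<C> (\<lambda>y. \<theta> (\<psi> y)) y"
    "\<And>y. y \<in> B \<Longrightarrow> regular X \<infinity> \<C> \<psi> y \<Longrightarrow> regular X \<infinity> \<C> (\<lambda>y. \<theta> (\<psi> y)) y"
proof -
  have ch: "chart_on X (U, \<phi>)" using atlasD[OF C U(1)] .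
  have chB: "chart_on X (B, \<psi>)" using regular_chart_on[OF A B] .
  let ?N = "U \<inter> V"
  have N: "openin X ?N" "?N \<subseteq> U" "?N \<subseteq> B" using chart_onD(1)[OF ch] V by auto
  have rel: "germ_related X 1 \<phi> \<psi> x" if "x \<in> ?N" for x
    using regular_related[OF A CA[OF regular_chart[OF U(1) _ C]] B(3)] that N by blast
  define f where "f = \<psi> \<circ> inv_into U \<phi>"
  have f\<phi>: "f (\<phi> y) = \<psi> y" if "y \<in> U" for y
    using that chart_onD(2)[OF ch] by (simp add: f_def inv_into_f_f)
  have ld: "ldiff_on 1 f (\<phi> \<circ> inv_into B \<psi>) (\<phi> ` ?N)"
    unfolding f_def by (rule transition_ldiff_on[OF ch chB N rel])
  have f_im: "f ` \<phi> ` ?N = \<psi> ` ?N" using f\<phi> by (force simp: image_image)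
  obtain \<theta> where \<theta>: "tame \<delta> (f ` \<phi> ` ?N) \<theta>" "Cr_on \<infinity> (\<lambda>x. \<theta> (f x)) (ball c r)"
    "\<And>W. open W \<Longrightarrow> W \<subseteq> \<phi> ` ?N \<Longrightarrow> Cr_on \<infinity> f W \<Longrightarrow> Cr_on \<infinity> (\<lambda>x. \<theta> (f x)) W"
    using local_smoothing[OF ld U(2,3,4) \<delta>(1)] by blast
  have tm: "tame \<delta> (\<psi> ` ?N) \<theta>" using \<theta>(1) f_im by simp
  have upgrade: "regular X \<infinity> \<C> (\<lambda>y. \<theta> (\<psi> y)) y"
    if y: "y \<in> ?N" and W: "open W" "\<phi> y \<in> W" "Cr_on \<infinity> (\<lambda>x. \<theta> (f x)) W" for y W
  proof (rule regular_upgrade[OF regular_chart[OF U(1) _ C] _ _ ch _ _ W])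
    show "germ_related X 1 \<phi> (\<lambda>y. \<theta> (\<psi> y)) y"
      using regular_related[OF A CA[OF regular_chart[OF U(1) _ C]] regular_tame[OF A B(3) tm \<delta>(2)]] y N by blast
    show "near X y (\<lambda>y. \<theta> (\<psi> y) = \<theta> (f (\<phi> y)))"
      using y f\<phi> by (intro nearI[OF N(1)]) auto
  qed (use y in auto)
  show ?thesis
  proof (rule that)
    show "tame \<delta> (\<psi> ` V) \<theta>" using tame_mono[OF tm order_refl] by blast
    show "regular X \<infinity> \<C> (\<lambda>y. \<theta> (\<psi> y)) y" if y: "y \<in> U" "\<phi> y \<in> ball c r" for y
    proof (rule upgrade[OF _ open_ball y(2) \<theta>(2)])
      have "\<phi> y \<in> \<phi> ` ?N" using U y by (meson ball_subset_cball subsetD subset_ball less_imp_le)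
      then show "y \<in> ?N" using y chart_onD(2)[OF ch] by (auto dest: inj_onD)
    qed
    show "regular X \<infinity> \<C> (\<lambda>y. \<theta> (\<psi> y)) y" if y: "y \<in> B" "regular X \<infinity> \<C> \<psi> y" for y
    proof (cases "y \<in> ?N")
      \<comment> \<open>Inside \<open>U \<inter> V\<close> the old smoothness means that
        \<open>f\<close> is smooth near \<open>\<phi> y\<close>, a property that the perturbation
        keeps.\<close>
      case True
      then obtain T where T: "ldiff \<infinity> T (\<phi> y)" "near X y (\<lambda>z. \<psi> z = T (\<phi> z))"
        using regular_related[OF C regular_chart[OF U(1) _ C] y(2)] unfolding germ_related_def by blast
      have "near X y (\<lambda>z. z \<in> ?N)" using True N by (intro nearI) auto
      then obtain M where M: "openin X M" "M \<subseteq> U" "y \<in> M" "open (\<phi> ` M)"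
        "\<And>z. z \<in> M \<Longrightarrow> \<psi> z = T (\<phi> z) \<and> z \<in> ?N"
        using chart_near_open[OF ch _ near_conj[OF T(2)]] True by (metis IntE)
      have y': "\<phi> y \<in> \<phi> ` M" using M(3) by blast
      obtain W T' where W: "\<phi> y \<in> W" "W \<subseteq> \<phi> ` M" "ldiff_on \<infinity> T T' W"
        using ldiff_shrink[OF T(1) M(4) y'] .
      have oW: "open W" "Cr_on \<infinity> T W" using W(3) by (auto simp: ldiff_on_def)
      have "T x = f x" if xW: "x \<in> W" for x
      proof -
        obtain z where z: "z \<in> M" "x = \<phi> z" using W(2) xW by blast
        then show ?thesis using M(2) M(5)[OF z(1)] f\<phi>[of z] by auto
      qed
      then have "Cr_on \<infinity> f W" using Cr_on_cong[OF oW(1) _ oW(2)] by blast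
      moreover have "W \<subseteq> \<phi> ` ?N" using W(2) M(5) by blast
      ultimately have "Cr_on \<infinity> (\<lambda>x. \<theta> (f x)) W" using \<theta>(3) oW(1) by blast
      then show ?thesis using upgrade[OF True oW(1) W(1)] by blast
    next
      \<comment> \<open>Outside, injectivity of \<open>\<psi>\<close> on \<open>B\<close> puts
        \<open>\<psi> y\<close> off the compact support, so \<open>\<theta>\<close> is the identity
        near it.\<close>
      case False
      obtain Z where Z: "compact Z" "Z \<subseteq> \<psi> ` ?N" "\<And>z. z \<notin> Z \<Longrightarrow> \<theta> z = z"
        using tm by (auto simp: tame_def)
      have "\<psi> y \<notin> Z" using False Z(2) y(1) B(2) N by (auto dest: inj_onD)
      then have "\<forall>\<^sub>F z in nhds (\<psi> y). \<theta> z = z"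
        unfolding eventually_nhds using Z compact_imp_closed by (intro exI[of _ "- Z"]) auto
      then have "near X y (\<lambda>z. \<theta> (\<psi> z) = \<psi> z)" by (rule chart_near[OF chB y(1)])
      then show ?thesis by (rule regular_cong[OF y(2)])
    qed
  qed
qed

text \<open>Compactness of \<open>L\<close> leaves finitely many coordinate balls, treated in turn;
  a ball once smoothed stays smooth by the last conclusion of
  \<open>smoothing_in_chart\<close>.\<close>

theorem relative_smoothing:
  assumes C: "atlas X \<infinity> \<C>" and A: "atlas X 1 \<A>"
    and CA: "\<And>\<phi> x. regular X \<infinity> \<C> \<phi> x \<Longrightarrow> regular X 1 \<A> \<phi> x"
    and B: "openin X B" "inj_on \<psi> B" "\<And>x. x \<in> B \<Longrightarrow> regular X 1 \<A> \<psi> x"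
    and V: "openin X V" "V \<subseteq> B" "V \<subseteq> \<Union> (fst ` \<C>)" and L: "compactin X L" "L \<subseteq> V" and \<delta>: "0 < \<delta>"
  obtains \<theta> where "tame \<delta> (\<psi> ` V) \<theta>"
    "\<And>y. y \<in> L \<Longrightarrow> regular X \<infinity> \<C> (\<lambda>y. \<theta> (\<psi> y)) y"
    "\<And>y. y \<in> B \<Longrightarrow> regular X \<infinity> \<C> \<psi> y \<Longrightarrow> regular X \<infinity> \<C> (\<lambda>y. \<theta> (\<psi> y)) y"
proof -
  \<comment> \<open>Coordinate balls of radius \<open>r\<close>, with room up to radius
    \<open>R\<close> for the cutoffs.\<close>
  define good where "good N \<longleftrightarrow> (\<exists>U \<phi> c R r. (U, \<phi>) \<in> \<C> \<and> cball c R \<subseteq> \<phi> ` (U \<inter> V) \<and> 0 < r \<and> r < R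
    \<and> N = U \<inter> \<phi> -` ball c r)" for N
  have "\<exists>N. good N \<and> x \<in> N" if x: "x \<in> L" for x
  proof -
    have "x \<in> \<Union> (fst ` \<C>)" using x L(2) V(3) by blast
    then obtain U \<phi> where U: "(U, \<phi>) \<in> \<C>" "x \<in> U" by auto
    have ch: "chart_on X (U, \<phi>)" using atlasD[OF C U(1)] .
    have "open (\<phi> ` (U \<inter> V))" using chart_onD(1,4)[OF ch] V by auto
    moreover have "\<phi> x \<in> \<phi> ` (U \<inter> V)" using U x L by auto
    ultimately obtain R where R: "0 < R" "cball (\<phi> x) R \<subseteq> \<phi> ` (U \<inter> V)"
      using open_contains_cball by blast
    then have "good (U \<inter> \<phi> -` ball (\<phi> x) (R/2))"
      unfolding good_def using U by (intro exI[of _ U] exI[of _ \<phi>] exI[of _ "\<phi> x"] exI[of _ R] exI[of _ "R/2"]) auto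
    moreover have "x \<in> U \<inter> \<phi> -` ball (\<phi> x) (R/2)" using U R by simp
    ultimately show ?thesis by blast
  qed
  then have cover: "L \<subseteq> \<Union> {N. good N}" by blast
  have "openin X N" if "good N" for N
    using that chart_onD(5)[OF atlasD[OF C]] unfolding good_def by auto
  then obtain \<F> where \<F>: "finite \<F>" "\<F> \<subseteq> {N. good N}" "L \<subseteq> \<Union> \<F>"
    using L(1) cover unfolding compactin_def by (metis mem_Collect_eq)
  have "\<exists>\<theta>. tame \<delta> (\<psi> ` V) \<theta> \<and> (\<forall>y\<in>\<Union> \<F>. regular X \<infinity> \<C> (\<lambda>y. \<theta> (\<psi> y)) y)
     \<and> (\<forall>y\<in>B. regular X \<infinity> \<C> \<psi> y \<longrightarrow> regular X \<infinity> \<C> (\<lambda>y. \<theta> (\<psi> y)) y)" if "0 < \<delta>" "\<delta> \<le> 1/2" for \<delta>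
    using \<F>(1,2) that
  proof (induction \<F> arbitrary: \<delta>)
    case empty
    then show ?case by (intro exI[of _ "\<lambda>x. x"]) (auto simp: tame_id)
  next
    case (insert N \<F>)
    \<comment> \<open>Two maps of size \<open>\<delta>/3\<close> compose to size 2\<delta>/3 +
      \<delta>^2/9, which is at most \<open>\<delta>\<close> for
      \<open>\<delta> \<le> 1/2\<close>.\<close>
    have \<delta>3: "0 < \<delta>/3" "\<delta>/3 \<le> 1/2" using insert.prems by auto
    obtain \<theta> where \<theta>: "tame (\<delta>/3) (\<psi> ` V) \<theta>" "\<forall>y\<in>\<Union> \<F>. regular X \<infinity> \<C> (\<lambda>y. \<theta> (\<psi> y)) y"
      "\<forall>y\<in>B. regular X \<infinity> \<C> \<psi> y \<longrightarrow> regular X \<infinity> \<C> (\<lambda>y. \<theta> (\<psi> y)) y"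
      using insert.IH[OF _ \<delta>3] insert.prems(1) by auto
    define \<psi>1 where "\<psi>1 y = \<theta> (\<psi> y)" for y
    have tm: "tame (1/2) (\<psi> ` V) \<theta>" using tame_mono[OF \<theta>(1) \<delta>3(2)] by blast
    have bij: "bij \<theta>" "\<And>x. \<theta> x \<in> \<psi> ` V \<longleftrightarrow> x \<in> \<psi> ` V" using tame_bij[OF tm] by auto
    \<comment> \<open>The image of \<open>V\<close> does not change, so all perturbations are
      supported in the same set and \<open>tame_compose\<close> applies.\<close>
    have "\<theta> ` \<psi> ` V = \<psi> ` V"
    proof (intro subset_antisym subsetI)
      fix y assume y: "y \<in> \<psi> ` V"
      obtain x where x: "y = \<theta> x" using bij_is_surj[OF bij(1)] by (rule surjE)
      then have "x \<in> \<psi> ` V" using bij(2) y by simp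
      then show "y \<in> \<theta> ` \<psi> ` V" using x by blast
    next
      fix y assume "y \<in> \<theta> ` \<psi> ` V"
      then obtain x where "y = \<theta> x" "x \<in> \<psi> ` V" by (rule imageE)
      then show "y \<in> \<psi> ` V" using bij(2) by simp
    qed
    then have im: "\<psi>1 ` V = \<psi> ` V" by (simp add: \<psi>1_def[abs_def] image_image[symmetric])
    have B1: "inj_on \<psi>1 B"
    proof (rule inj_onI)
      fix x y assume xy: "x \<in> B" "y \<in> B" "\<psi>1 x = \<psi>1 y"
      then have "\<psi> x = \<psi> y" using injD[OF bij_is_inj[OF bij(1)]] by (simp add: \<psi>1_def)
      then show "x = y" using inj_onD[OF B(2)] xy by blast
    qed
    have B2: "regular X 1 \<A> \<psi>1 x" if "x \<in> B" for x
      unfolding \<psi>1_def[abs_def] using regular_tame[OF A B(3)[OF that] tm] by simp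
    obtain U \<phi> c R r where N: "(U, \<phi>) \<in> \<C>" "cball c R \<subseteq> \<phi> ` (U \<inter> V)" "0 < r" "r < R" "N = U \<inter> \<phi> -` ball c r"
      using insert.prems(1) unfolding good_def by auto
    obtain \<eta> where \<eta>: "tame (\<delta>/3) (\<psi>1 ` V) \<eta>"
      "\<And>y. y \<in> U \<Longrightarrow> \<phi> y \<in> ball c r \<Longrightarrow> regular X \<infinity> \<C> (\<lambda>y. \<eta> (\<psi>1 y)) y"
      "\<And>y. y \<in> B \<Longrightarrow> regular X \<infinity> \<C> \<psi>1 y \<Longrightarrow> regular X \<infinity> \<C> (\<lambda>y. \<eta> (\<psi>1 y)) y"
      using smoothing_in_chart[OF C A CA B(1) B1 B2 V(1,2) N(1-4) \<delta>3] by blast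
    have "tame (\<delta>/3 + \<delta>/3 + \<delta>/3 * (\<delta>/3)) (\<psi> ` V) (\<lambda>x. \<eta> (\<theta> x))"
      by (rule tame_compose[OF _ \<theta>(1)]) (use \<eta>(1) im \<delta>3 in simp_all)
    moreover have "\<delta>/3 + \<delta>/3 + \<delta>/3 * (\<delta>/3) \<le> \<delta>"
    proof -
      have "\<delta>/3 * (\<delta>/3) \<le> \<delta>/3 * 1" using insert.prems by (intro mult_left_mono) auto
      then show ?thesis by linarith
    qed
    ultimately have "tame \<delta> (\<psi> ` V) (\<lambda>x. \<eta> (\<theta> x))" using tame_mono by blast
    moreover have "regular X \<infinity> \<C> (\<lambda>y. \<eta> (\<theta> (\<psi> y))) y" if "y \<in> B" "regular X \<infinity> \<C> \<psi>1 y" for y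
      using \<eta>(3)[OF that] by (simp add: \<psi>1_def)
    moreover have "\<Union> \<F> \<subseteq> B"
    proof
      fix y assume "y \<in> \<Union> \<F>"
      then obtain M where "good M" "y \<in> M" using insert.prems by auto
      then obtain U \<phi> c R r where M: "(U, \<phi>) \<in> \<C>" "cball c R \<subseteq> \<phi> ` (U \<inter> V)" "r < R" "y \<in> U" "\<phi> y \<in> ball c r"
        unfolding good_def by auto
      then have "\<phi> y \<in> \<phi> ` (U \<inter> V)" by (meson ball_subset_cball subsetD subset_ball less_imp_le)
      then show "y \<in> B" using M(4) chart_onD(2)[OF atlasD[OF C M(1)]] V(2) by (auto dest: inj_onD)
    qed
    moreover have "regular X \<infinity> \<C> (\<lambda>y. \<eta> (\<theta> (\<psi> y))) y" if "y \<in> N" for y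
      using \<eta>(2)[of y] that N(5) by (simp add: \<psi>1_def)
    ultimately show ?case
      using \<theta>(2,3) unfolding \<psi>1_def[abs_def]
      by (intro exI[of _ "\<lambda>x. \<eta> (\<theta> x)"]) auto
  qed
  note claim = this
  have "0 < min \<delta> (1/2)" "min \<delta> (1/2) \<le> 1/2" using \<delta> by auto
  from claim[OF this] obtain \<theta> where "tame (min \<delta> (1/2)) (\<psi> ` V) \<theta>"
    "\<forall>y\<in>\<Union> \<F>. regular X \<infinity> \<C> (\<lambda>y. \<theta> (\<psi> y)) y"
    "\<forall>y\<in>B. regular X \<infinity> \<C> \<psi> y \<longrightarrow> regular X \<infinity> \<C> (\<lambda>y. \<theta> (\<psi> y)) y" by blast
  moreover from this(1) have "tame \<delta> (\<psi> ` V) \<theta>" by (rule tame_mono) auto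
  ultimately show ?thesis using \<F>(3) by (intro that) blast+
qed

section \<open>An invariant smooth structure\<close>

lemma near_Ball_finite:
  assumes "finite I" "\<And>i. i \<in> I \<Longrightarrow> near X x (P i)" "x \<in> topspace X"
  shows "near X x (\<lambda>y. \<forall>i\<in>I. P i y)"
  using assms(1,2)
proof (induction I)
  case empty
  then show ?case using assms(3) by (auto intro: nearI[of X "topspace X"])
next
  case (insert i I)
  show ?case by (rule near_conj_mono[of X x "P i" "\<lambda>y. \<forall>i\<in>I. P i y"]) (use insert in auto)
qed

lemma regular_topspace: "atlas X r \<C> \<Longrightarrow> regular X r \<C> \<phi> x \<Longrightarrow> x \<in> topspace X"
  by (meson atlasD chart_onD(1) openin_subset regularE subsetD)

lemma regular_refine:
  assumes "\<And>U \<phi> x. (U, \<phi>) \<in> \<C> \<Longrightarrow> x \<in> U \<Longrightarrow> regular X 1 \<A> \<phi> x" "regular X \<infinity> \<C> \<psi> x"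
  shows "regular X 1 \<A> \<psi> x"
  using assms by (meson germ_related_mono enat_ord_simps(3) regularE regular_germ_related)

text \<open>By continuity of the derivative, \<open>q\<close> minus the identity is Lipschitz with
  constant 1/2 on a small ball, so there \<open>q\<close> keeps at least half of every
  distance.\<close>

lemma ldiff_at_derivative_id:
  fixes q :: "real^'n \<Rightarrow> real^'n"
  assumes W: "open W" "c \<in> W" and q: "Cn_on (Suc 0) q W" and d: "(q has_derivative (\<lambda>v. v)) (at c)"
  shows "ldiff 1 q c"
proof -
  define D where "D x = Blinfun (frechet_derivative q (at x))" for x
  have D: "(q has_derivative blinfun_apply (D x)) (at x)" if "x \<in> W" for x
    using Cn1_blinfun(1)[OF q that] by (simp add: D_def)
  have "continuous_on W D" using Cn1_blinfun(2)[OF q] by (simp add: D_def[abs_def])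
  then have "isCont D c" using W continuous_on_eq_continuous_at by blast
  then obtain e where e: "e > 0" "\<And>x. dist x c < e \<Longrightarrow> dist (D x) (D c) < 1/2"
    unfolding continuous_at_eps_delta by (metis half_gt_zero zero_less_one)
  obtain e' where e': "e' > 0" "ball c e' \<subseteq> W" using W open_contains_ball by blast
  define V where "V = ball c (min e e')"
  have V: "open V" "c \<in> V" "V \<subseteq> W" "convex V" using e e' by (auto simp: V_def)
  have Dc: "blinfun_apply (D c) = (\<lambda>v. v)" using has_derivative_unique[OF D[OF W(2)] d] .
  have lip: "norm ((q x - x) - (q y - y)) \<le> 1/2 * norm (x - y)" if "x \<in> V" "y \<in> V" for x y
  proof (rule differentiable_bound[OF V(4) _ _ that])
    show "((\<lambda>x. q x - x) has_derivative blinfun_apply (D x - D c)) (at x within V)" if "x \<in> V" for x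
    proof -
      have "((\<lambda>x. q x - x) has_derivative (\<lambda>v. blinfun_apply (D x) v - v)) (at x)"
        using D V(3) that by (intro has_derivative_diff has_derivative_ident) auto
      moreover have "blinfun_apply (D x - D c) = (\<lambda>v. blinfun_apply (D x) v - v)"
        by (simp add: fun_eq_iff minus_blinfun.rep_eq Dc)
      ultimately show ?thesis by (simp add: has_derivative_at_withinI)
    qed
    show "onorm (blinfun_apply (D x - D c)) \<le> 1/2" if "x \<in> V" for x
      using e(2)[of x] that by (simp add: V_def dist_norm norm_blinfun.rep_eq norm_minus_commute)
  qed
  show ?thesis
  proof (rule ldiff_expansive[OF V(1) _ _ _ V(2), where c="1/2"])
    show "Cn_on 1 q V" using Cn_on_subset[OF q V(3)] by simp
    show "1/2 * norm (x - y) \<le> norm (q x - q y)" if "x \<in> V" "y \<in> V" for x y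
      using lip[OF that] norm_triangle_ineq3[of "q x - q y" "x - y"] by (simp add: algebra_simps abs_le_iff)
  qed simp
qed

lemma regular_space_shrink:
  assumes "regular_space X" "openin X U" "x \<in> U"
  obtains V where "openin X V" "x \<in> V" "X closure_of V \<subseteq> U"
proof -
  have "closedin X (topspace X - U)" "x \<in> topspace X - (topspace X - U)"
    using assms openin_subset by (auto intro: openin_closedin_eq[THEN iffD1, THEN conjunct2])
  then obtain V W where V: "openin X V" "openin X W" "x \<in> V" "topspace X - U \<subseteq> W" "disjnt V W"
    using assms(1) unfolding regular_space_def by meson
  have "X closure_of V \<subseteq> topspace X - W"
    by (rule closure_of_minimal) (use V openin_subset[OF V(1)] in \<open>auto simp: disjnt_def\<close>)
  then show ?thesis using that[OF V(1,3)] V(4) by blast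
qed

text \<open>\<open>C1\<close> states that the elements act by C^1 diffeomorphisms in terms of pulled
  back chart germs. Regular germs are locally invertible, so invertibility of the action maps to
  first order is included.\<close>

locale finite_C1_action = group_action G "topspace X" \<rho>
  for G (structure) and X :: "'a topology" and \<rho> :: "'g \<Rightarrow> 'a \<Rightarrow> 'a" +
  fixes \<A> :: "('a, real^'n) chart set"
  assumes fin: "finite (carrier G)"
    and atlas: "atlas X \<infinity> \<A>" "\<Union> (fst ` \<A>) = topspace X"
    and compact: "compact_space X" and Hausdorff: "Hausdorff_space X"
    and cont: "g \<in> carrier G \<Longrightarrow> continuous_map X X (\<rho> g)"
    and C1: "g \<in> carrier G \<Longrightarrow> x \<in> topspace X \<Longrightarrow> regular X 1 \<A> \<phi> (\<rho> g x) \<Longrightarrow> regular X 1 \<A> (\<lambda>y. \<phi> (\<rho> g y)) x"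
begin

sublocale group G
  using group_hom group_hom.axioms(1) by blast

lemma atlas1: "atlas X 1 \<A>"
  using atlas(1) by (rule atlas_mono) simp

lemma act_closed: "g \<in> carrier G \<Longrightarrow> x \<in> topspace X \<Longrightarrow> \<rho> g x \<in> topspace X"
  using element_image by blast

lemma act_mult: "g \<in> carrier G \<Longrightarrow> h \<in> carrier G \<Longrightarrow> x \<in> topspace X \<Longrightarrow> \<rho> (g \<otimes> h) x = \<rho> g (\<rho> h x)"
  using composition_rule by blast

lemma act_one: "x \<in> topspace X \<Longrightarrow> \<rho> \<one> x = x"
  using id_eq_one by (metis restrict_apply')

lemma act_inv: "g \<in> carrier G \<Longrightarrow> x \<in> topspace X \<Longrightarrow> \<rho> (inv g) (\<rho> g x) = x"
  "g \<in> carrier G \<Longrightarrow> x \<in> topspace X \<Longrightarrow> \<rho> g (\<rho> (inv g) x) = x"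
  by (metis act_mult act_one l_inv inv_closed, metis act_mult act_one r_inv inv_closed)

lemma in_image_iff:
  assumes "g \<in> carrier G" "U \<subseteq> topspace X"
  shows "x \<in> \<rho> g ` U \<longleftrightarrow> x \<in> topspace X \<and> \<rho> (inv g) x \<in> U"
proof
  assume "x \<in> \<rho> g ` U"
  then obtain y where "y \<in> U" "x = \<rho> g y" by blast
  then show "x \<in> topspace X \<and> \<rho> (inv g) x \<in> U" using assms act_closed act_inv(1) by (metis subsetD)
next
  assume "x \<in> topspace X \<and> \<rho> (inv g) x \<in> U"
  then show "x \<in> \<rho> g ` U" using act_inv(2)[OF assms(1)] by (metis image_eqI)
qed

lemma openin_image:
  assumes "g \<in> carrier G" "openin X U"
  shows "openin X (\<rho> g ` U)"
proof -
  have "\<rho> g ` U = {x \<in> topspace X. \<rho> (inv g) x \<in> U}"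
    using in_image_iff[OF assms(1) openin_subset[OF assms(2)]] by blast
  then show ?thesis using openin_continuous_map_preimage[OF cont assms(2)] assms(1) by simp
qed

lemma closedin_image:
  assumes "g \<in> carrier G" "closedin X U"
  shows "closedin X (\<rho> g ` U)"
proof -
  have "\<rho> g ` U = {x \<in> topspace X. \<rho> (inv g) x \<in> U}"
    using in_image_iff[OF assms(1) closedin_subset[OF assms(2)]] by blast
  then show ?thesis using closedin_continuous_map_preimage[OF cont assms(2)] assms(1) by simp
qed

section \<open>Linear representations, tubes and invariant atlases\<close>

definition subgrp :: "'g set \<Rightarrow> bool" where
  "subgrp F \<longleftrightarrow> F \<subseteq> carrier G \<and> \<one> \<in> F \<and> (\<forall>g\<in>F. inv g \<in> F) \<and> (\<forall>g\<in>F. \<forall>h\<in>F. g \<otimes> h \<in> F)"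

definition rep :: "'g set \<Rightarrow> ('g \<Rightarrow> real^'n \<Rightarrow> real^'n) \<Rightarrow> bool" where
  "rep F L \<longleftrightarrow> (\<forall>g\<in>F. linear (L g)) \<and> (\<forall>v. L \<one> v = v) \<and> (\<forall>g\<in>F. \<forall>h\<in>F. \<forall>v. L (g \<otimes> h) v = L g (L h v))"

lemma subgrpD:
  assumes "subgrp F"
  shows "finite F" "F \<noteq> {}" "\<And>g. g \<in> F \<Longrightarrow> g \<in> carrier G" "\<And>g. g \<in> F \<Longrightarrow> inv g \<in> F"
    "\<And>g h. g \<in> F \<Longrightarrow> h \<in> F \<Longrightarrow> g \<otimes> h \<in> F" "\<one> \<in> F"
  using assms fin unfolding subgrp_def by (auto intro: finite_subset)

lemma repD:
  assumes "subgrp F" "rep F L"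
  shows "\<And>g. g \<in> F \<Longrightarrow> linear (L g)" "\<And>g h v. g \<in> F \<Longrightarrow> h \<in> F \<Longrightarrow> L (g \<otimes> h) v = L g (L h v)"
    "\<And>g v. g \<in> F \<Longrightarrow> L (inv g) (L g v) = v" "\<And>g v. g \<in> F \<Longrightarrow> L g (L (inv g) v) = v"
proof -
  show "\<And>g. g \<in> F \<Longrightarrow> linear (L g)" "\<And>g h v. g \<in> F \<Longrightarrow> h \<in> F \<Longrightarrow> L (g \<otimes> h) v = L g (L h v)"
    using assms unfolding rep_def by blast+
  fix g v assume g: "g \<in> F"
  then show "L (inv g) (L g v) = v" "L g (L (inv g) v) = v"
    using assms subgrpD[OF assms(1)] unfolding rep_def by (metis l_inv r_inv)+
qed

text \<open>Reindexing by right translation, with \<open>inv g\<close> equal to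
  \<open>h \<otimes> inv (g \<otimes> h)\<close>. This gives the equivariance of both averages taken
  below, that of a perturbation and that of a chart.\<close>

lemma rep_sum_shift:
  assumes F: "subgrp F" "rep F L" and h: "h \<in> F"
  shows "(\<Sum>g\<in>F. L (inv g) (a (g \<otimes> h))) = L h (\<Sum>g\<in>F. L (inv g) (a g))"
proof -
  note F' = subgrpD[OF F(1)]
  have "(\<Sum>g\<in>F. L (inv g) (a (g \<otimes> h))) = (\<Sum>g\<in>F. L h (L (inv g) (a g)))"
  proof (rule sum.reindex_bij_witness[where i="\<lambda>g. g \<otimes> inv h" and j="\<lambda>g. g \<otimes> h"])
    fix g assume g: "g \<in> F"
    show "g \<otimes> h \<otimes> inv h = g" "g \<otimes> inv h \<otimes> h = g"
      using g h F'(3) by (simp_all add: m_assoc)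
    show "g \<otimes> h \<in> F" "g \<otimes> inv h \<in> F" using g h F' by auto
    have "h \<otimes> inv (g \<otimes> h) = inv g" using g h F'(3) by (simp add: inv_mult_group m_assoc[symmetric])
    then show "L h (L (inv (g \<otimes> h)) (a (g \<otimes> h))) = L (inv g) (a (g \<otimes> h))"
      using repD(2)[OF F, of h "inv (g \<otimes> h)"] g h F' by simp
  qed
  then show ?thesis unfolding linear_sum[OF repD(1)[OF F h]] .
qed

text \<open>A chart domain on which \<open>F\<close> acts linearly. The last clause makes translates
  of \<open>B\<close> by different cosets of \<open>F\<close> disjoint, so one coordinate map on
  \<open>B\<close> yields coordinates along the whole orbit of \<open>B\<close>.\<close>

definition tube :: "'g set \<Rightarrow> 'a set \<Rightarrow> ('a \<Rightarrow> real^'n) \<Rightarrow> ('g \<Rightarrow> real^'n \<Rightarrow> real^'n) \<Rightarrow> bool" where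
  "tube F B \<psi> L \<longleftrightarrow> subgrp F \<and> rep F L \<and> openin X B \<and> inj_on \<psi> B \<and> (\<forall>x\<in>B. regular X 1 \<A> \<psi> x) \<and>
     (\<forall>g\<in>F. \<forall>x\<in>B. \<rho> g x \<in> B \<and> \<psi> (\<rho> g x) = L g (\<psi> x)) \<and>
     (\<forall>g\<in>carrier G. \<forall>x\<in>B. \<rho> g x \<in> B \<longrightarrow> g \<in> F)"

text \<open>Covering is left out because the atlas grows tube by tube. Invariance is stated as
  pulling back only, since the inverse elements supply the other direction.\<close>

definition equivariant_atlas :: "('a, real^'n) chart set \<Rightarrow> bool" where
  "equivariant_atlas \<C> \<longleftrightarrow> atlas X \<infinity> \<C> \<and> (\<forall>\<phi> x. regular X \<infinity> \<C> \<phi> x \<longrightarrow> regular X 1 \<A> \<phi> x) \<and>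
     (\<forall>g\<in>carrier G. \<forall>x\<in>topspace X. \<forall>\<phi>. regular X \<infinity> \<C> \<phi> (\<rho> g x) \<longrightarrow> regular X \<infinity> \<C> (\<lambda>y. \<phi> (\<rho> g y)) x)"

text \<open>Invariance is checked on charts alone, as every regular germ differs from a chart by a
  local diffeomorphism.\<close>

lemma equivariant_atlasI:
  assumes C: "atlas X \<infinity> \<C>" "\<And>U \<phi> x. (U, \<phi>) \<in> \<C> \<Longrightarrow> x \<in> U \<Longrightarrow> regular X 1 \<A> \<phi> x"
    and inv: "\<And>g x U \<phi>. g \<in> carrier G \<Longrightarrow> x \<in> topspace X \<Longrightarrow> (U, \<phi>) \<in> \<C> \<Longrightarrow> \<rho> g x \<in> U \<Longrightarrow>
      regular X \<infinity> \<C> (\<lambda>y. \<phi> (\<rho> g y)) x"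
  shows "equivariant_atlas \<C>"
  unfolding equivariant_atlas_def
proof (intro conjI allI impI ballI)
  show "regular X 1 \<A> \<phi> x" if "regular X \<infinity> \<C> \<phi> x" for \<phi> x
    using regular_refine[OF C(2) that] .
  fix g x and \<psi> :: "'a \<Rightarrow> real^'n" assume gx: "g \<in> carrier G" "x \<in> topspace X" "regular X \<infinity> \<C> \<psi> (\<rho> g x)"
  then obtain U \<phi> where U: "(U, \<phi>) \<in> \<C>" "\<rho> g x \<in> U" "germ_related X \<infinity> \<phi> \<psi> (\<rho> g x)" by (meson regularE)
  then obtain T where T: "ldiff \<infinity> T (\<phi> (\<rho> g x))" "near X (\<rho> g x) (\<lambda>y. \<psi> y = T (\<phi> y))"
    unfolding germ_related_def by blast
  show "regular X \<infinity> \<C> (\<lambda>y. \<psi> (\<rho> g y)) x"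
    by (rule regular_comp[OF inv[OF gx(1,2) U(1,2)] T(1) near_continuous_map[OF cont[OF gx(1)] T(2) gx(2)]])
qed (fact C)

lemma equivariant_atlasD:
  assumes "equivariant_atlas \<C>"
  shows "atlas X \<infinity> \<C>" "\<And>\<phi> x. regular X \<infinity> \<C> \<phi> x \<Longrightarrow> regular X 1 \<A> \<phi> x"
    "\<And>g x \<phi>. g \<in> carrier G \<Longrightarrow> x \<in> topspace X \<Longrightarrow> regular X \<infinity> \<C> \<phi> (\<rho> g x) \<Longrightarrow> regular X \<infinity> \<C> (\<lambda>y. \<phi> (\<rho> g y)) x"
  using assms unfolding equivariant_atlas_def by blast+

text \<open>A regular germ exists only over the domain of the atlas, so pulling back a chart at
  \<open>\<rho> g x\<close> puts \<open>x\<close> into that domain.\<close>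

lemma equivariant_atlas_domain:
  assumes C: "equivariant_atlas \<C>" and g: "g \<in> carrier G" and x: "x \<in> topspace X" "\<rho> g x \<in> \<Union> (fst ` \<C>)"
  shows "x \<in> \<Union> (fst ` \<C>)"
proof -
  obtain U \<phi> where U: "(U, \<phi>) \<in> \<C>" "\<rho> g x \<in> U" using x(2) by auto
  then have "regular X \<infinity> \<C> (\<lambda>y. \<phi> (\<rho> g y)) x"
    by (intro equivariant_atlasD(3)[OF C g x(1)] regular_chart equivariant_atlasD(1)[OF C])
  then show ?thesis by (metis UN_I fst_conv regularE)
qed

lemma equivariant_atlas_subset: "equivariant_atlas \<C> \<Longrightarrow> (U, \<phi>) \<in> \<C> \<Longrightarrow> openin X U"
  using equivariant_atlasD(1) atlasD chart_onD(1) by blast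

subsection \<open>Adding a tube to an invariant smooth structure\<close>

text \<open>Relative smoothing supplies a \<open>\<theta>\<close> that makes the chart smooth on the
  compact \<open>K \<inter> E\<close>; averaging \<open>\<theta>\<close> over the linear action of
  \<open>F\<close> restores equivariance. Smoothness survives the averaging because
  \<open>K\<close>, \<open>E\<close> and \<open>\<C>\<close> are invariant under
  \<open>F\<close>.\<close>

lemma equivariant_smoothing:
  assumes C: "equivariant_atlas \<C>" and K: "closedin X K" "\<And>g x. g \<in> carrier G \<Longrightarrow> x \<in> K \<Longrightarrow> \<rho> g x \<in> K" "K \<subseteq> \<Union> (fst ` \<C>)"
    and tube: "tube F B \<psi> L" and E: "closedin X E" "E \<subseteq> B" "\<And>g x. g \<in> F \<Longrightarrow> x \<in> E \<Longrightarrow> \<rho> g x \<in> E"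
  obtains \<psi>' where "tube F B \<psi>' L" "\<And>x. x \<in> K \<Longrightarrow> x \<in> E \<Longrightarrow> regular X \<infinity> \<C> \<psi>' x"
proof -
  note C' = equivariant_atlasD[OF C]
  have t: "subgrp F" "rep F L" "openin X B" "inj_on \<psi> B" "\<And>x. x \<in> B \<Longrightarrow> regular X 1 \<A> \<psi> x"
    "\<And>g x. g \<in> F \<Longrightarrow> x \<in> B \<Longrightarrow> \<rho> g x \<in> B" "\<And>g x. g \<in> F \<Longrightarrow> x \<in> B \<Longrightarrow> \<psi> (\<rho> g x) = L g (\<psi> x)"
    "\<And>g x. g \<in> carrier G \<Longrightarrow> x \<in> B \<Longrightarrow> \<rho> g x \<in> B \<Longrightarrow> g \<in> F"
    using tube unfolding tube_def by blast+
  note F = subgrpD[OF t(1)] and L = repD[OF t(1,2)]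
  have BX: "B \<subseteq> topspace X" using t(3) openin_subset by blast
  \<comment> \<open>The region allowed for the perturbation. It is invariant under \<open>F\<close>,
    so the averaged perturbation is still supported in its image.\<close>
  define V where "V = B \<inter> \<Union> (fst ` \<C>)"
  have "openin X (\<Union> (fst ` \<C>))" using equivariant_atlas_subset[OF C] by (intro openin_Union) auto
  then have V: "openin X V" "V \<subseteq> B" "V \<subseteq> \<Union> (fst ` \<C>)" using t(3) by (auto simp: V_def)
  have Vinv: "\<rho> g x \<in> V" if "g \<in> F" "x \<in> V" for g x
  proof -
    have x: "x \<in> topspace X" "g \<in> carrier G" using that V BX F(3) by auto
    have "\<rho> (inv g) (\<rho> g x) \<in> \<Union> (fst ` \<C>)" using act_inv(1)[OF x(2,1)] that V by auto
    then have "\<rho> g x \<in> \<Union> (fst ` \<C>)"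
      by (rule equivariant_atlas_domain[OF C inv_closed[OF x(2)] act_closed[OF x(2,1)]])
    then show ?thesis using that t(6) by (simp add: V_def)
  qed
  have "compactin X (K \<inter> E)"
    using closedin_compact_space[OF compact] K(1) E(1) by (simp add: closedin_Int)
  moreover have "K \<inter> E \<subseteq> V" using K(3) E(2) by (auto simp: V_def)
  moreover obtain M where M: "1 \<le> M" "\<And>g v. g \<in> F \<Longrightarrow> norm (L g v) \<le> M * norm v"
  proof -
    have "\<exists>B. \<forall>v. norm (L g v) \<le> B * norm v" if "g \<in> F" for g
      using linear_bounded[OF L(1)[OF that]] .
    then obtain m where m: "\<And>g v. g \<in> F \<Longrightarrow> norm (L g v) \<le> m g * norm v" by metis
    define M where "M = Max (insert 1 (m ` F))"
    have "m g \<le> M" if "g \<in> F" for g using that F(1) by (auto simp: M_def intro: Max_ge)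
    then have "norm (L g v) \<le> M * norm v" if "g \<in> F" for g v
      using m[OF that, of v] that by (meson mult_right_mono norm_ge_zero order_trans)
    moreover have "1 \<le> M" using F(1) by (auto simp: M_def intro: Max_ge)
    ultimately show ?thesis using that by blast
  qed
  \<comment> \<open>Averaging costs the factor \<open>M * M\<close>, and 1/2 is the size up to which
    a perturbation is known to be bijective.\<close>
  moreover have "0 < 1 / (2 * M * M)" using M(1) by simp
  ultimately obtain \<theta> where \<theta>: "tame (1 / (2 * M * M)) (\<psi> ` V) \<theta>"
    "\<And>y. y \<in> K \<inter> E \<Longrightarrow> regular X \<infinity> \<C> (\<lambda>y. \<theta> (\<psi> y)) y"
    using relative_smoothing[OF C'(1) atlas1 C'(2) t(3-5) V] by metis
  define \<theta>' where "\<theta>' v = (\<Sum>g\<in>F. L (inv g) (\<theta> (L g v))) /\<^sub>R card F" for v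
  have "tame (M * M * (1 / (2 * M * M))) (\<psi> ` V) \<theta>'"
    unfolding \<theta>'_def
  proof (rule tame_average[OF \<theta>(1) F(1,2)])
    show "L (inv g) v \<in> \<psi> ` V" if "g \<in> F" "v \<in> \<psi> ` V" for g v
    proof -
      from that(2) obtain x where "x \<in> V" "v = \<psi> x" by blast
      then have "L (inv g) v = \<psi> (\<rho> (inv g) x)" using t(7) F(4) that(1) V(2) by (metis subsetD)
      then show ?thesis using Vinv F(4) that(1) \<open>x \<in> V\<close> by blast
    qed
  qed (use L M F in auto)
  moreover have "M * M * (1 / (2 * M * M)) = 1/2" using M(1) by simp
  ultimately have tame': "tame (1/2) (\<psi> ` V) \<theta>'" by (simp only:)
  have equi: "\<theta>' (L h v) = L h (\<theta>' v)" if h: "h \<in> F" for h v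
  proof -
    have "(\<Sum>g\<in>F. L (inv g) (\<theta> (L g (L h v)))) = (\<Sum>g\<in>F. L (inv g) ((\<lambda>g. \<theta> (L g v)) (g \<otimes> h)))"
      using L(2) h by (intro sum.cong) auto
    also have "\<dots> = L h (\<Sum>g\<in>F. L (inv g) (\<theta> (L g v)))" by (rule rep_sum_shift[OF t(1,2) h])
    finally show ?thesis by (simp add: \<theta>'_def linear_scale[OF L(1)[OF h]])
  qed
  define \<psi>' where "\<psi>' x = \<theta>' (\<psi> x)" for x
  have reg1: "regular X 1 \<A> \<psi>' x" if "x \<in> B" for x
    unfolding \<psi>'_def[abs_def] using regular_tame[OF atlas1 t(5)[OF that] tame'] by simp
  have inj': "inj_on \<psi>' B"
  proof (rule inj_onI)
    fix x y assume xy: "x \<in> B" "y \<in> B" "\<psi>' x = \<psi>' y"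
    then have "\<psi> x = \<psi> y" using injD[OF bij_is_inj[OF tame_bij(1)[OF tame']]] by (simp add: \<psi>'_def)
    then show "x = y" using inj_onD[OF t(4)] xy by blast
  qed
  have "tube F B \<psi>' L"
    unfolding tube_def using t reg1 inj' equi by (simp add: \<psi>'_def)
  moreover have "regular X \<infinity> \<C> \<psi>' x" if x: "x \<in> K" "x \<in> E" for x
  proof -
    have xX: "x \<in> topspace X" using x closedin_subset[OF K(1)] by blast
    have xB: "x \<in> B" using x E by blast
    obtain U \<phi> where U: "(U, \<phi>) \<in> \<C>" "x \<in> U" using x(1) K(3) by fastforce
    have ch: "chart_on X (U, \<phi>)" using atlasD[OF C'(1) U(1)] .
    have reg\<phi>: "regular X \<infinity> \<C> \<phi> x" using regular_chart[OF U C'(1)] .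
    \<comment> \<open>Smoothness of the perturbed chart at the orbit point
      \<open>\<rho> g x\<close>, pulled back along \<open>g\<close> by the invariance of
      \<open>\<C>\<close>, makes each summand of \<open>\<psi>'\<close> smooth in the coordinate
      \<open>\<phi>\<close>.\<close>
    have "\<exists>T. ldiff \<infinity> T (\<phi> x) \<and> near X x (\<lambda>y. \<theta> (\<psi> (\<rho> g y)) = T (\<phi> y))" if g: "g \<in> F" for g
    proof -
      have "\<rho> g x \<in> K \<inter> E" using K(2) E(3) F(3) g x by blast
      from C'(3)[OF F(3)[OF g] xX \<theta>(2)[OF this]]
      have "germ_related X \<infinity> \<phi> (\<lambda>y. \<theta> (\<psi> (\<rho> g y))) x" using regular_related[OF C'(1) reg\<phi>] by blast
      then show ?thesis unfolding germ_related_def by blast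
    qed
    then obtain T where T: "\<And>g. g \<in> F \<Longrightarrow> ldiff \<infinity> (T g) (\<phi> x)"
      "\<And>g. g \<in> F \<Longrightarrow> near X x (\<lambda>y. \<theta> (\<psi> (\<rho> g y)) = T g (\<phi> y))" by metis
    then obtain W where W: "\<And>g. g \<in> F \<Longrightarrow> open (W g) \<and> \<phi> x \<in> W g \<and> Cr_on \<infinity> (T g) (W g)"
      unfolding ldiff_def ldiff_on_def by metis
    define W' where "W' = (\<Inter>g\<in>F. W g)"
    have W': "open W'" "\<phi> x \<in> W'" using W F(1) by (auto simp: W'_def)
    \<comment> \<open>A sum of diffeomorphism germs need not be one. Invertibility comes from
      \<open>reg1\<close>, at the C^1 level, and the smooth formula then upgrades it.\<close>
    show ?thesis
    proof (rule regular_upgrade[where T="\<lambda>z. (\<Sum>g\<in>F. L (inv g) (T g z)) /\<^sub>R card F", OF reg\<phi> _ _ ch U(2) _ W'])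
      show "germ_related X 1 \<phi> \<psi>' x" by (rule regular_related[OF atlas1 C'(2)[OF reg\<phi>] reg1[OF xB]])
      have "near X x (\<lambda>y. y \<in> B)" using t(3) xB by (intro nearI) auto
      then show "near X x (\<lambda>y. \<psi>' y = (\<Sum>g\<in>F. L (inv g) (T g (\<phi> y))) /\<^sub>R card F)"
        using near_Ball_finite[OF F(1) T(2) xX]
      proof (rule near_conj_mono)
        fix y assume y: "y \<in> B" "\<forall>g\<in>F. \<theta> (\<psi> (\<rho> g y)) = T g (\<phi> y)"
        then have "\<theta> (L g (\<psi> y)) = T g (\<phi> y)" if "g \<in> F" for g using t(7) that by metis
        then show "\<psi>' y = (\<Sum>g\<in>F. L (inv g) (T g (\<phi> y))) /\<^sub>R card F"
          by (simp add: \<psi>'_def \<theta>'_def)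
      qed
      have "Cr_on \<infinity> (\<lambda>z. L (inv g) (T g z)) W'" if "g \<in> F" for g
      proof (rule Cr_on_compose[where g="L (inv g)" and f="T g", OF W'(1) open_UNIV _ _ subset_UNIV])
        show "Cr_on \<infinity> (T g) W'" using W[OF that] Cr_on_subset that by (metis INT_lower W'_def)
        show "Cr_on \<infinity> (L (inv g)) UNIV"
          using L(1) F(4) that by (auto intro!: Cr_on_bounded_linear simp: linear_conv_bounded_linear)
      qed
      then show "Cr_on \<infinity> (\<lambda>z. (\<Sum>g\<in>F. L (inv g) (T g z)) /\<^sub>R card F) W'"
        by (intro Cr_on_scaleR Cr_on_const Cr_on_sum W'(1))
    qed simp
  qed
  ultimately show ?thesis using that by blast
qed

text \<open>After smoothing on \<open>K \<inter> E\<close>, the tube chart may still clash with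
  \<open>\<C>\<close> on the rest of the closure of \<open>D\<close>. The saturation
  \<open>Q\<close> of this bad set is closed, invariant and misses \<open>K\<close>; deleting it
  from the old charts makes room for all translates of the tube.\<close>

lemma add_tube:
  assumes C: "equivariant_atlas \<C>" and K: "closedin X K" "\<And>g x. g \<in> carrier G \<Longrightarrow> x \<in> K \<Longrightarrow> \<rho> g x \<in> K" "K \<subseteq> \<Union> (fst ` \<C>)"
    and tube: "tube F B \<psi> L"
    and D: "openin X D" "X closure_of D \<subseteq> B" "\<And>g x. g \<in> F \<Longrightarrow> x \<in> D \<Longrightarrow> \<rho> g x \<in> D"
  obtains \<C>' where "equivariant_atlas \<C>'" "K \<subseteq> \<Union> (fst ` \<C>')" "\<And>g. g \<in> carrier G \<Longrightarrow> \<rho> g ` D \<subseteq> \<Union> (fst ` \<C>')"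
proof -
  note C' = equivariant_atlasD[OF C]
  define E where "E = X closure_of D"
  have t0: "subgrp F" using tube unfolding tube_def by blast
  note F = subgrpD[OF t0]
  have E: "closedin X E" "E \<subseteq> B" "D \<subseteq> E"
    using D closure_of_subset[OF openin_subset[OF D(1)]] by (auto simp: E_def)
  have Einv: "\<rho> g x \<in> E" if "g \<in> F" "x \<in> E" for g x
  proof -
    have "\<rho> g ` (X closure_of D) \<subseteq> X closure_of (\<rho> g ` D)"
      by (rule continuous_map_image_closure_subset[OF cont[OF F(3)[OF that(1)]]])
    also have "\<dots> \<subseteq> X closure_of D" using D(3) that(1) by (intro closure_of_mono) blast
    finally show ?thesis using that(2) by (auto simp: E_def)
  qed
  obtain \<psi>' where \<psi>': "tube F B \<psi>' L" "\<And>x. x \<in> K \<Longrightarrow> x \<in> E \<Longrightarrow> regular X \<infinity> \<C> \<psi>' x"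
    using equivariant_smoothing[OF C K tube E(1,2) Einv] by blast
  have t: "rep F L" "openin X B" "inj_on \<psi>' B" "\<And>x. x \<in> B \<Longrightarrow> regular X 1 \<A> \<psi>' x"
    "\<And>g x. g \<in> F \<Longrightarrow> x \<in> B \<Longrightarrow> \<rho> g x \<in> B" "\<And>g x. g \<in> F \<Longrightarrow> x \<in> B \<Longrightarrow> \<psi>' (\<rho> g x) = L g (\<psi>' x)"
    "\<And>g x. g \<in> carrier G \<Longrightarrow> x \<in> B \<Longrightarrow> \<rho> g x \<in> B \<Longrightarrow> g \<in> F"
    using \<psi>'(1) unfolding tube_def by blast+
  note L = repD[OF t0 t(1)]
  have ldL: "ldiff r (L g) v" if "g \<in> F" for r g v
    using ldiff_linear[OF L(1)[OF that] L(1)[OF F(4)[OF that]] L(3,4)[OF that]] .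
  have BX: "B \<subseteq> topspace X" "D \<subseteq> topspace X" "E \<subseteq> topspace X" using t(2) D(1) E openin_subset by blast+
  define N where "N = {x \<in> B. regular X \<infinity> \<C> \<psi>' x}"
  have Nopen: "openin X N"
  proof (subst openin_subopen, intro ballI)
    fix x assume x: "x \<in> N"
    then have "near X x (regular X \<infinity> \<C> \<psi>')" using regular_near[OF C'(1)] by (simp add: N_def)
    then obtain U where "openin X U" "x \<in> U" "\<forall>y\<in>U. regular X \<infinity> \<C> \<psi>' y" unfolding near_def by blast
    then show "\<exists>T. openin X T \<and> x \<in> T \<and> T \<subseteq> N"
      using x t(2) by (intro exI[of _ "U \<inter> B"]) (auto simp: N_def)
  qed
  \<comment> \<open>The closure \<open>E\<close> is used instead of \<open>D\<close>, so that
    \<open>Q\<close> is a finite union of closed sets.\<close>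
  define Q where "Q = (\<Union>g\<in>carrier G. \<rho> g ` (E - N))"
  have "closedin X Q"
    unfolding Q_def
  proof (rule closedin_Union)
    show "finite ((\<lambda>g. \<rho> g ` (E - N)) ` carrier G)" using fin by simp
    show "closedin X T" if "T \<in> (\<lambda>g. \<rho> g ` (E - N)) ` carrier G" for T
      using that closedin_image closedin_diff[OF E(1) Nopen] by auto
  qed
  then have Qopen: "openin X (topspace X - Q)" by (rule openin_diff[OF openin_topspace])
  have Qinv: "\<rho> g x \<notin> Q" if "g \<in> carrier G" "x \<in> topspace X" "x \<notin> Q" for g x
  proof
    assume "\<rho> g x \<in> Q"
    then obtain h y where h: "h \<in> carrier G" "y \<in> E - N" "\<rho> g x = \<rho> h y" by (auto simp: Q_def)
    have yX: "y \<in> topspace X" using h BX by blast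
    have "x = \<rho> (inv g) (\<rho> h y)" using act_inv(1)[OF that(1,2)] h(3) by simp
    also have "\<dots> = \<rho> (inv g \<otimes> h) y" using act_mult[OF inv_closed[OF that(1)] h(1) yX] by simp
    finally have "x \<in> Q" using h that(1) by (auto simp: Q_def)
    then show False using that(3) by blast
  qed
  \<comment> \<open>By invariance of \<open>K\<close>, a common point would come from a point of
    \<open>K \<inter> E\<close> at which \<open>\<psi>'\<close> fails to be smooth for
    \<open>\<C>\<close>.\<close>
  have KQ: "K \<inter> Q = {}"
  proof (rule ccontr)
    assume "K \<inter> Q \<noteq> {}"
    then obtain h y where h: "h \<in> carrier G" "y \<in> E - N" "\<rho> h y \<in> K" by (auto simp: Q_def)
    have "\<rho> (inv h) (\<rho> h y) \<in> K" using K(2)[OF inv_closed[OF h(1)] h(3)] .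
    then have "y \<in> K" using act_inv(1)[OF h(1)] h BX by auto
    then show False using h(2) \<psi>'(2) E(2) by (auto simp: N_def)
  qed
  define \<C>1 where "\<C>1 = {(U \<inter> (topspace X - Q), \<phi>) | U \<phi>. (U, \<phi>) \<in> \<C>}"
  define \<C>2 where "\<C>2 = {(\<rho> g ` D, \<lambda>x. \<psi>' (\<rho> (inv g) x)) | g. g \<in> carrier G}"
  have inD: "x \<in> topspace X" "\<rho> (inv g) x \<in> D" if "g \<in> carrier G" "x \<in> \<rho> g ` D" for g x
    using that in_image_iff[OF that(1) BX(2)] by auto
  have reg2: "regular X 1 \<A> (\<lambda>x. \<psi>' (\<rho> (inv g) x)) x" if "g \<in> carrier G" "x \<in> \<rho> g ` D" for g x
    using C1[OF inv_closed[OF that(1)] inD(1)[OF that] t(4)] inD(2)[OF that] E by blast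
  have chart2: "chart_on X (\<rho> g ` D, \<lambda>x. \<psi>' (\<rho> (inv g) x))" if g: "g \<in> carrier G" for g
  proof (rule regular_chart_on[OF atlas1 openin_image[OF g D(1)] _ reg2[OF g]])
    show "inj_on (\<lambda>x. \<psi>' (\<rho> (inv g) x)) (\<rho> g ` D)"
    proof (rule inj_onI)
      fix x y assume xy: "x \<in> \<rho> g ` D" "y \<in> \<rho> g ` D" "\<psi>' (\<rho> (inv g) x) = \<psi>' (\<rho> (inv g) y)"
      then have "\<rho> (inv g) x = \<rho> (inv g) y" using inj_onD[OF t(3) xy(3)] inD[OF g] E by blast
      then show "x = y" using act_inv(2)[OF g] inD(1)[OF g] xy by metis
    qed
  qed
  \<comment> \<open>Off \<open>Q\<close>, the point \<open>\<rho> (inv g) x\<close> lies in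
    \<open>N\<close>, and invariance of \<open>\<C>\<close> moves smoothness from there to
    \<open>x\<close>.\<close>
  have rel12: "regular X \<infinity> \<C> (\<lambda>x. \<psi>' (\<rho> (inv g) x)) x" if g: "g \<in> carrier G" and x: "x \<in> \<rho> g ` D" "x \<notin> Q" for g x
  proof -
    have "\<rho> (inv g) x \<in> N"
    proof (rule ccontr)
      assume "\<rho> (inv g) x \<notin> N"
      then have "\<rho> g (\<rho> (inv g) x) \<in> Q" using inD(2)[OF g x(1)] E g by (auto simp: Q_def)
      then show False using act_inv(2)[OF g inD(1)[OF g x(1)]] x(2) by simp
    qed
    then show ?thesis using C'(3)[OF inv_closed[OF g] inD(1)[OF g x(1)]] by (simp add: N_def)
  qed
  \<comment> \<open>Overlapping translates differ by an element of \<open>F\<close>, by the last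
    clause of \<open>tube\<close>, so their transition map is linear.\<close>
  have rel22: "germ_related X \<infinity> (\<lambda>x. \<psi>' (\<rho> (inv g) x)) (\<lambda>x. \<psi>' (\<rho> (inv h) x)) x"
    if g: "g \<in> carrier G" and h: "h \<in> carrier G" and x: "x \<in> \<rho> g ` D" "x \<in> \<rho> h ` D" for g h x
  proof (rule germ_relatedI)
    have eq: "\<rho> (inv h) y = \<rho> (inv h \<otimes> g) (\<rho> (inv g) y)" if "y \<in> topspace X" for y
      using act_mult[OF inv_closed[OF h] g act_closed[OF inv_closed[OF g] that]] act_inv(2)[OF g that] by simp
    have i: "inv h \<otimes> g \<in> F"
    proof (rule t(7))
      show "\<rho> (inv g) x \<in> B" using inD(2)[OF g x(1)] E by blast
      show "\<rho> (inv h \<otimes> g) (\<rho> (inv g) x) \<in> B" using eq[OF inD(1)[OF g x(1)]] inD(2)[OF h x(2)] E by auto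
    qed (use g h in simp)
    show "ldiff \<infinity> (L (inv h \<otimes> g)) (\<psi>' (\<rho> (inv g) x))" by (rule ldL[OF i])
    show "near X x (\<lambda>y. \<psi>' (\<rho> (inv h) y) = L (inv h \<otimes> g) (\<psi>' (\<rho> (inv g) y)))"
    proof (rule nearI[OF openin_image[OF g D(1)] x(1)])
      fix y assume y: "y \<in> \<rho> g ` D"
      show "\<psi>' (\<rho> (inv h) y) = L (inv h \<otimes> g) (\<psi>' (\<rho> (inv g) y))"
        using eq[OF inD(1)[OF g y]] t(6)[OF i] inD(2)[OF g y] E by auto
    qed
  qed
  have atl: "atlas X \<infinity> (\<C>1 \<union> \<C>2)"
    unfolding atlas_def
  proof (intro conjI ballI)
    fix c assume "c \<in> \<C>1 \<union> \<C>2"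
    then show "chart_on X c"
    proof
      assume "c \<in> \<C>1"
      then obtain U \<phi> where U: "(U, \<phi>) \<in> \<C>" "c = (U \<inter> (topspace X - Q), \<phi>)" by (auto simp: \<C>1_def)
      have ch: "chart_on X (U, \<phi>)" using atlasD[OF C'(1) U(1)] .
      show ?thesis
        unfolding U(2) by (rule chart_on_subset[OF ch openin_Int[OF chart_onD(1)[OF ch] Qopen] Int_lower1])
    qed (use chart2 in \<open>auto simp: \<C>2_def\<close>)
  next
    have rel: "germ_related X \<infinity> \<phi> \<psi> x"
      if cd: "c \<in> \<C>1 \<union> \<C>2" "d \<in> \<C>1 \<union> \<C>2" and c: "c = (U, \<phi>)" "d = (W, \<psi>)" and x: "x \<in> U" "x \<in> W"
      for c d U \<phi> W \<psi> x
    proof (cases "c \<in> \<C>1 \<or> d \<in> \<C>1")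
      case True
      have Q: "x \<notin> Q" using True c x by (auto simp: \<C>1_def)
      have "regular X \<infinity> \<C> \<xi> x" if "(Y, \<xi>) \<in> \<C>1 \<union> \<C>2" "x \<in> Y" for Y \<xi>
        using that rel12[OF _ _ Q] regular_chart[OF _ _ C'(1), of _ _ x] by (auto simp: \<C>1_def \<C>2_def)
      then show ?thesis using regular_related[OF C'(1)] cd c x by metis
    next
      case False
      then obtain g h where "g \<in> carrier G" "c = (\<rho> g ` D, \<lambda>x. \<psi>' (\<rho> (inv g) x))"
        "h \<in> carrier G" "d = (\<rho> h ` D, \<lambda>x. \<psi>' (\<rho> (inv h) x))" using cd by (auto simp: \<C>2_def)
      then show ?thesis using rel22 c x by auto
    qed
    fix c assume "c \<in> \<C>1 \<union> \<C>2"
    then show "case c of (U, \<phi>) \<Rightarrow> \<forall>(V, \<psi>)\<in>\<C>1 \<union> \<C>2. \<forall>x\<in>U \<inter> V. germ_related X \<infinity> \<phi> \<psi> x"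
      using rel[OF _ _ refl refl] by (cases c) blast
  qed
  have reg\<C>1: "regular X \<infinity> (\<C>1 \<union> \<C>2) \<phi> x" if x: "regular X \<infinity> \<C> \<phi> x" "x \<notin> Q" for \<phi> x
  proof -
    obtain U \<xi> where U: "(U, \<xi>) \<in> \<C>" "x \<in> U" "germ_related X \<infinity> \<xi> \<phi> x" using regularE[OF x(1)] .
    have "x \<in> topspace X" using regular_topspace[OF C'(1) x(1)] .
    then show ?thesis using U x(2)
      by (intro regularI[of "U \<inter> (topspace X - Q)" \<xi>]) (auto simp: \<C>1_def)
  qed
  have eq: "equivariant_atlas (\<C>1 \<union> \<C>2)"
  proof (rule equivariant_atlasI[OF atl])
    show "regular X 1 \<A> \<phi> x" if "(U, \<phi>) \<in> \<C>1 \<union> \<C>2" "x \<in> U" for U \<phi> x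
      using that reg2 C'(2)[OF regular_chart[OF _ _ C'(1)]] by (auto simp: \<C>1_def \<C>2_def)
    fix g x U \<phi> assume g: "g \<in> carrier G" and x: "x \<in> topspace X" and U: "(U, \<phi>) \<in> \<C>1 \<union> \<C>2" "\<rho> g x \<in> U"
    show "regular X \<infinity> (\<C>1 \<union> \<C>2) (\<lambda>y. \<phi> (\<rho> g y)) x"
    proof (cases "(U, \<phi>) \<in> \<C>1")
      case True
      then obtain W where W: "(W, \<phi>) \<in> \<C>" "\<rho> g x \<in> W" "\<rho> g x \<notin> Q" using U by (auto simp: \<C>1_def)
      have "x \<notin> Q" using Qinv[OF inv_closed[OF g] act_closed[OF g x] W(3)] act_inv(1)[OF g x] by simp
      moreover have "regular X \<infinity> \<C> (\<lambda>y. \<phi> (\<rho> g y)) x"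
        by (rule C'(3)[OF g x regular_chart[OF W(1,2) C'(1)]])
      ultimately show ?thesis using reg\<C>1 by blast
    next
      case False
      then obtain h where h: "h \<in> carrier G" "U = \<rho> h ` D" "\<phi> = (\<lambda>x. \<psi>' (\<rho> (inv h) x))" using U by (auto simp: \<C>2_def)
      let ?k = "inv g \<otimes> h"
      have k: "?k \<in> carrier G" "inv ?k = inv h \<otimes> g" using g h(1) by (simp_all add: inv_mult_group)
      have eq: "\<rho> (inv h) (\<rho> g y) = \<rho> (inv ?k) y" if "y \<in> topspace X" for y
        unfolding k(2) using act_mult[OF inv_closed[OF h(1)] g that] by simp
      have "\<rho> (inv ?k) x \<in> D" using inD(2)[OF h(1), of "\<rho> g x"] U(2) h(2) eq[OF x] by simp
      then have xk: "x \<in> \<rho> ?k ` D" using in_image_iff[OF k(1) BX(2)] x by blast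
      have "(\<rho> ?k ` D, \<lambda>x. \<psi>' (\<rho> (inv ?k) x)) \<in> \<C>1 \<union> \<C>2" using k(1) unfolding \<C>2_def by blast
      from regular_chart[OF this xk atl] show ?thesis
        by (rule regular_cong) (use eq h(3) x in \<open>auto intro: nearI[of X "topspace X"]\<close>)
    qed
  qed
  show ?thesis
  proof (rule that[OF eq])
    show "K \<subseteq> \<Union> (fst ` (\<C>1 \<union> \<C>2))"
    proof
      fix x assume x: "x \<in> K"
      then obtain U \<phi> where "(U, \<phi>) \<in> \<C>" "x \<in> U" using K(3) by fastforce
      moreover have "x \<in> topspace X - Q" using x KQ closedin_subset[OF K(1)] by blast
      ultimately have "(U \<inter> (topspace X - Q), \<phi>) \<in> \<C>1" "x \<in> U \<inter> (topspace X - Q)" by (auto simp: \<C>1_def)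
      then show "x \<in> \<Union> (fst ` (\<C>1 \<union> \<C>2))" by force
    qed
    show "\<rho> g ` D \<subseteq> \<Union> (fst ` (\<C>1 \<union> \<C>2))" if "g \<in> carrier G" for g
      using that by (force simp: \<C>2_def)
  qed
qed

subsection \<open>Existence of tubes\<close>

lemma stabilizer_subgrp:
  assumes "p \<in> topspace X"
  shows "subgrp {g \<in> carrier G. \<rho> g p = p}"
  unfolding subgrp_def
proof (intro conjI ballI)
  show "inv g \<in> {g \<in> carrier G. \<rho> g p = p}" if "g \<in> {g \<in> carrier G. \<rho> g p = p}" for g
    using that act_inv(1)[of g p] assms by simp
qed (use assms act_one act_mult in auto)

lemma invariant_core:
  assumes F: "subgrp F" and U: "openin X U"
  defines "V \<equiv> {x \<in> topspace X. \<forall>g\<in>F. \<rho> g x \<in> U}"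
  shows "openin X V" "V \<subseteq> U" "\<And>g x. g \<in> F \<Longrightarrow> x \<in> V \<Longrightarrow> \<rho> g x \<in> V"
proof -
  note F' = subgrpD[OF F]
  have "V = (\<Inter>g\<in>F. {x \<in> topspace X. \<rho> g x \<in> U})" using F'(2) by (auto simp: V_def)
  then show "openin X V"
    using F' openin_continuous_map_preimage[OF cont U] by (auto intro!: openin_INT)
  show "V \<subseteq> U"
  proof
    fix x assume "x \<in> V"
    then have "x \<in> topspace X" "\<rho> \<one> x \<in> U" using F'(6) by (auto simp: V_def)
    then show "x \<in> U" using act_one by simp
  qed
  show "\<rho> g x \<in> V" if "g \<in> F" "x \<in> V" for g x
  proof -
    have x: "x \<in> topspace X" "\<And>h. h \<in> F \<Longrightarrow> \<rho> h x \<in> U" using that(2) by (auto simp: V_def)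
    have "\<rho> h (\<rho> g x) \<in> U" if h: "h \<in> F" for h
      using act_mult[OF F'(3)[OF h] F'(3)[OF \<open>g \<in> F\<close>] x(1)] x(2)[OF F'(5)[OF h \<open>g \<in> F\<close>]] by simp
    then show ?thesis using act_closed[OF F'(3)[OF that(1)] x(1)] by (simp add: V_def)
  qed
qed

text \<open>Bochner linearization: \<open>L g\<close> is the derivative at \<open>\<phi> p\<close>
  of \<open>g\<close> read in the chart, a representation by the chain rule at a fixed point. The
  average of L(g^-1) (\<phi>(g x) - \<phi>(p)) intertwines the action with it.\<close>

lemma equivariant_chart_germ:
  assumes p: "p \<in> topspace X" and F_def: "F = {g \<in> carrier G. \<rho> g p = p}"
  obtains \<psi> L where "rep F L" "regular X 1 \<A> \<psi> p"
    "\<And>g x. g \<in> F \<Longrightarrow> x \<in> topspace X \<Longrightarrow> \<psi> (\<rho> g x) = L g (\<psi> x)"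
proof -
  have sF: "subgrp F" unfolding F_def by (rule stabilizer_subgrp[OF p])
  note F = subgrpD[OF sF]
  have fixp: "\<rho> g p = p" if "g \<in> F" for g using that by (simp add: F_def)
  obtain U \<phi> where U: "(U, \<phi>) \<in> \<A>" "p \<in> U" using p atlas(2) by fastforce
  have ch: "chart_on X (U, \<phi>)" using atlasD[OF atlas1 U(1)] .
  have reg: "regular X 1 \<A> \<phi> p" using regular_chart[OF U atlas1] .
  let ?c = "\<phi> p"
  have "\<exists>T. ldiff 1 T ?c \<and> near X p (\<lambda>y. \<phi> (\<rho> g y) = T (\<phi> y))" if g: "g \<in> F" for g
  proof -
    have "regular X 1 \<A> (\<lambda>y. \<phi> (\<rho> g y)) p" using C1[OF F(3)[OF g] p] reg fixp[OF g] by simp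
    from regular_related[OF atlas1 reg this] show ?thesis unfolding germ_related_def by blast
  qed
  then obtain T where T: "\<And>g. g \<in> F \<Longrightarrow> ldiff 1 (T g) ?c"
    "\<And>g. g \<in> F \<Longrightarrow> near X p (\<lambda>y. \<phi> (\<rho> g y) = T g (\<phi> y))" by metis
  have Tc: "T g ?c = ?c" if "g \<in> F" for g using near_at[OF T(2)[OF that]] fixp[OF that] by simp
  have "\<exists>W. open W \<and> ?c \<in> W \<and> Cn_on (Suc 0) (T g) W" if "g \<in> F" for g
    using T(1)[OF that] unfolding ldiff_def ldiff_on_def Cr_on_1 by (metis One_nat_def)
  then obtain W where W: "\<And>g. g \<in> F \<Longrightarrow> open (W g)" "\<And>g. g \<in> F \<Longrightarrow> ?c \<in> W g"
    "\<And>g. g \<in> F \<Longrightarrow> Cn_on (Suc 0) (T g) (W g)" by metis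
  define L where "L g = frechet_derivative (T g) (at ?c)" for g
  have L: "(T g has_derivative L g) (at ?c)" if "g \<in> F" for g
    unfolding L_def using Cn_onD[OF W(3) W(2)] that by blast
  have germ: "\<exists>V. open V \<and> ?c \<in> V \<and> (\<forall>z\<in>V. A z = B z)" if nr: "near X p (\<lambda>y. A (\<phi> y) = B (\<phi> y))" for A B :: "real^'n \<Rightarrow> real^'n"
  proof -
    obtain M where "openin X M" "M \<subseteq> U" "p \<in> M" "open (\<phi> ` M)" "\<And>y. y \<in> M \<Longrightarrow> A (\<phi> y) = B (\<phi> y)"
      using chart_near_open[OF ch U(2) nr] by blast
    then show ?thesis by (intro exI[of _ "\<phi> ` M"]) auto
  qed
  have L1: "L \<one> = (\<lambda>v. v)"
  proof -
    have "near X p (\<lambda>y. T \<one> (\<phi> y) = \<phi> y)"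
      by (rule near_conj_mono[OF T(2)[OF F(6)] nearI[OF openin_topspace p], of "\<lambda>y. y \<in> topspace X"])
        (auto simp: act_one)
    then obtain V where V: "open V" "?c \<in> V" "\<forall>z\<in>V. T \<one> z = z" using germ[of "T \<one>" "\<lambda>z. z"] by blast
    have "(T \<one> has_derivative (\<lambda>v. v)) (at ?c)"
      by (rule has_derivative_transform_within_open[OF has_derivative_ident V(1,2)]) (use V(3) in simp)
    then show ?thesis using has_derivative_unique[OF L[OF F(6)]] by blast
  qed
  have Lmult: "L (g \<otimes> h) = L g \<circ> L h" if g: "g \<in> F" and h: "h \<in> F" for g h
  proof -
    have "near X p (\<lambda>y. \<phi> (\<rho> g (\<rho> h y)) = T g (\<phi> (\<rho> h y)))"
      using near_continuous_map[OF cont[OF F(3)[OF h]], of p "\<lambda>y. \<phi> (\<rho> g y) = T g (\<phi> y)"] T(2)[OF g] fixp[OF h] p by simp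
    from near_conj[OF this near_conj[OF T(2)[OF h] near_conj[OF T(2)[OF F(5)[OF g h]] nearI[OF openin_topspace p, of "\<lambda>y. y \<in> topspace X"]]]]
    have "near X p (\<lambda>y. (T g \<circ> T h) (\<phi> y) = T (g \<otimes> h) (\<phi> y))"
      by (rule near_mono) (use act_mult F(3) g h in auto)
    from germ[OF this] obtain V where V: "open V" "?c \<in> V" "\<forall>z\<in>V. (T g \<circ> T h) z = T (g \<otimes> h) z"
      by blast
    have "(T g \<circ> T h has_derivative L g \<circ> L h) (at ?c)"
      using diff_chain_at[OF L[OF h], of "T g" "L g"] L[OF g] Tc[OF h] by simp
    then have "(T (g \<otimes> h) has_derivative L g \<circ> L h) (at ?c)"
      by (rule has_derivative_transform_within_open[OF _ V(1,2)]) (use V(3) in blast)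
    then show ?thesis using has_derivative_unique[OF L[OF F(5)[OF g h]]] by blast
  qed
  have rep: "rep F L"
    unfolding rep_def using L has_derivative_linear L1 Lmult by auto
  note LL = repD[OF sF rep]
  \<comment> \<open>As \<open>\<phi>\<close> is a total function, the average makes sense on all of
    \<open>X\<close> and is equivariant there; only near \<open>p\<close> is it claimed to be a
    chart.\<close>
  define \<psi> where "\<psi> x = (\<Sum>g\<in>F. L (inv g) (\<phi> (\<rho> g x) - ?c)) /\<^sub>R card F" for x
  have equi: "\<psi> (\<rho> h x) = L h (\<psi> x)" if h: "h \<in> F" and x: "x \<in> topspace X" for h x
  proof -
    have "(\<Sum>g\<in>F. L (inv g) (\<phi> (\<rho> g (\<rho> h x)) - ?c)) = (\<Sum>g\<in>F. L (inv g) ((\<lambda>g. \<phi> (\<rho> g x) - ?c) (g \<otimes> h)))"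
      using act_mult[OF F(3) F(3)[OF h] x] by (intro sum.cong) auto
    also have "\<dots> = L h (\<Sum>g\<in>F. L (inv g) (\<phi> (\<rho> g x) - ?c))" by (rule rep_sum_shift[OF sF rep h])
    finally show ?thesis by (simp add: \<psi>_def linear_scale[OF LL(1)[OF h]])
  qed
  define q where "q z = (\<Sum>g\<in>F. L (inv g) (T g z - ?c)) /\<^sub>R card F" for z
  define W' where "W' = (\<Inter>g\<in>F. W g)"
  have W': "open W'" "?c \<in> W'" using W F(1) by (auto simp: W'_def)
  have bl: "bounded_linear (L (inv g))" if "g \<in> F" for g
    using LL(1)[OF F(4)[OF that]] by (simp add: linear_conv_bounded_linear)
  have "Cn_on (Suc 0) (\<lambda>z. L (inv g) (T g z - ?c)) W'" if g: "g \<in> F" for g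
    by (intro Cn_on_linear_comp[OF bl[OF g]] Cn_on_diff Cn_on_const W'(1) Cn_on_subset[OF W(3)[OF g]])
      (use g in \<open>auto simp: W'_def\<close>)
  then have q: "Cn_on (Suc 0) q W'"
    unfolding q_def by (intro Cn_on_scaleR Cn_on_const Cn_on_sum W'(1))
  \<comment> \<open>\<open>q\<close> is the average seen in the coordinate \<open>\<phi>\<close>.
    Its derivative at the centre is the mean of the maps L(g^-1) L(g), that is the identity, which
    makes \<open>\<psi>\<close> a C^1 chart near \<open>p\<close>.\<close>
  have "(q has_derivative (\<lambda>v. (\<Sum>g\<in>F. L (inv g) (L g v)) /\<^sub>R card F)) (at ?c)"
    unfolding q_def
  proof (intro has_derivative_scaleR_right has_derivative_sum)
    fix g assume g: "g \<in> F"
    have "((\<lambda>z. T g z - ?c) has_derivative L g) (at ?c)"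
      using has_derivative_diff[OF L[OF g] has_derivative_const[of ?c]] by simp
    then show "((\<lambda>z. L (inv g) (T g z - ?c)) has_derivative (\<lambda>v. L (inv g) (L g v))) (at ?c)"
      by (rule bounded_linear.has_derivative[OF bl[OF g]])
  qed
  moreover have "(\<Sum>g\<in>F. L (inv g) (L g v)) /\<^sub>R card F = v" for v
  proof -
    have "(\<Sum>g\<in>F. L (inv g) (L g v)) = real (card F) *\<^sub>R v"
      using LL(3) by (subst sum_constant_scaleR[symmetric]) (rule sum.cong[OF refl], simp)
    moreover have "real (card F) \<noteq> 0" using F(1,2) by simp
    ultimately show ?thesis by (simp only: scaleR_scaleR) simp
  qed
  ultimately have "(q has_derivative (\<lambda>v. v)) (at ?c)" by simp
  then have "ldiff 1 q ?c" by (rule ldiff_at_derivative_id[OF W' q])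
  moreover have "near X p (\<lambda>y. \<psi> y = q (\<phi> y))"
    using near_Ball_finite[OF F(1) T(2) p]
  proof (rule near_mono)
    fix y assume "\<forall>g\<in>F. \<phi> (\<rho> g y) = T g (\<phi> y)"
    then have "(\<Sum>g\<in>F. L (inv g) (\<phi> (\<rho> g y) - ?c)) = (\<Sum>g\<in>F. L (inv g) (T g (\<phi> y) - ?c))"
      by (intro sum.cong) auto
    then show "\<psi> y = q (\<phi> y)" by (simp only: \<psi>_def q_def)
  qed
  ultimately have "regular X 1 \<A> \<psi> p" by (rule regular_comp[OF reg])
  then show ?thesis using that[OF rep _ equi] by blast
qed

lemma tube_exists:
  assumes p: "p \<in> topspace X"
  obtains F B \<psi> L where "tube F B \<psi> L" "p \<in> B" "\<And>g. g \<in> F \<Longrightarrow> \<rho> g p = p"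
proof -
  define F where "F = {g \<in> carrier G. \<rho> g p = p}"
  have sF: "subgrp F" unfolding F_def by (rule stabilizer_subgrp[OF p])
  note F = subgrpD[OF sF]
  obtain \<psi> L where \<psi>: "rep F L" "regular X 1 \<A> \<psi> p"
    "\<And>g x. g \<in> F \<Longrightarrow> x \<in> topspace X \<Longrightarrow> \<psi> (\<rho> g x) = L g (\<psi> x)"
    by (rule equivariant_chart_germ[OF p F_def]) (rule that)
  obtain V where V: "p \<in> V" "chart_on X (V, \<psi>)" "\<And>y. y \<in> V \<Longrightarrow> regular X 1 \<A> \<psi> y"
    using regular_local_chart[OF atlas1 \<psi>(2)] by metis
  \<comment> \<open>An element outside the stabilizer moves \<open>p\<close>, so Hausdorff
    separation gives a neighbourhood that it maps off itself. Intersecting these finitely many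
    neighbourhoods yields the last clause of \<open>tube\<close>.\<close>
  have "\<exists>N. openin X N \<and> p \<in> N \<and> (\<forall>x\<in>N. \<rho> g x \<notin> N)" if g: "g \<in> carrier G - F" for g
  proof -
    have gp: "\<rho> g p \<in> topspace X" "\<rho> g p \<noteq> p" using g act_closed p by (auto simp: F_def)
    then obtain A B where AB: "openin X A" "openin X B" "p \<in> A" "\<rho> g p \<in> B" "disjnt A B"
      using Hausdorff p unfolding Hausdorff_space_def by metis
    have "openin X {x \<in> topspace X. \<rho> g x \<in> B}" using g by (intro openin_continuous_map_preimage[OF cont AB(2)]) auto
    then show ?thesis
      using AB p by (intro exI[of _ "A \<inter> {x \<in> topspace X. \<rho> g x \<in> B}"]) (auto simp: disjnt_def)
  qed
  then obtain N where N: "\<And>g. g \<in> carrier G - F \<Longrightarrow> openin X (N g)" "\<And>g. g \<in> carrier G - F \<Longrightarrow> p \<in> N g"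
    "\<And>g x. g \<in> carrier G - F \<Longrightarrow> x \<in> N g \<Longrightarrow> \<rho> g x \<notin> N g" by metis
  define U where "U = \<Inter> (insert V (N ` (carrier G - F)))"
  have "openin X U"
    unfolding U_def by (rule openin_Inter) (use N(1) fin chart_onD(1)[OF V(2)] in auto)
  then have U: "openin X U" "p \<in> U" "U \<subseteq> V"
    using V N(2) by (auto simp: U_def)
  define B where "B = {x \<in> topspace X. \<forall>g\<in>F. \<rho> g x \<in> U}"
  note B = invariant_core[OF sF U(1), folded B_def]
  show ?thesis
  proof (rule that)
    show "p \<in> B" using U(2) p by (auto simp: B_def F_def)
    show "\<rho> g p = p" if "g \<in> F" for g using that by (simp add: F_def)
    show "tube F B \<psi> L"
      unfolding tube_def
    proof (intro conjI ballI impI)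
      show "inj_on \<psi> B" using chart_onD(2)[OF V(2)] B(2) U(3) by (meson inj_on_subset subset_trans)
      show "regular X 1 \<A> \<psi> x" if "x \<in> B" for x using V(3) B(2) U(3) that by blast
      show "\<psi> (\<rho> g x) = L g (\<psi> x)" if "g \<in> F" "x \<in> B" for g x
        using \<psi>(3) that by (simp add: B_def)
      fix g x assume g: "g \<in> carrier G" "x \<in> B" "\<rho> g x \<in> B"
      show "g \<in> F"
      proof (rule ccontr)
        assume "g \<notin> F"
        then have "x \<in> N g" "\<rho> g x \<in> N g" using g B(2) by (auto simp: U_def)
        then show False using N(3) g(1) \<open>g \<notin> F\<close> by blast
      qed
    qed (use sF \<psi>(1) B in auto)
  qed
qed

theorem equivariant_atlas_exists:
  obtains \<C> where "equivariant_atlas \<C>" "\<Union> (fst ` \<C>) = topspace X"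
proof -
  have rs: "regular_space X" using compact Hausdorff compact_Hausdorff_imp_regular_space by blast
  \<comment> \<open>Nested neighbourhoods: \<open>add_tube\<close> wants the closure of
    \<open>D\<close> inside \<open>B\<close>, and the closure of \<open>D0\<close> inside
    \<open>D\<close> lets the region secured so far be closed.\<close>
  define good where "good D0 \<longleftrightarrow> openin X D0 \<and> (\<exists>F B \<psi> L D. tube F B \<psi> L \<and> openin X D \<and> X closure_of D \<subseteq> B
    \<and> (\<forall>g\<in>F. \<forall>x\<in>D. \<rho> g x \<in> D) \<and> X closure_of D0 \<subseteq> D)" for D0
  have good: "\<exists>D0. good D0 \<and> p \<in> D0" if p: "p \<in> topspace X" for p
  proof -
    obtain F B \<psi> L where t: "tube F B \<psi> L" "p \<in> B" "\<And>g. g \<in> F \<Longrightarrow> \<rho> g p = p" using tube_exists[OF p] by blast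
    then have sF: "subgrp F" and oB: "openin X B" unfolding tube_def by blast+
    obtain D1 where D1: "openin X D1" "p \<in> D1" "X closure_of D1 \<subseteq> B"
      using regular_space_shrink[OF rs oB t(2)] .
    define D where "D = {x \<in> topspace X. \<forall>g\<in>F. \<rho> g x \<in> D1}"
    note D = invariant_core[OF sF D1(1), folded D_def]
    have pD: "p \<in> D" using p t(3) D1(2) by (simp add: D_def)
    have cl: "X closure_of D \<subseteq> B" using closure_of_mono[OF D(2)] D1(3) by (rule subset_trans)
    obtain D0 where D0: "openin X D0" "p \<in> D0" "X closure_of D0 \<subseteq> D"
      using regular_space_shrink[OF rs D(1) pD] .
    have "good D0"
      unfolding good_def using t(1) D cl D0 by (intro conjI exI[of _ F] exI[of _ B] exI[of _ \<psi>] exI[of _ L] exI[of _ D]) auto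
    then show ?thesis using D0(2) by blast
  qed
  \<comment> \<open>\<open>add_tube\<close> may shrink the domain of the atlas, so the induction
    tracks a closed invariant set that is certain to stay covered.\<close>
  define K where "K P = (\<Union>D0\<in>P. \<Union>g\<in>carrier G. \<rho> g ` (X closure_of D0))" for P
  have claim: "\<exists>\<C>. equivariant_atlas \<C> \<and> K P \<subseteq> \<Union> (fst ` \<C>)" if "finite P" "\<forall>D0\<in>P. good D0" for P
    using that
  proof (induction P)
    case empty
    have "equivariant_atlas {}" by (rule equivariant_atlasI) (auto simp: atlas_def)
    then show ?case by (auto simp: K_def)
  next
    case (insert D0 P)
    then obtain \<C> where C: "equivariant_atlas \<C>" "K P \<subseteq> \<Union> (fst ` \<C>)" by auto
    obtain F B \<psi> L D where t: "tube F B \<psi> L" "openin X D" "X closure_of D \<subseteq> B"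
      "\<And>g x. g \<in> F \<Longrightarrow> x \<in> D \<Longrightarrow> \<rho> g x \<in> D" "X closure_of D0 \<subseteq> D"
      using insert.prems unfolding good_def by auto
    have cK: "closedin X (K P)"
      unfolding K_def using insert.hyps(1) fin by (intro closedin_Union) (auto intro!: closedin_Union closedin_image)
    have iK: "\<rho> g x \<in> K P" if gx: "g \<in> carrier G" "x \<in> K P" for g x
    proof -
      obtain E h y where q: "E \<in> P" "h \<in> carrier G" "y \<in> X closure_of E" "x = \<rho> h y"
        using gx(2) by (auto simp: K_def)
      then have "y \<in> topspace X" by (meson closure_of_subset_topspace subsetD)
      then have "\<rho> g x = \<rho> (g \<otimes> h) y" using act_mult gx(1) q by simp
      moreover have "g \<otimes> h \<in> carrier G" using gx(1) q(2) by simp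
      ultimately show ?thesis using q(1,3) unfolding K_def by blast
    qed
    obtain \<C>' where C': "equivariant_atlas \<C>'" "K P \<subseteq> \<Union> (fst ` \<C>')"
      "\<And>g. g \<in> carrier G \<Longrightarrow> \<rho> g ` D \<subseteq> \<Union> (fst ` \<C>')"
      by (rule add_tube[OF C(1) cK iK C(2) t(1-4)]) (rule that | assumption)+
    have "K (insert D0 P) = K P \<union> (\<Union>g\<in>carrier G. \<rho> g ` (X closure_of D0))" by (auto simp: K_def)
    also have "\<dots> \<subseteq> \<Union> (fst ` \<C>')"
    proof (intro Un_least C'(2) UN_least)
      fix g assume "g \<in> carrier G"
      then show "\<rho> g ` (X closure_of D0) \<subseteq> \<Union> (fst ` \<C>')" using C'(3)[of g] t(5) by (meson image_mono subset_trans)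
    qed
    finally show ?case using C'(1) by blast
  qed
  have "topspace X \<subseteq> \<Union> {D0. good D0}" using good by blast
  moreover have "\<forall>D0\<in>{D0. good D0}. openin X D0" by (simp add: good_def)
  moreover have "compactin X (topspace X)" using compact by (simp add: compact_space_def)
  ultimately obtain P where P: "finite P" "P \<subseteq> {D0. good D0}" "topspace X \<subseteq> \<Union> P"
    unfolding compactin_def by metis
  then have "\<forall>D0\<in>P. good D0" by auto
  from claim[OF P(1) this] obtain \<C> where C: "equivariant_atlas \<C>" "K P \<subseteq> \<Union> (fst ` \<C>)"
    by (elim exE conjE)
  have "topspace X \<subseteq> K P"
  proof
    fix x assume x: "x \<in> topspace X"
    then obtain E where p: "E \<in> P" "x \<in> E" using P(3) by blast
    then have "openin X E" using P(2) by (auto simp: good_def)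
    then have "x \<in> X closure_of E" using subsetD[OF closure_of_subset[OF openin_subset] p(2)] by blast
    then have "\<rho> \<one> x \<in> \<rho> \<one> ` (X closure_of E)" by (rule imageI)
    then have "\<rho> \<one> x \<in> K P" using p(1) one_closed unfolding K_def by blast
    then show "x \<in> K P" using act_one[OF x] by simp
  qed
  moreover have "\<Union> (fst ` \<C>) \<subseteq> topspace X"
    using equivariant_atlas_subset[OF C(1)] openin_subset by fastforce
  ultimately show ?thesis using that C by blast
qed

end

section \<open>Smoothing a homeomorphism of class \<open>C\<^sup>1\<close>\<close>

lemma compact_neighbourhood_radius:
  assumes "compact P" "open Q" "P \<subseteq> Q"
  obtains \<delta> where "0 < \<delta>" "\<And>x y. x \<in> P \<Longrightarrow> norm (y - x) \<le> \<delta> \<Longrightarrow> y \<in> Q"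
proof -
  obtain e where e: "e > 0" "(\<Union>x\<in>P. ball x e) \<subseteq> Q"
    using compact_subset_open_imp_ball_epsilon_subset[OF assms] by blast
  show ?thesis
  proof (rule that[of "e/2"])
    show "y \<in> Q" if "x \<in> P" "norm (y - x) \<le> e/2" for x y
      using e that by (intro subsetD[OF e(2)]) (auto simp: dist_norm norm_minus_commute intro!: bexI[of _ x])
  qed (use e in simp)
qed

text \<open>\<open>\<theta>\<close> transported to \<open>X\<close>. It is meant for
  \<open>\<theta>\<close> that are the identity off a compact part of the image of the chart, so
  that both branches fit together.\<close>

definition chart_twist :: "'a set \<Rightarrow> ('a \<Rightarrow> 'e) \<Rightarrow> ('e \<Rightarrow> 'e) \<Rightarrow> 'a \<Rightarrow> 'a" where
  "chart_twist B \<psi> \<theta> x = (if x \<in> B then inv_into B \<psi> (\<theta> (\<psi> x)) else x)"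

lemma chart_twist:
  fixes \<psi> :: "'a \<Rightarrow> 'e::euclidean_space"
  assumes ch: "chart_on X (B, \<psi>)" and tm: "tame (1/2) (\<psi> ` V) \<theta>" and V: "V \<subseteq> B" and H: "Hausdorff_space X"
  shows "\<And>x. x \<in> B \<Longrightarrow> chart_twist B \<psi> \<theta> x \<in> B" "\<And>x. x \<in> B \<Longrightarrow> \<psi> (chart_twist B \<psi> \<theta> x) = \<theta> (\<psi> x)"
    "\<And>x. x \<notin> V \<Longrightarrow> chart_twist B \<psi> \<theta> x = x"
    "\<And>x. x \<in> topspace X \<Longrightarrow> x \<notin> V \<Longrightarrow> near X x (\<lambda>y. chart_twist B \<psi> \<theta> y = y)"
    "continuous_map X X (chart_twist B \<psi> \<theta>)" "bij_betw (chart_twist B \<psi> \<theta>) (topspace X) (topspace X)"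
proof -
  let ?k = "chart_twist B \<psi> \<theta>"
  note c = chart_onD[OF ch]
  have BX: "B \<subseteq> topspace X" using c(1) openin_subset by blast
  obtain Z where Z: "compact Z" "Z \<subseteq> \<psi> ` V" "\<And>y. y \<notin> Z \<Longrightarrow> \<theta> y = y" and c\<theta>: "continuous_on UNIV \<theta>"
    using tm Cn_on_continuous unfolding tame_def by metis
  have tmB: "tame (1/2) (\<psi> ` B) \<theta>" using tame_mono[OF tm order_refl image_mono[OF V]] .
  show kB: "?k x \<in> B" and k\<psi>: "\<psi> (?k x) = \<theta> (\<psi> x)" if x: "x \<in> B" for x
  proof -
    have "\<theta> (\<psi> x) \<in> \<psi> ` B" using tame_bij(2)[OF tmB] x by blast
    then show "?k x \<in> B" "\<psi> (?k x) = \<theta> (\<psi> x)" using x by (auto simp: chart_twist_def inv_into_into f_inv_into_f)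
  qed
  have kid: "?k x = x" if "x \<in> B" "\<psi> x \<notin> Z" for x
    using that c(2) Z(3) by (simp add: chart_twist_def inv_into_f_f)
  have kid2: "?k x = x" if "x \<notin> B" for x using that by (simp add: chart_twist_def)
  have VZ: "x \<in> V" if x: "x \<in> B" "\<psi> x \<in> Z" for x
  proof -
    obtain y where "y \<in> V" "\<psi> x = \<psi> y" using x(2) Z(2) by blast
    then show ?thesis using inj_onD[OF c(2), of x y] x(1) V by auto
  qed
  show "?k x = x" if "x \<notin> V" for x using that kid kid2 VZ by (cases "x \<in> B") auto
  \<comment> \<open>The support pulled back to \<open>X\<close> is compact, hence closed in the
    Hausdorff space \<open>X\<close>. So the twist is the identity near every point off
    \<open>S\<close>, boundary points of \<open>B\<close> included, which gives continuity across
    that boundary.\<close>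
  define S where "S = {x \<in> B. \<psi> x \<in> Z}"
  have "compactin X S"
  proof -
    have "homeomorphic_map (subtopology X B) (top_of_set (\<psi> ` B)) \<psi>" using ch by (simp add: chart_on_def)
    then obtain f where f: "homeomorphic_maps (subtopology X B) (top_of_set (\<psi> ` B)) \<psi> f"
      using homeomorphic_map_maps by blast
    have "Z \<subseteq> \<psi> ` B" using Z(2) V by blast
    then have "compactin (top_of_set (\<psi> ` B)) Z" using Z(1) by (simp add: compactin_subtopology)
    moreover have "continuous_map (top_of_set (\<psi> ` B)) (subtopology X B) f" using f by (simp add: homeomorphic_maps_def)
    ultimately have "compactin (subtopology X B) (f ` Z)" by (metis image_compactin)
    moreover have fB: "f (\<psi> x) = x" if "x \<in> B" for x using f that BX by (auto simp: homeomorphic_maps_def)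
    have "f ` Z = S"
    proof (intro subset_antisym subsetI)
      fix x assume "x \<in> f ` Z"
      then obtain z where z: "z \<in> Z" "x = f z" by blast
      then obtain y where "y \<in> B" "z = \<psi> y" using Z(2) V by blast
      then show "x \<in> S" using z fB by (simp add: S_def)
    next
      fix x assume "x \<in> S"
      then show "x \<in> f ` Z" using fB[of x] by (auto simp: S_def image_iff intro!: bexI[of _ "\<psi> x"])
    qed
    ultimately show ?thesis by (simp add: compactin_subtopology)
  qed
  then have cS: "closedin X S" using compactin_imp_closedin[OF H] by blast
  have off: "near X x (\<lambda>y. ?k y = y)" if "x \<in> topspace X" "x \<notin> S" for x
  proof (rule nearI[of X "topspace X - S"])
    show "?k y = y" if "y \<in> topspace X - S" for y using that kid kid2 by (cases "y \<in> B") (auto simp: S_def)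
  qed (use that cS in auto)
  show "near X x (\<lambda>y. ?k y = y)" if "x \<in> topspace X" "x \<notin> V" for x
    using off[OF that(1)] that(2) VZ by (auto simp: S_def)
  show "continuous_map X X ?k"
  proof -
    have "openin X {x \<in> topspace X. ?k x \<in> U}" if U: "openin X U" for U
    proof (subst openin_subopen, intro ballI)
      fix x assume "x \<in> {x \<in> topspace X. ?k x \<in> U}"
      then have x: "x \<in> topspace X" "?k x \<in> U" by auto
      show "\<exists>T. openin X T \<and> x \<in> T \<and> T \<subseteq> {x \<in> topspace X. ?k x \<in> U}"
      proof (cases "x \<in> B")
        case True
        define Y where "Y = B \<inter> \<psi> -` (\<theta> -` (\<psi> ` (U \<inter> B)))"
        have "open (\<theta> -` (\<psi> ` (U \<inter> B)))"
          using c(4)[of "U \<inter> B"] U c(1) c\<theta> by (intro open_vimage) auto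
        then have "openin X Y" unfolding Y_def by (rule c(5))
        moreover have "x \<in> Y" using True kB[OF True] k\<psi>[OF True] x(2) unfolding Y_def by (auto intro!: image_eqI[of _ _ "?k x"])
        moreover have "?k y \<in> U" if yY: "y \<in> Y" for y
        proof -
          have y: "y \<in> B" using yY by (simp add: Y_def)
          obtain z where "z \<in> U \<inter> B" "\<theta> (\<psi> y) = \<psi> z" using yY by (auto simp: Y_def)
          then show ?thesis using inj_onD[OF c(2), of "?k y" z] k\<psi>[OF y] kB[OF y] by auto
        qed
        ultimately show ?thesis using BX by (intro exI[of _ Y]) (auto simp: Y_def)
      next
        case False
        then obtain N where N: "openin X N" "x \<in> N" "\<forall>y\<in>N. ?k y = y"
          using off[OF x(1)] by (auto simp: S_def near_def)
        have "?k x = x" using False by (rule kid2)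
        then show ?thesis using N U x openin_subset[OF N(1)] by (intro exI[of _ "N \<inter> U"]) auto
      qed
    qed
    moreover have "?k x \<in> topspace X" if "x \<in> topspace X" for x using kB kid2 BX that by (cases "x \<in> B") auto
    ultimately show ?thesis unfolding continuous_map_def by auto
  qed
  show "bij_betw ?k (topspace X) (topspace X)"
    unfolding bij_betw_def
  proof
    have bij: "bij \<theta>" using tame_bij(1)[OF tm] .
    show "inj_on ?k (topspace X)"
    proof (rule inj_onI)
      fix x y assume xy: "?k x = ?k y"
      show "x = y"
      proof (cases "x \<in> B \<or> y \<in> B")
        case True
        then have B: "x \<in> B" "y \<in> B" using xy kB kid2 by metis+
        then have "\<psi> x = \<psi> y" using k\<psi> xy injD[OF bij_is_inj[OF bij]] by metis
        then show ?thesis using inj_onD[OF c(2)] B by blast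
      qed (use xy kid2 in auto)
    qed
    show "?k ` topspace X = topspace X"
    proof (intro subset_antisym subsetI)
      fix y assume y: "y \<in> topspace X"
      show "y \<in> ?k ` topspace X"
      proof (cases "y \<in> B")
        case True
        obtain z where z: "\<psi> y = \<theta> z" using bij_is_surj[OF bij] by (rule surjE)
        have "\<theta> z \<in> \<psi> ` B" using z True by (metis imageI)
        then have "z \<in> \<psi> ` B" using tame_bij(2)[OF tmB] by blast
        then obtain x where x: "x \<in> B" "z = \<psi> x" by blast
        then have "?k x = y" using k\<psi>[OF x(1)] kB[OF x(1)] z inj_onD[OF c(2)] True by metis
        then show ?thesis using x BX by blast
      next
        case False
        then show ?thesis using kid2 y by (metis imageI)
      qed
    next
      fix y assume "y \<in> ?k ` topspace X"
      then obtain x where "x \<in> topspace X" "y = ?k x" by blast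
      then show "y \<in> topspace X" using kB kid2 BX by (cases "x \<in> B") auto
    qed
  qed
qed

text \<open>For continuous \<open>k\<close>, this encodes that \<open>k\<close> is a C^r
  diffeomorphism germ at \<open>x\<close> from the structure \<open>\<A>\<close> to the structure
  \<open>\<C>\<close>: regular germs are invertible, so local invertibility of \<open>k\<close> is
  included.\<close>

definition pulls_back :: "'a topology \<Rightarrow> enat \<Rightarrow> ('a, real^'n) chart set \<Rightarrow> ('a, real^'n) chart set \<Rightarrow> ('a \<Rightarrow> 'a) \<Rightarrow> 'a \<Rightarrow> bool" where
  "pulls_back X r \<A> \<C> k x \<longleftrightarrow> (\<forall>\<phi>. regular X r \<C> \<phi> (k x) \<longrightarrow> regular X r \<A> (\<lambda>y. \<phi> (k y)) x)"

text \<open>One chart at \<open>k x\<close> decides, since all regular germs there differ by local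
  diffeomorphisms.\<close>

lemma pulls_backI:
  assumes C: "atlas X r \<C>" and k: "continuous_map X X k" "x \<in> topspace X"
    and \<psi>: "regular X r \<C> \<psi> (k x)" "regular X r \<A> (\<lambda>y. \<psi> (k y)) x"
  shows "pulls_back X r \<A> \<C> k x"
  unfolding pulls_back_def
proof (intro allI impI)
  fix \<phi> assume "regular X r \<C> \<phi> (k x)"
  then obtain T where T: "ldiff r T (\<psi> (k x))" "near X (k x) (\<lambda>y. \<phi> y = T (\<psi> y))"
    using regular_related[OF C \<psi>(1)] unfolding germ_related_def by blast
  show "regular X r \<A> (\<lambda>y. \<phi> (k y)) x"
    by (rule regular_comp[OF \<psi>(2) T(1) near_continuous_map[OF k(1) T(2) k(2)]])
qed

text \<open>The C^1 chart f = \<psi> o k is smoothed with respect to \<open>\<A>\<close>, and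
  \<open>k\<close> is followed by the twist of \<open>\<psi>\<close> with the same
  \<open>\<theta>\<close>, so that \<psi> o k' = \<theta> o f. A small \<open>\<theta>\<close> keeps
  finitely many closed sets \<open>P i\<close> inside their open targets \<open>Q i\<close>.\<close>

lemma smoothing_homeomorphism_step:
  assumes A: "atlas X \<infinity> \<A>" "\<Union> (fst ` \<A>) = topspace X" and X: "compact_space X" "Hausdorff_space X"
    and C: "atlas X \<infinity> \<C>" "\<And>\<phi> x. regular X \<infinity> \<C> \<phi> x \<Longrightarrow> regular X 1 \<A> \<phi> x"
    and k: "continuous_map X X k" "bij_betw k (topspace X) (topspace X)"
      "\<And>x. x \<in> topspace X \<Longrightarrow> pulls_back X 1 \<A> \<A> k x"
    and B: "(B, \<psi>) \<in> \<C>" and L: "closedin X L" "k ` L \<subseteq> B"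
    and J: "finite J" "\<And>i. i \<in> J \<Longrightarrow> closedin X (P i)" "\<And>i. i \<in> J \<Longrightarrow> openin X (Q i)" "\<And>i. i \<in> J \<Longrightarrow> k ` P i \<subseteq> Q i"
  obtains k' where "continuous_map X X k'" "bij_betw k' (topspace X) (topspace X)"
    "\<And>x. x \<in> topspace X \<Longrightarrow> pulls_back X 1 \<A> \<A> k' x"
    "\<And>x. x \<in> topspace X \<Longrightarrow> pulls_back X \<infinity> \<A> \<C> k x \<Longrightarrow> pulls_back X \<infinity> \<A> \<C> k' x"
    "\<And>x. x \<in> L \<Longrightarrow> pulls_back X \<infinity> \<A> \<C> k' x"
    "\<And>i. i \<in> J \<Longrightarrow> k' ` P i \<subseteq> Q i"
proof -
  have A1: "atlas X 1 \<A>" using atlas_mono[OF A(1)] by simp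
  have AA: "regular X 1 \<A> \<phi> x" if "regular X \<infinity> \<A> \<phi> x" for \<phi> x
    using regular_refine[OF _ that] regular_chart[OF _ _ A1] by blast
  have ch: "chart_on X (B, \<psi>)" using atlasD[OF C(1) B] .
  note c = chart_onD[OF ch]
  have BX: "B \<subseteq> topspace X" using c(1) openin_subset by blast
  have LX: "L \<subseteq> topspace X" using L(1) closedin_subset by blast
  have kX: "k x \<in> topspace X" if "x \<in> topspace X" for x using k(2) that by (meson bij_betwE)
  have kinj: "x = y" if "k x = k y" "x \<in> topspace X" "y \<in> topspace X" for x y
    using k(2) that by (meson bij_betw_imp_inj_on inj_onD)
  define B' where "B' = {x \<in> topspace X. k x \<in> B}"
  have B': "openin X B'" unfolding B'_def by (rule openin_continuous_map_preimage[OF k(1) c(1)])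
  have B'X: "B' \<subseteq> topspace X" by (auto simp: B'_def)
  define f where "f x = \<psi> (k x)" for x
  have inj: "inj_on f B'"
  proof (rule inj_onI)
    fix x y assume xy: "x \<in> B'" "y \<in> B'" "f x = f y"
    then have "k x = k y" using inj_onD[OF c(2)] by (simp add: f_def B'_def)
    then show "x = y" using kinj xy by (simp add: B'_def)
  qed
  have reg1: "regular X 1 \<A> f x" if "x \<in> B'" for x
    using k(3)[of x] C(2)[OF regular_chart[OF B _ C(1)]] that by (simp add: pulls_back_def B'_def f_def[abs_def])
  have LB: "L \<subseteq> B'" using L LX by (auto simp: B'_def)
  \<comment> \<open>Since the closure of \<open>V\<close> stays in \<open>B'\<close>, its
    intersection with each \<open>P i\<close> is compact inside the domain of
    \<open>f\<close>.\<close>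
  obtain V where V: "openin X V" "L \<subseteq> V" "X closure_of V \<subseteq> B'"
  proof -
    have n: "normal_space X" using X compact_Hausdorff_or_regular_imp_normal_space by blast
    have "closedin X (topspace X - B')" "disjnt L (topspace X - B')" using B' LB by (auto simp: disjnt_def)
    then obtain V W where W: "openin X V" "openin X W" "L \<subseteq> V" "topspace X - B' \<subseteq> W" "disjnt V W"
      using n L(1) unfolding normal_space_def by metis
    have "X closure_of V \<subseteq> topspace X - W"
      by (rule closure_of_minimal) (use W openin_subset[OF W(1)] in \<open>auto simp: disjnt_def\<close>)
    then show ?thesis using that[OF W(1,3)] W(4) by blast
  qed
  have VB: "V \<subseteq> X closure_of V" using closure_of_subset[OF openin_subset[OF V(1)]] .
  then have VB': "V \<subseteq> B'" using V(3) by blast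
  \<comment> \<open>Only images of points of \<open>V\<close> are moved, so a margin is required
    there alone; compactness supplies it.\<close>
  have "\<exists>\<delta>>0. \<forall>x\<in>P i \<inter> X closure_of V. \<forall>v. norm (v - f x) \<le> \<delta> \<longrightarrow> v \<in> \<psi> ` (B \<inter> Q i)" if i: "i \<in> J" for i
  proof -
    have "compactin X (P i \<inter> X closure_of V)"
      using closedin_compact_space[OF X(1)] J(2)[OF i] by (simp add: closedin_Int)
    moreover have "P i \<inter> X closure_of V \<subseteq> B'" using V(3) by blast
    ultimately have "compactin (subtopology X B') (P i \<inter> X closure_of V)" by (simp add: compactin_subtopology)
    moreover have "continuous_map (subtopology X B') euclidean f"
      using chart_onD(3)[OF regular_chart_on[OF A1 B' inj reg1]] .
    ultimately have "compact (f ` (P i \<inter> X closure_of V))"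
      using image_compactin by fastforce
    moreover have "open (\<psi> ` (B \<inter> Q i))" using c(1,4) J(3)[OF i] by auto
    moreover have "f ` (P i \<inter> X closure_of V) \<subseteq> \<psi> ` (B \<inter> Q i)"
      using V(3) J(4)[OF i] by (auto simp: f_def B'_def)
    ultimately obtain \<delta> where "0 < \<delta>" "\<And>x y. x \<in> f ` (P i \<inter> X closure_of V) \<Longrightarrow> norm (y - x) \<le> \<delta> \<Longrightarrow> y \<in> \<psi> ` (B \<inter> Q i)"
      using compact_neighbourhood_radius by metis
    then show ?thesis by blast
  qed
  then obtain d where d: "\<And>i. i \<in> J \<Longrightarrow> 0 < d i"
    "\<And>i x v. i \<in> J \<Longrightarrow> x \<in> P i \<Longrightarrow> x \<in> X closure_of V \<Longrightarrow> norm (v - f x) \<le> d i \<Longrightarrow> v \<in> \<psi> ` (B \<inter> Q i)"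
    by (metis IntI)
  \<comment> \<open>1/2 keeps the perturbation bijective; the other entries are the margins of the
    inclusions.\<close>
  define \<delta> where "\<delta> = Min (insert (1/2) (d ` J))"
  have fJ: "finite (insert (1/2) (d ` J))" using J(1) by simp
  have \<delta>: "0 < \<delta>" "\<delta> \<le> 1/2" "\<And>i. i \<in> J \<Longrightarrow> \<delta> \<le> d i"
    unfolding \<delta>_def using J(1) d(1) Min_le[OF fJ] by (simp, blast, blast)
  have "compactin X L" using closedin_compact_space[OF X(1) L(1)] .
  moreover have "V \<subseteq> \<Union> (fst ` \<A>)" using A(2) VB' B'X by blast
  ultimately obtain \<theta> where \<theta>: "tame \<delta> (f ` V) \<theta>"
    "\<And>y. y \<in> L \<Longrightarrow> regular X \<infinity> \<A> (\<lambda>y. \<theta> (f y)) y"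
    "\<And>y. y \<in> B' \<Longrightarrow> regular X \<infinity> \<A> f y \<Longrightarrow> regular X \<infinity> \<A> (\<lambda>y. \<theta> (f y)) y"
    using relative_smoothing[OF A(1) A1 AA B' inj reg1 V(1) VB' _ _ V(2) \<delta>(1)] by metis
  have fV: "f ` V = \<psi> ` k ` V" by (simp add: f_def[abs_def] image_image)
  have tm: "tame (1/2) (\<psi> ` k ` V) \<theta>" using tame_mono[OF \<theta>(1) \<delta>(2) order_refl] fV by simp
  have kVB: "k ` V \<subseteq> B" using VB' by (auto simp: B'_def)
  let ?t = "chart_twist B \<psi> \<theta>"
  note tw = chart_twist[OF ch tm kVB X(2)]
  define k' where "k' x = ?t (k x)" for x
  have k'c: "continuous_map X X k'"
    unfolding k'_def[abs_def] using continuous_map_compose[OF k(1) tw(5)] by (simp add: o_def)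
  have k'b: "bij_betw k' (topspace X) (topspace X)"
    unfolding k'_def[abs_def] using bij_betw_trans[OF k(2) tw(6)] by (simp add: o_def)
  have in_B: "\<psi> (k' y) = \<theta> (f y)" "k' y \<in> B" if "y \<in> B'" for y
    using tw(1,2)[of "k y"] that by (auto simp: B'_def f_def k'_def)
  have off_B: "near X x (\<lambda>y. k' y = k y)" "k' x = k x" if x: "x \<in> topspace X" "x \<notin> B'" for x
  proof -
    have "k x \<notin> k ` V" using x VB' kinj B'X by (metis imageE subsetD)
    then show "near X x (\<lambda>y. k' y = k y)" "k' x = k x"
      unfolding k'_def using near_continuous_map[OF k(1) tw(4)[OF kX[OF x(1)]] x(1)] tw(3) by auto
  qed
  have off_pb: "pulls_back X r \<A> \<D> k' x" if pb: "pulls_back X r \<A> \<D> k x" and x: "x \<in> topspace X" "x \<notin> B'" for r \<D> x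
    unfolding pulls_back_def
  proof (intro allI impI)
    fix \<phi> :: "'a \<Rightarrow> real^'b" assume "regular X r \<D> \<phi> (k' x)"
    then have "regular X r \<A> (\<lambda>y. \<phi> (k y)) x" using pb off_B(2)[OF x] by (simp add: pulls_back_def)
    then show "regular X r \<A> (\<lambda>y. \<phi> (k' y)) x"
      by (rule regular_cong) (rule near_mono[OF off_B(1)[OF x]], simp)
  qed
  have near_B: "near X x (\<lambda>y. \<psi> (k' y) = \<theta> (f y))" if "x \<in> B'" for x
    using in_B(1) that by (intro nearI[OF B']) auto
  show ?thesis
  proof (rule that[OF k'c k'b])
    show "pulls_back X 1 \<A> \<A> k' x" if x: "x \<in> topspace X" for x
    proof (cases "x \<in> B'")
      case True
      show ?thesis
      proof (rule pulls_backI[OF A1 k'c x])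
        show "regular X 1 \<A> \<psi> (k' x)" using C(2)[OF regular_chart[OF B in_B(2)[OF True] C(1)]] .
        show "regular X 1 \<A> (\<lambda>y. \<psi> (k' y)) x"
          by (rule regular_cong[OF regular_tame[OF A1 reg1[OF True] tm] near_B[OF True]]) simp
      qed
    qed (use off_pb k(3) x in blast)
    have good: "pulls_back X \<infinity> \<A> \<C> k' x" if x: "x \<in> B'" and r: "regular X \<infinity> \<A> (\<lambda>y. \<theta> (f y)) x" for x
    proof (rule pulls_backI[OF C(1) k'c _ regular_chart[OF B in_B(2)[OF x] C(1)]])
      show "regular X \<infinity> \<A> (\<lambda>y. \<psi> (k' y)) x" using regular_cong[OF r near_B[OF x]] .
    qed (use x B'X in blast)
    show "pulls_back X \<infinity> \<A> \<C> k' x" if x: "x \<in> topspace X" and pb: "pulls_back X \<infinity> \<A> \<C> k x" for x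
    proof (cases "x \<in> B'")
      case True
      then have "k x \<in> B" by (simp add: B'_def)
      then have "regular X \<infinity> \<A> f x"
        using pb regular_chart[OF B _ C(1)] unfolding pulls_back_def f_def[abs_def] by blast
      then show ?thesis using good[OF True \<theta>(3)[OF True]] by blast
    qed (use off_pb pb x in blast)
    show "pulls_back X \<infinity> \<A> \<C> k' x" if "x \<in> L" for x using good \<theta>(2) LB that by blast
    show "k' ` P i \<subseteq> Q i" if i: "i \<in> J" for i
    proof
      fix y assume "y \<in> k' ` P i"
      then obtain x where x: "x \<in> P i" "y = k' x" by blast
      then have xX: "x \<in> topspace X" using J(2)[OF i] closedin_subset by blast
      show "y \<in> Q i"
      proof (cases "x \<in> V")
        case True
        have xB: "x \<in> B'" using True VB' by blast
        have "norm (\<theta> (f x) - f x) \<le> d i" using \<theta>(1) \<delta>(3)[OF i] unfolding tame_def by (meson order_trans)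
        then have "\<psi> y \<in> \<psi> ` (B \<inter> Q i)" using d(2)[OF i x(1)] True VB in_B(1)[OF xB] x(2) by auto
        then obtain z where "z \<in> B \<inter> Q i" "\<psi> y = \<psi> z" by blast
        then show ?thesis using inj_onD[OF c(2), of y z] in_B(2)[OF xB] x(2) by auto
      next
        case False
        then have "k x \<notin> k ` V" using kinj xX VB' B'X by (metis imageE subsetD)
        then have "y = k x" using tw(3) x(2) by (simp add: k'_def)
        then show ?thesis using J(4)[OF i] x(1) by blast
      qed
    qed
  qed
qed

theorem smoothing_homeomorphism:
  assumes A: "atlas X \<infinity> \<A>" "\<Union> (fst ` \<A>) = topspace X" and X: "compact_space X" "Hausdorff_space X"
    and C: "atlas X \<infinity> \<C>" "\<And>\<phi> x. regular X \<infinity> \<C> \<phi> x \<Longrightarrow> regular X 1 \<A> \<phi> x" "\<Union> (fst ` \<C>) = topspace X"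
  obtains k where "continuous_map X X k" "bij_betw k (topspace X) (topspace X)"
    "\<And>x. x \<in> topspace X \<Longrightarrow> pulls_back X \<infinity> \<A> \<C> k x"
proof -
  have rs: "regular_space X" using X compact_Hausdorff_imp_regular_space by blast
  define good where "good D \<longleftrightarrow> openin X D \<and> (\<exists>B \<psi>. (B, \<psi>) \<in> \<C> \<and> X closure_of D \<subseteq> B)" for D
  have "\<exists>D. good D \<and> p \<in> D" if p: "p \<in> topspace X" for p
  proof -
    have "p \<in> \<Union> (fst ` \<C>)" using p C(3) by simp
    then obtain B \<psi> where B: "(B, \<psi>) \<in> \<C>" "p \<in> B" by auto
    obtain D where "openin X D" "p \<in> D" "X closure_of D \<subseteq> B"
      using regular_space_shrink[OF rs chart_onD(1)[OF atlasD[OF C(1) B(1)]] B(2)] .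
    then show ?thesis using B(1) unfolding good_def by blast
  qed
  then have "topspace X \<subseteq> \<Union> {D. good D}" by blast
  moreover have "\<forall>D\<in>{D. good D}. openin X D" by (simp add: good_def)
  moreover have "compactin X (topspace X)" using X(1) by (simp add: compact_space_def)
  ultimately obtain P where P: "finite P" "P \<subseteq> {D. good D}" "topspace X \<subseteq> \<Union> P"
    unfolding compactin_def by metis
  have "\<forall>D\<in>P. \<exists>B \<psi>. (B, \<psi>) \<in> \<C> \<and> X closure_of D \<subseteq> B" using P(2) by (auto simp: good_def)
  then obtain B \<psi> where B: "\<And>D. D \<in> P \<Longrightarrow> (B D, \<psi> D) \<in> \<C>" "\<And>D. D \<in> P \<Longrightarrow> X closure_of D \<subseteq> B D"
    by metis
  have oB: "openin X (B D)" if "D \<in> P" for D using chart_onD(1)[OF atlasD[OF C(1) B(1)[OF that]]] .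
  \<comment> \<open>The inclusions are kept for every \<open>D\<close> in \<open>P\<close>, also for
    those still waiting, so that the chart of each remains usable when its turn comes. The identity
    starts the induction.\<close>
  have "\<exists>k. continuous_map X X k \<and> bij_betw k (topspace X) (topspace X)
      \<and> (\<forall>x\<in>topspace X. pulls_back X 1 \<A> \<A> k x) \<and> (\<forall>D\<in>P. k ` (X closure_of D) \<subseteq> B D)
      \<and> (\<forall>D\<in>S. \<forall>x\<in>X closure_of D. pulls_back X \<infinity> \<A> \<C> k x)" if "S \<subseteq> P" for S
    using finite_subset[OF that P(1)] that
  proof (induction S)
    case empty
    show ?case
      using B(2) by (intro exI[of _ "\<lambda>x. x"]) (auto simp: bij_betw_def pulls_back_def)
  next
    case (insert D S)
    then obtain k where k: "continuous_map X X k" "bij_betw k (topspace X) (topspace X)"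
      "\<And>x. x \<in> topspace X \<Longrightarrow> pulls_back X 1 \<A> \<A> k x" "\<And>D. D \<in> P \<Longrightarrow> k ` (X closure_of D) \<subseteq> B D"
      "\<And>D x. D \<in> S \<Longrightarrow> x \<in> X closure_of D \<Longrightarrow> pulls_back X \<infinity> \<A> \<C> k x" by auto
    have D: "D \<in> P" using insert.prems by simp
    have cl: "closedin X (X closure_of E)" for E by simp
    obtain k' where k': "continuous_map X X k'" "bij_betw k' (topspace X) (topspace X)"
      "\<And>x. x \<in> topspace X \<Longrightarrow> pulls_back X 1 \<A> \<A> k' x"
      "\<And>x. x \<in> topspace X \<Longrightarrow> pulls_back X \<infinity> \<A> \<C> k x \<Longrightarrow> pulls_back X \<infinity> \<A> \<C> k' x"
      "\<And>x. x \<in> X closure_of D \<Longrightarrow> pulls_back X \<infinity> \<A> \<C> k' x"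
      "\<And>D. D \<in> P \<Longrightarrow> k' ` (X closure_of D) \<subseteq> B D"
      by (rule smoothing_homeomorphism_step[OF A X C(1,2) k(1-3) B(1)[OF D] cl k(4)[OF D] P(1) cl oB k(4)])
        (assumption | rule that)+
    show ?case
    proof (intro exI[of _ k'] conjI ballI k'(1-3,6))
      fix E x assume E: "E \<in> insert D S" "x \<in> X closure_of E"
      have "x \<in> topspace X" using E(2) by (meson closure_of_subset_topspace subsetD)
      then show "pulls_back X \<infinity> \<A> \<C> k' x" using E k(5) k'(4,5) by blast
    qed
  qed
  from this[OF order_refl] obtain k where k: "continuous_map X X k" "bij_betw k (topspace X) (topspace X)"
    "\<forall>D\<in>P. \<forall>x\<in>X closure_of D. pulls_back X \<infinity> \<A> \<C> k x" by auto
  show ?thesis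
  proof (rule that[OF k(1,2)])
    fix x assume "x \<in> topspace X"
    then obtain D where D: "D \<in> P" "x \<in> D" using P(3) by blast
    then have "openin X D" using P(2) by (auto simp: good_def)
    then have "x \<in> X closure_of D" using subsetD[OF closure_of_subset[OF openin_subset] D(2)] by blast
    then show "pulls_back X \<infinity> \<A> \<C> k x" using k(3) D(1) by blast
  qed
qed

section \<open>Conjugating the action\<close>

lemma Cr_map_pulls_back:
  fixes \<A> :: "('a, real^'n) chart set"
  assumes A: "atlas X r \<A>" and f: "continuous_map X X f" "\<And>x. x \<in> topspace X \<Longrightarrow> pulls_back X r \<A> \<A> f x"
  shows "Cr_map r X \<A> f"
proof -
  have "Cr_on r (\<psi> \<circ> f \<circ> inv_into U \<phi>) (\<phi> ` (U \<inter> f -` V))" if U: "(U, \<phi>) \<in> \<A>" and V: "(V, \<psi>) \<in> \<A>" for U \<phi> V \<psi>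
  proof (rule transition_Cr[OF atlasD[OF A U]])
    fix x assume x: "x \<in> U \<inter> f -` V"
    have ru: "regular X r \<A> \<phi> x" using regular_chart[OF U _ A] x by blast
    have "regular X r \<A> \<psi> (f x)" using regular_chart[OF V _ A] x by blast
    then have "regular X r \<A> (\<psi> \<circ> f) x"
      using f(2)[OF regular_topspace[OF A ru]] unfolding pulls_back_def o_def by blast
    then show "germ_related X r \<phi> (\<psi> \<circ> f) x" using regular_related[OF A ru] by blast
  qed simp
  then show ?thesis using f(1) unfolding Cr_map_def by blast
qed

text \<open>From coordinates to germs: the coordinate forms of \<open>f\<close> and of its inverse
  are mutually inverse, which is the data that \<open>ldiff_on\<close> asks for.\<close>

lemma Cr_diffeo_pulls_back:
  fixes \<A> :: "('a, real^'n) chart set"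
  assumes A: "atlas X r \<A>" "\<Union> (fst ` \<A>) = topspace X" and f: "Cr_diffeo r X \<A> f" and x: "x \<in> topspace X"
  shows "pulls_back X r \<A> \<A> f x"
proof -
  obtain f' where f': "homeomorphic_maps X X f f'" "Cr_map r X \<A> f" "Cr_map r X \<A> f'"
    using f unfolding Cr_diffeo_def by blast
  have h: "continuous_map X X f" "continuous_map X X f'" "\<And>y. y \<in> topspace X \<Longrightarrow> f' (f y) = y"
    "\<And>y. y \<in> topspace X \<Longrightarrow> f (f' y) = y"
    using f'(1) by (auto simp: homeomorphic_maps_def)
  have fx: "f x \<in> topspace X" using continuous_map_image_subset_topspace[OF h(1)] x by blast
  have "x \<in> \<Union> (fst ` \<A>)" "f x \<in> \<Union> (fst ` \<A>)" using A(2) x fx by simp_all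
  then obtain U \<phi> V \<psi> where U: "(U, \<phi>) \<in> \<A>" "x \<in> U" and V: "(V, \<psi>) \<in> \<A>" "f x \<in> V" by auto
  note cU = chart_onD[OF atlasD[OF A(1) U(1)]] and cV = chart_onD[OF atlasD[OF A(1) V(1)]]
  have UX: "U \<subseteq> topspace X" "V \<subseteq> topspace X" using cU(1) cV(1) openin_subset by blast+
  define N where "N = U \<inter> f -` V"
  have "N = U \<inter> {x \<in> topspace X. f x \<in> V}" using UX by (auto simp: N_def)
  then have N: "openin X N" "N \<subseteq> U" "x \<in> N"
    using cU(1) openin_continuous_map_preimage[OF h(1) cV(1)] U V by (auto simp: N_def)
  have fN: "f ` N = V \<inter> f' -` U"
  proof (intro subset_antisym subsetI)
    fix y assume "y \<in> f ` N"
    then show "y \<in> V \<inter> f' -` U" using UX h(3) by (auto simp: N_def)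
  next
    fix y assume y: "y \<in> V \<inter> f' -` U"
    then have "f (f' y) = y" using h(4) UX by blast
    then show "y \<in> f ` N" using y by (intro image_eqI[of _ _ "f' y"]) (auto simp: N_def)
  qed
  have "f ` N = V \<inter> {y \<in> topspace X. f' y \<in> U}" using fN UX by auto
  then have ofN: "openin X (f ` N)" "f ` N \<subseteq> V"
    using cV(1) openin_continuous_map_preimage[OF h(2) cU(1)] by auto
  let ?T = "\<psi> \<circ> f \<circ> inv_into U \<phi>" and ?T' = "\<phi> \<circ> f' \<circ> inv_into V \<psi>"
  have T: "?T (\<phi> y) = \<psi> (f y)" "?T' (\<psi> (f y)) = \<phi> y" if "y \<in> N" for y
  proof -
    have "y \<in> U" "f y \<in> V" "y \<in> topspace X" using that UX by (auto simp: N_def)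
    then show "?T (\<phi> y) = \<psi> (f y)" "?T' (\<psi> (f y)) = \<phi> y" using cU(2) cV(2) h(3) by (auto simp: inv_into_f_f)
  qed
  have im: "?T ` \<phi> ` N = \<psi> ` f ` N"
    unfolding image_image by (rule image_cong[OF refl]) (rule T(1))
  have "ldiff_on r ?T ?T' (\<phi> ` N)"
    unfolding ldiff_on_def im
  proof (intro conjI ballI)
    show "open (\<phi> ` N)" "open (\<psi> ` f ` N)" using cU(4) cV(4) N ofN by auto
    show "Cr_on r ?T (\<phi> ` N)" using f'(2) U(1) V(1) unfolding Cr_map_def N_def by fast
    show "Cr_on r ?T' (\<psi> ` f ` N)" using f'(3) U(1) V(1) unfolding Cr_map_def fN by fast
    show "?T' (?T z) = z" if "z \<in> \<phi> ` N" for z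
    proof -
      from that obtain y where "y \<in> N" "z = \<phi> y" by blast
      then show ?thesis using T by metis
    qed
  qed
  then have "ldiff r ?T (\<phi> x)" using N(3) ldiff_on_ldiff by blast
  moreover have "near X x (\<lambda>y. \<psi> (f y) = ?T (\<phi> y))" using T(1) N by (intro nearI[OF N(1)]) auto
  ultimately have "regular X r \<A> (\<lambda>y. \<psi> (f y)) x" by (rule regular_comp[OF regular_chart[OF U A(1)]])
  then show ?thesis by (rule pulls_backI[OF A(1) h(1) x regular_chart[OF V A(1)]])
qed

text \<open>For a chart \<open>\<psi>\<close> of \<open>\<C>\<close> at \<open>y\<close>, both
  \<open>\<phi>\<close> and \<psi> o k are regular for \<open>\<A>\<close> at \<open>g y\<close>.
  Their transition map, evaluated along \<open>g\<close>, expresses \<phi> o g through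
  \<open>\<psi>\<close>.\<close>

lemma pulls_back_inverse:
  assumes A: "atlas X r \<A>" and C: "atlas X r \<C>" "\<Union> (fst ` \<C>) = topspace X"
    and k: "homeomorphic_maps X X k g" and y: "y \<in> topspace X" and pb: "pulls_back X r \<A> \<C> k (g y)"
  shows "pulls_back X r \<C> \<A> g y"
  unfolding pulls_back_def
proof (intro allI impI)
  fix \<phi> assume \<phi>: "regular X r \<A> \<phi> (g y)"
  have h: "continuous_map X X g" "\<And>z. z \<in> topspace X \<Longrightarrow> k (g z) = z"
    using k by (auto simp: homeomorphic_maps_def)
  have "y \<in> \<Union> (fst ` \<C>)" using C(2) y by simp
  then obtain B \<psi> where B: "(B, \<psi>) \<in> \<C>" "y \<in> B" by auto
  have \<psi>: "regular X r \<C> \<psi> y" using regular_chart[OF B C(1)] .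
  then have "regular X r \<A> (\<lambda>z. \<psi> (k z)) (g y)" using pb h(2)[OF y] by (simp add: pulls_back_def)
  then obtain T where T: "ldiff r T (\<psi> (k (g y)))" "near X (g y) (\<lambda>z. \<phi> z = T (\<psi> (k z)))"
    using regular_related[OF A _ \<phi>] unfolding germ_related_def by blast
  have "near X y (\<lambda>z. \<phi> (g z) = T (\<psi> (k (g z))))" using near_continuous_map[OF h(1) T(2) y] .
  then have "near X y (\<lambda>z. \<phi> (g z) = T (\<psi> z))"
    by (rule near_conj_mono[OF _ nearI[OF openin_topspace y, of "\<lambda>z. z \<in> topspace X"]]) (auto simp: h(2))
  then show "regular X r \<C> (\<lambda>z. \<phi> (g z)) y" using regular_comp[OF \<psi>] T(1) h(2)[OF y] by simp
qed

theorem finite_C1_action_conjugated: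
  fixes X :: "'a topology" and \<A> :: "('a, real^'n) chart set" and G :: "('g, 'm) monoid_scheme"
  assumes M: "closed_smooth_manifold X \<A>" and fin: "finite (carrier G)" and act: "Cr_action 1 G X \<A> \<rho>"
  shows "conjugated_to_smooth_action G X \<A> \<rho>"
proof -
  have X: "compact_space X" "Hausdorff_space X" "smooth_atlas X \<A>"
    using M unfolding closed_smooth_manifold_def closed_smooth_manifold_axioms_def smooth_manifold_def by blast+
  have A: "atlas X \<infinity> \<A>" "\<Union> (fst ` \<A>) = topspace X"
    using smooth_atlas_atlas[OF X(3)] X(3) by (auto simp: smooth_atlas_def)
  have A1: "atlas X 1 \<A>" using atlas_mono[OF A(1)] by simp
  have ga: "group_action G (topspace X) \<rho>" and d: "\<And>g. g \<in> carrier G \<Longrightarrow> Cr_diffeo 1 X \<A> (\<rho> g)"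
    using act unfolding Cr_action_def by blast+
  have cont: "continuous_map X X (\<rho> g)" if "g \<in> carrier G" for g
    using d[OF that] unfolding Cr_diffeo_def Cr_map_def by blast
  interpret finite_C1_action G X \<rho> \<A>
  proof (intro finite_C1_action.intro finite_C1_action_axioms.intro ga fin A X(1,2) cont)
    show "regular X 1 \<A> (\<lambda>y. \<phi> (\<rho> g y)) x" if "g \<in> carrier G" "x \<in> topspace X" "regular X 1 \<A> \<phi> (\<rho> g x)" for g x \<phi>
      using Cr_diffeo_pulls_back[OF A1 A(2) d[OF that(1)] that(2)] that(3) by (simp add: pulls_back_def)
  qed
  obtain \<C> where \<C>: "equivariant_atlas \<C>" "\<Union> (fst ` \<C>) = topspace X" using equivariant_atlas_exists .
  note C = equivariant_atlasD[OF \<C>(1)]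
  obtain k where k: "continuous_map X X k" "bij_betw k (topspace X) (topspace X)"
    "\<And>x. x \<in> topspace X \<Longrightarrow> pulls_back X \<infinity> \<A> \<C> k x"
    by (rule smoothing_homeomorphism[OF A X(1,2) C(1,2) \<C>(2)]) (assumption | rule that)+
  \<comment> \<open>A continuous bijection from a compact space onto a Hausdorff space is a
    homeomorphism.\<close>
  have "homeomorphic_map X X k"
    using continuous_imp_homeomorphic_map[OF k(1) X(1,2)] k(2) by (auto simp: bij_betw_def)
  then obtain h where kh: "homeomorphic_maps X X k h" using homeomorphic_map_maps by blast
  have kh': "continuous_map X X h" "\<And>x. x \<in> topspace X \<Longrightarrow> h (k x) = x" "\<And>x. x \<in> topspace X \<Longrightarrow> k (h x) = x"
    using kh by (auto simp: homeomorphic_maps_def)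
  have kX: "k x \<in> topspace X" "h x \<in> topspace X" if "x \<in> topspace X" for x
    using continuous_map_image_subset_topspace[OF k(1)] continuous_map_image_subset_topspace[OF kh'(1)] that by blast+
  have cc: "continuous_map X X (h \<circ> \<rho> g \<circ> k)" if "g \<in> carrier G" for g
    by (intro continuous_map_compose[of X X] k(1) kh'(1) cont that)
  \<comment> \<open>The conjugate goes by \<open>k\<close> from \<open>\<A>\<close> to
    \<open>\<C>\<close>, by the action, smooth for \<open>\<C>\<close>, and by \<open>h\<close> back
    to \<open>\<A>\<close>. Charts are pulled back along these three arrows in reverse
    order.\<close>
  have pb: "pulls_back X \<infinity> \<A> \<A> (h \<circ> \<rho> g \<circ> k) x" if g: "g \<in> carrier G" and x: "x \<in> topspace X" for g x
    unfolding pulls_back_def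
  proof (intro allI impI)
    fix \<phi> assume \<phi>: "regular X \<infinity> \<A> \<phi> ((h \<circ> \<rho> g \<circ> k) x)"
    let ?y = "\<rho> g (k x)"
    have y: "?y \<in> topspace X" using act_closed[OF g kX(1)[OF x]] .
    have "pulls_back X \<infinity> \<C> \<A> h ?y" by (rule pulls_back_inverse[OF A(1) C(1) \<C>(2) kh y k(3)[OF kX(2)[OF y]]])
    then have "regular X \<infinity> \<C> (\<lambda>z. \<phi> (h z)) ?y" using \<phi> by (simp add: pulls_back_def)
    then have "regular X \<infinity> \<C> (\<lambda>z. \<phi> (h (\<rho> g z))) (k x)" by (rule C(3)[OF g kX(1)[OF x]])
    from k(3)[OF x, unfolded pulls_back_def, rule_format, OF this]
    show "regular X \<infinity> \<A> (\<lambda>z. \<phi> ((h \<circ> \<rho> g \<circ> k) z)) x" by simp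
  qed
  have inv: "(h \<circ> \<rho> g' \<circ> k) ((h \<circ> \<rho> g \<circ> k) x) = x"
    if "g \<in> carrier G" "x \<in> topspace X" "\<rho> g' (\<rho> g (k x)) = k x" for g g' x
    using that kh'(2)[OF that(2)] kh'(3)[OF act_closed[OF that(1) kX(1)[OF that(2)]]] by simp
  have "Cr_diffeo \<infinity> X \<A> (h \<circ> \<rho> g \<circ> k)" if g: "g \<in> carrier G" for g
    unfolding Cr_diffeo_def
  \<comment> \<open>The inverse is the conjugate of the inverse element, smooth for the same
    reason.\<close>
  proof (intro exI[of _ "h \<circ> \<rho> (inv\<^bsub>G\<^esub> g) \<circ> k"] conjI Cr_map_pulls_back[OF A(1)] cc pb)
    show "homeomorphic_maps X X (h \<circ> \<rho> g \<circ> k) (h \<circ> \<rho> (inv\<^bsub>G\<^esub> g) \<circ> k)"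
      unfolding homeomorphic_maps_def
      using cc[OF g] cc[OF inv_closed[OF g]] inv[OF g] inv[OF inv_closed[OF g]] act_inv[OF g] kX(1) by auto
  qed (use g in auto)
  moreover have "homeomorphic_maps X X h k" using kh homeomorphic_maps_sym by blast
  ultimately show ?thesis unfolding conjugated_to_smooth_action_def by blast
qed

theorem mainTheorem2:
  fixes X :: "'a topology"
    and \<A> :: "('a, real ^ 3) chart set"
    and G :: "('g, 'm) monoid_scheme"
    and \<rho> :: "'g \<Rightarrow> 'a \<Rightarrow> 'a"
  assumes "closed_smooth_manifold X \<A>"
    and "group G"
    and "cyclic_group G"
    and "finite (carrier G)"
    and "Cr_action 1 G X \<A> \<rho>"
  shows "conjugated_to_smooth_action G X \<A> \<rho>"
  using finite_C1_action_conjugated assms(1,4,5) .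

end
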